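(* Let $(X,d,\mu)$ be a complete metric measure space with $\mu$ doubling, let $1<p<\infty$, assume that $X$ supports a $p$-Poincaré inequality, and let $Q>0$ be an order for which $X$ has relative lower volume decay. Let $0<\delta<\infty$, $1<q<p$, and let $u\in N^{1,p}(X)$ be defined pointwise everywhere by $$u(x)=\limsup_{r\to 0}\frac{1}{\mu(B(x,r))}\int_{B(x,r)}u\,d\mu ,\qquad x\in X.$$ Then the following hold. (i) If $p<Q$ and $0<h\le \frac{Qp}{Q-p}$, or if $p=Q$ and $h>0$, then for $q$-quasievery $x\in X$, $$\int_0^{\delta}\left(\frac{1}{\mu(B(x,r))}\int_{B(x,r)}|u-u(x)|^h\,d\mu\right)^{\frac{p}{h(p-1)}}\frac{dr}{r}<\infty .$$ (ii) If $p>Q$ and $h>0$, then $$\int_X\left(\int_0^{\delta}\left(\frac{1}{\mu(B(x,r))}\int_{B(x,r)}|u-u(x)|^h\,d\mu\right)^{\frac{p}{h(p-1)}}\frac{dr}{r}\right)^{p-1}d\mu(x)<\infty .$$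
   Context: $X=(X,d,\mu)$ is a complete metric space with a positive Borel regular measure $\mu$ such that $0<\mu(B)<\infty$ for every open ball $B=B(x,r)$, and $\mu$ is doubling: there is $C_\mu>0$ with $\mu(2B)\le C_\mu\mu(B)$ for all balls $B$. Here $\sigma B$ denotes the ball with the same centre as $B$ and $\sigma$ times its radius. Relative lower volume decay of order $Q>0$: there is $C>0$ such that $\frac{\mu(B(y,r))}{\mu(B(x,R))}\ge C\left(\frac rR\right)^Q$ whenever $x\in X$, $y\in B(x,R)$ and $0<r\le R<\infty$. Curves are non-constant, compact and rectifiable, parameterized by arc length $ds$. For $1<s<\infty$, a property holds for $s$-almost every curve if there is a non-negative Borel function $\rho\in L^s(X)$ with $\int_\gamma\rho\,ds=\infty$ for every curve $\gamma$ for which the property fails. A non-negative Borel function $g$ on $X$ is an upper gradient of $u:X\to\mathbb R$ if $|u(\gamma(0))-u(\gamma(l))|\le\int_\gamma g\,ds$ for all curves $\gamma:[0,l]\to X$; it is an $s$-weak upper gradient if this holds for $s$-almost every curve. $X$ supports a $p$-Poincaré inequality if there are constants $C>0$ and $\sigma\ge1$ such that for all balls $B\subset X$, all integrable functions $u$ on $X$ and all $p$-weak upper gradients $g$ of $u$, $\frac1{\mu(B)}\int_B|u-u_B|\,d\mu\le C\,\mathrm{diam}(B)\left(\frac1{\mu(\sigma B)}\int_{\sigma B}g^p\,d\mu\right)^{1/p}$, where $u_B=\frac1{\mu(B)}\int_Bu\,d\mu$. Newton-Sobolev space: for $1<s<\infty$, $\tilde N^{1,s}(X)$ is the collection of everywhere-defined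 functions $u\in L^s(X)$ having an upper gradient in $L^s(X)$, with seminorm $\|u\|_{\tilde N^{1,s}(X)}=\left(\int_X|u|^s\,d\mu+\inf_g\int_Xg^s\,d\mu\right)^{1/s}$, the infimum being over all upper gradients $g$ of $u$; $N^{1,s}(X)=\tilde N^{1,s}(X)/\sim$, where $u\sim v$ iff $\|u-v\|_{\tilde N^{1,s}(X)}=0$, with the quotient norm. The $s$-capacity of $E\subset X$ is $C_s(E)=\inf\|u\|_{N^{1,s}(X)}^s$ over all $u\in N^{1,s}(X)$ with $u\ge1$ on $E$. A property holds for $s$-quasievery $x$ ($s$-q.e.) if it holds outside a set of $s$-capacity zero. *)

theory Defs
  imports "HOL-Analysis.Analysis"
begin

text \<open>Powers of extended non-negative numbers, used for positive exponents only.\<close>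

definition epowr :: "ennreal \<Rightarrow> real \<Rightarrow> ennreal"  (infixr "epowr" 80) where
  "x epowr a = (if x = \<infinity> then \<infinity> else ennreal (enn2real x powr a))"

text \<open>
  A Borel regular measure is represented by a complete measure whose sigma-algebra contains
  the Borel sets and in which every measurable set has a Borel hull of the same measure. In the
  presence of finite measure on balls this is the same as a Borel regular outer measure
  restricted to its Caratheodory measurable sets. Completeness of the metric space is
  carried by the type class.
\<close>

locale metric_measure_space = complete_measure M for M :: "'a::complete_space measure" +
  assumes borel_measurable_sets: "sets borel \<subseteq> sets M"
    and borel_regular: "\<And>A. A \<in> sets M \<Longrightarrow> \<exists>B\<in>sets borel. A \<subseteq> B \<and> emeasure M B = emeasure M A"
    and ball_pos: "\<And>x r. 0 < r \<Longrightarrow> 0 < emeasure M (ball x r)"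
    and ball_finite: "\<And>x r. 0 < r \<Longrightarrow> emeasure M (ball x r) < \<infinity>"

definition doubling :: "'a::metric_space measure \<Rightarrow> bool" where
  "doubling M \<longleftrightarrow> (\<exists>C>0. \<forall>x r. 0 < r \<longrightarrow>
     measure M (ball x (2 * r)) \<le> C * measure M (ball x r))"

definition relative_lower_volume_decay :: "'a::metric_space measure \<Rightarrow> real \<Rightarrow> bool" where
  "relative_lower_volume_decay M Q \<longleftrightarrow> (\<exists>C>0. \<forall>x R. \<forall>y\<in>ball x R. \<forall>r. 0 < r \<and> r \<le> R \<longrightarrow>
     measure M (ball y r) / measure M (ball x R) \<ge> C * (r / R) powr Q)"

definition average :: "'a measure \<Rightarrow> 'a set \<Rightarrow> ('a \<Rightarrow> real) \<Rightarrow> real" where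
  "average M B u = (LINT y:B|M. u y) / measure M B"

definition nn_average :: "'a measure \<Rightarrow> 'a set \<Rightarrow> ('a \<Rightarrow> ennreal) \<Rightarrow> ennreal" where
  "nn_average M B f = (\<integral>\<^sup>+y\<in>B. f y \<partial>M) / emeasure M B"

definition curve_length :: "(real \<Rightarrow> 'a::metric_space) \<Rightarrow> real \<Rightarrow> real \<Rightarrow> ennreal" where
  "curve_length \<gamma> a b =
     (SUP (n, t) \<in> {(n :: nat, t :: nat \<Rightarrow> real). mono_on {..n} t \<and> t ` {..n} \<subseteq> {a..b}}.
        \<Sum>i<n. ennreal (dist (\<gamma> (t i)) (\<gamma> (t (Suc i)))))"

text \<open>
  \<open>curve l \<gamma>\<close>: the restriction of \<open>\<gamma>\<close> to \<open>{0..l}\<close> is a rectifiable curve of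
  length \<open>l\<close> parameterized by arc length; it is non-constant because \<open>l > 0\<close>.
\<close>

definition curve :: "real \<Rightarrow> (real \<Rightarrow> 'a::metric_space) \<Rightarrow> bool" where
  "curve l \<gamma> \<longleftrightarrow> 0 < l \<and> continuous_on {0..l} \<gamma> \<and>
     (\<forall>a b. 0 \<le> a \<and> a \<le> b \<and> b \<le> l \<longrightarrow> curve_length \<gamma> a b = ennreal (b - a))"

definition curve_integral :: "real \<Rightarrow> (real \<Rightarrow> 'a) \<Rightarrow> ('a \<Rightarrow> ennreal) \<Rightarrow> ennreal" where
  "curve_integral l \<gamma> g = (\<integral>\<^sup>+t\<in>{0..l}. g (\<gamma> t) \<partial>lborel)"

text \<open>
  Non-negative Borel functions on the space (upper gradients and the functions \<open>\<rho>\<close> below)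
  may take the value infinity, as is usual for upper gradients.
\<close>

definition almost_every_curve ::
    "'a::metric_space measure \<Rightarrow> real \<Rightarrow> (real \<Rightarrow> (real \<Rightarrow> 'a) \<Rightarrow> bool) \<Rightarrow> bool" where
  "almost_every_curve M s P \<longleftrightarrow> (\<exists>\<rho> :: 'a \<Rightarrow> ennreal.
     \<rho> \<in> borel_measurable borel \<and> (\<integral>\<^sup>+x. \<rho> x epowr s \<partial>M) < \<infinity> \<and>
     (\<forall>l \<gamma>. curve l \<gamma> \<and> \<not> P l \<gamma> \<longrightarrow> curve_integral l \<gamma> \<rho> = \<infinity>))"

definition upper_gradient :: "('a::metric_space \<Rightarrow> real) \<Rightarrow> ('a \<Rightarrow> ennreal) \<Rightarrow> bool" where
  "upper_gradient u g \<longleftrightarrow> g \<in> borel_measurable borel \<and>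
     (\<forall>l \<gamma>. curve l \<gamma> \<longrightarrow> ennreal \<bar>u (\<gamma> 0) - u (\<gamma> l)\<bar> \<le> curve_integral l \<gamma> g)"

definition weak_upper_gradient ::
    "'a::metric_space measure \<Rightarrow> real \<Rightarrow> ('a \<Rightarrow> real) \<Rightarrow> ('a \<Rightarrow> ennreal) \<Rightarrow> bool" where
  "weak_upper_gradient M s u g \<longleftrightarrow> g \<in> borel_measurable borel \<and>
     almost_every_curve M s (\<lambda>l \<gamma>. ennreal \<bar>u (\<gamma> 0) - u (\<gamma> l)\<bar> \<le> curve_integral l \<gamma> g)"

definition supports_poincare :: "'a::metric_space measure \<Rightarrow> real \<Rightarrow> bool" where
  "supports_poincare M p \<longleftrightarrow> (\<exists>C>0. \<exists>\<sigma>\<ge>1. \<forall>x r u g.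
     0 < r \<and> integrable M u \<and> weak_upper_gradient M p u g \<longrightarrow>
     ennreal (average M (ball x r) (\<lambda>y. \<bar>u y - average M (ball x r) u\<bar>))
       \<le> ennreal (C * diameter (ball x r)) *
          (nn_average M (ball x (\<sigma> * r)) (\<lambda>y. g y epowr p)) epowr (1 / p))"

text \<open>
  The set of everywhere defined functions whose quotient by the relation of vanishing
  \<open>newton_norm\<close> distance is the Newton-Sobolev space. Elements of the quotient are handled
  through representatives, and the quotient norm of a class is \<open>newton_norm\<close> of any of them.
\<close>

definition newton_space :: "'a::metric_space measure \<Rightarrow> real \<Rightarrow> ('a \<Rightarrow> real) set" where
  "newton_space M s = {u. u \<in> borel_measurable M \<and> (\<integral>\<^sup>+x. ennreal (\<bar>u x\<bar> powr s) \<partial>M) < \<infinity> \<and>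
     (\<exists>g. upper_gradient u g \<and> (\<integral>\<^sup>+x. g x epowr s \<partial>M) < \<infinity>)}"

definition newton_norm :: "'a::metric_space measure \<Rightarrow> real \<Rightarrow> ('a \<Rightarrow> real) \<Rightarrow> ennreal" where
  "newton_norm M s u =
     ((\<integral>\<^sup>+x. ennreal (\<bar>u x\<bar> powr s) \<partial>M) +
      (INF g\<in>{g. upper_gradient u g}. \<integral>\<^sup>+x. g x epowr s \<partial>M)) epowr (1 / s)"

definition capacity :: "'a::metric_space measure \<Rightarrow> real \<Rightarrow> 'a set \<Rightarrow> ennreal" where
  "capacity M s E = (INF u\<in>{u \<in> newton_space M s. \<forall>x\<in>E. 1 \<le> u x}. newton_norm M s u epowr s)"

definition quasievery :: "'a::metric_space measure \<Rightarrow> real \<Rightarrow> ('a \<Rightarrow> bool) \<Rightarrow> bool" where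
  "quasievery M s P \<longleftrightarrow> (\<exists>E. capacity M s E = 0 \<and> (\<forall>x. x \<notin> E \<longrightarrow> P x))"

text \<open>
  The limsup of the averages may be infinite on an exceptional set, hence the extended real
  values. The result depends only on the class of \<open>f\<close> up to null sets.
\<close>

definition limsup_representative ::
    "'a::metric_space measure \<Rightarrow> ('a \<Rightarrow> real) \<Rightarrow> 'a \<Rightarrow> ereal" where
  "limsup_representative M f x = Limsup (at_right 0) (\<lambda>r. ereal (average M (ball x r) f))"

text \<open>
  The inner integral \<open>\<integral>\<^sub>0\<^sup>\<delta> (\<dots>) dr/r\<close>. Note that \<open>\<bar>u y - u x\<bar> = \<infinity>\<close> for all \<open>y\<close>
  whenever \<open>u x\<close> is infinite (with \<open>\<infinity> - \<infinity> = \<infinity>\<close> in \<^typ>\<open>ereal\<close>), so the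
  integral is infinite at such points.
\<close>

definition oscillation_integral ::
    "'a::metric_space measure \<Rightarrow> real \<Rightarrow> real \<Rightarrow> real \<Rightarrow> ('a \<Rightarrow> ereal) \<Rightarrow> 'a \<Rightarrow> ennreal" where
  "oscillation_integral M p h \<delta> u x =
     (\<integral>\<^sup>+r\<in>{0<..<\<delta>}.
        (nn_average M (ball x r) (\<lambda>y. e2ennreal \<bar>u y - u x\<bar> epowr h)) epowr (p / (h * (p - 1)))
          * ennreal (1 / r) \<partial>lborel)"

end

theory Submission
  imports Defs
begin

text \<open>
  Let \<open>\<nu> = g\<^sup>p \<mu>\<close> for an upper gradient \<open>g\<close> of \<open>f\<close>. The Poincare inequality, telescoped over
  the balls \<open>B(x, r / 2\<^sup>k)\<close>, bounds the distance from \<open>u x\<close> to the mean of \<open>f\<close> on \<open>B(x, r)\<close> by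
  \<open>r T\<close>, once \<open>\<nu> B(x, 2 \<sigma> r) \<le> T\<^sup>p \<mu> B(x, r)\<close> and the densities at the smaller scales grow at most
  like \<open>2\<close> to the power \<open>k \<beta> p\<close> with \<open>\<beta> < 1\<close>.

  If \<open>p \<le> Q\<close>, the set where the upper density \<open>r\<^sup>q \<nu> B(x, r) / \<mu> B(x, r)\<close> is infinite has zero
  \<open>q\<close>-capacity, by a Vitali covering and a supremum of cutoff functions. Outside of it
  \<open>T\<close> may be taken proportional to the power \<open>- q / p\<close> of \<open>r\<close>, and as \<open>q < p\<close> the quantity \<open>r T\<close>
  decays geometrically along dyadic radii. The Sobolev-Poincare inequality, obtained from its
  weak form by truncation, handles exponents \<open>h\<close> up to the critical one; for \<open>p = Q\<close> the order \<open>Q\<close> is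
  first increased.

  If \<open>p > Q\<close>, volume decay gives \<open>\<beta> = Q / p\<close> at every point, hence a Morrey estimate with
  \<open>T\<^sup>p\<close> comparable to \<open>\<nu> B(x, 2 \<sigma> r) / \<mu> B(x, r)\<close>; by Fubini and doubling the \<open>\<mu>\<close>-integral of this
  ratio is bounded independently of \<open>r\<close>.
\<close>

text \<open>With \<open>t = r * T\<close> at radius \<open>r\<close>, the mean of
  \<open>\<bar>u - u x\<bar>\<close> to the power \<open>h\<close> is at most a constant times
  \<open>t powr h\<close>, so in both cases the integrand has size
  \<open>t powr (p / (p - 1))\<close>, whatever \<open>h\<close> is. For p \<le> Q any positive
  exponent would sum, with constants that depend on the point. For p > Q the outer power
  \<open>p - 1\<close> turns the exponent into \<open>p\<close>, and \<open>T powr p\<close> is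
  linear in \<nu>: this linearity is what lets Fubini act.

  Two obstacles shape the rest. The function \<open>u\<close> is built from means of
  \<open>f\<close>, while the Sobolev inequality speaks of \<open>f\<close>; that both agree almost
  everywhere is derived from a half-density form of approximate continuity combined with vanishing
  mean oscillation. Moreover the Poincare inequality is given for integrable functions and Borel
  gradients only, whereas truncations of \<open>f\<close> need not be integrable and their level
  sets need not be Borel. Localization and Borel hulls bridge this once, after which all estimates
  see only a pair of a function and a measure \<nu>.\<close>

lemma (in metric_measure_space) space_UNIV [simp]: "space M = UNIV"
  proof -
  have "UNIV \<in> sets (borel :: 'a measure)" using sets.top[of "borel :: 'a measure"] by simp
  then show ?thesis using sets.sets_into_space[of UNIV M] borel_measurable_sets by blast
qed

lemma (in metric_measure_space) borel_setD: "A \<in> sets borel \<Longrightarrow> A \<in> sets M"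
  using borel_measurable_sets by auto

lemma (in metric_measure_space) open_setD: "open A \<Longrightarrow> A \<in> sets M"
  by (intro borel_setD borel_open)

lemma (in metric_measure_space) ball_sets [measurable, simp]: "ball x r \<in> sets M"
  by (intro open_setD) auto

lemma (in metric_measure_space) borel_funD:
  "g \<in> borel_measurable borel \<Longrightarrow> g \<in> borel_measurable M"
  by (auto simp: measurable_def intro: borel_setD)

lemma (in metric_measure_space) ball_fin: "emeasure M (ball x r) < \<infinity>"
  by (cases "r > 0") (use ball_finite[of r x] in \<open>auto simp: not_less ball_empty\<close>)

lemma (in metric_measure_space) ball_fmeasurable [simp]: "ball x r \<in> fmeasurable M"
  using ball_fin by (intro fmeasurableI) auto

lemma (in metric_measure_space) emeasure_ball: "emeasure M (ball x r) = ennreal (measure M (ball x r))"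
  using ball_fin[of x r] by (simp add: emeasure_eq_ennreal_measure)

lemma (in metric_measure_space) measure_ball_pos: "0 < r \<Longrightarrow> 0 < measure M (ball x r)"
  using ball_pos[of r x] by (simp add: emeasure_ball)

lemma (in metric_measure_space) measure_ball_mono:
  "A \<subseteq> ball x r \<Longrightarrow> A \<in> sets M \<Longrightarrow> measure M A \<le> measure M (ball x r)"
  by (intro measure_mono_fmeasurable) auto

lemma UN_ball_nat: "(\<Union>n::nat. ball (x::'a::metric_space) (real n)) = UNIV"
  by (auto intro: reals_Archimedean2)

sublocale metric_measure_space \<subseteq> sigma_finite_measure M
proof
  show "\<exists>A. countable A \<and> A \<subseteq> sets M \<and> \<Union>A = space M \<and> (\<forall>a\<in>A. emeasure M a \<noteq> \<infinity>)"
    using UN_ball_nat[of undefined] ball_fin[of undefined]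
    by (intro exI[of _ "range (\<lambda>n::nat. ball undefined (real n))"]) (auto simp: less_top)
qed

text \<open>By disjointness at most \<open>Suc n\<close> times the total mass many sets can have
  measure above \<open>1 / Suc n\<close>, so each \<open>J n\<close> is finite and the index set is
  a countable union of finite sets.\<close>

lemma (in finite_measure) countable_disjoint_positive:
  assumes S: "\<And>i. i \<in> I \<Longrightarrow> S i \<in> sets M" and pos: "\<And>i. i \<in> I \<Longrightarrow> 0 < emeasure M (S i)"
    and d: "disjoint_family_on S I"
  shows "countable I"
proof -
  have pos': "0 < measure M (S i)" if "i \<in> I" for i
    using pos[OF that] emeasure_eq_measure[of "S i"] by (auto simp: zero_less_measure_iff emeasure_eq_measure)
  define J where "J n = {i\<in>I. measure M (S i) > 1 / real (Suc n)}" for n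
  have "I \<subseteq> (\<Union>n. J n)"
  proof
    fix i assume i: "i \<in> I"
    from reals_Archimedean[OF pos'[OF i]] obtain n where "inverse (real (Suc n)) < measure M (S i)" by auto
    then show "i \<in> (\<Union>n. J n)" using i by (auto simp: J_def field_simps)
  qed
  moreover have "finite (J n)" for n
  proof (rule ccontr)
    assume inf: "infinite (J n)"
    obtain k where k: "measure M (space M) * Suc n < real k" using reals_Archimedean2 by blast
    obtain F where F: "F \<subseteq> J n" "finite F" "card F = k"
      using infinite_arbitrarily_large[OF inf] by blast
    have "real k / Suc n = (\<Sum>i\<in>F. 1 / Suc n)" using F by simp
    also have "\<dots> \<le> (\<Sum>i\<in>F. measure M (S i))"
      using F by (intro sum_mono) (auto simp: J_def intro: less_imp_le)
    also have "\<dots> = measure M (\<Union>i\<in>F. S i)"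
      using F d S by (intro finite_measure_finite_Union[symmetric])
        (auto simp: J_def disjoint_family_on_def)
    also have "\<dots> \<le> measure M (space M)" by (intro bounded_measure)
    finally show False using k by (simp add: field_simps)
  qed
  ultimately have "countable (\<Union>n. J n)" "I \<subseteq> (\<Union>n. J n)" by (simp_all add: countable_finite)
  then show ?thesis by (rule countable_subset[rotated])
qed

text \<open>A set of positive measure meets some ball of integer radius about a fixed centre in
  positive measure, which reduces the claim to the finite measures obtained by restriction to these
  balls.\<close>

lemma (in metric_measure_space) countable_disjoint_positive:
  assumes S: "\<And>i. i \<in> I \<Longrightarrow> S i \<in> sets M" and pos: "\<And>i. i \<in> I \<Longrightarrow> 0 < emeasure M (S i)"
    and d: "disjoint_family_on S I"
  shows "countable I"
proof -
  fix x0 :: 'a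
  define J where "J n = {i\<in>I. 0 < emeasure M (S i \<inter> ball x0 (real n))}" for n
  have "I \<subseteq> (\<Union>n. J n)"
  proof
    fix i assume i: "i \<in> I"
    have "i \<in> (\<Union>n. J n)" if "\<forall>n. emeasure M (S i \<inter> ball x0 (real n)) = 0"
    proof -
      have "emeasure M (\<Union>n. S i \<inter> ball x0 (real n)) = 0"
        using that S[OF i] by (intro emeasure_UN_eq_0) auto
      moreover have "(\<Union>n. S i \<inter> ball x0 (real n)) = S i" using UN_ball_nat[of x0] by blast
      ultimately show ?thesis using pos[OF i] by simp
    qed
    then show "i \<in> (\<Union>n. J n)" using i by (auto simp: J_def zero_less_iff_neq_zero)
  qed
  moreover have "countable (J n)" for n
  proof -
    interpret R: finite_measure "restrict_space M (ball x0 (real n))"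
      using ball_fin by (intro finite_measureI) (auto simp: emeasure_restrict_space space_restrict_space less_top)
    show ?thesis
    proof (rule R.countable_disjoint_positive[where S="\<lambda>i. S i \<inter> ball x0 (real n)"])
      fix i assume "i \<in> J n"
      then show "S i \<inter> ball x0 (real n) \<in> sets (restrict_space M (ball x0 (real n)))"
        "0 < emeasure (restrict_space M (ball x0 (real n))) (S i \<inter> ball x0 (real n))"
        using S[of i] by (auto simp: J_def sets_restrict_space emeasure_restrict_space)
    qed (use d in \<open>auto simp: disjoint_family_on_def J_def\<close>)
  qed
  ultimately have "countable (\<Union>n. J n)" "I \<subseteq> (\<Union>n. J n)" by (simp_all)
  then show ?thesis by (rule countable_subset[rotated])
qed

section \<open>Vitali covering and doubling measures\<close>

text \<open>Zorn's lemma is applied to disjoint subfamilies \<open>H\<close> that are greedy: a ball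
  that meets \<open>H\<close> meets a member of at least half its radius. This property passes to
  unions of chains. A maximal \<open>H\<close> meets every ball, for otherwise one of the missed
  balls, of radius above half the supremum of their radii, could be added.\<close>

lemma vitali_covering_5r:
  fixes S :: "'a::metric_space set" and \<rho> :: "'a \<Rightarrow> real"
  assumes pos: "\<And>y. y \<in> S \<Longrightarrow> 0 < \<rho> y" and bd: "\<And>y. y \<in> S \<Longrightarrow> \<rho> y \<le> R"
  obtains D where "D \<subseteq> S" "disjoint_family_on (\<lambda>y. ball y (\<rho> y)) D"
    "S \<subseteq> (\<Union>y\<in>D. ball y (5 * \<rho> y))"
proof -
  define meets where "meets y z \<longleftrightarrow> ball y (\<rho> y) \<inter> ball z (\<rho> z) \<noteq> {}" for y z
  define \<A> where "\<A> = {H. H \<subseteq> S \<and> disjoint_family_on (\<lambda>y. ball y (\<rho> y)) H \<and>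
     (\<forall>y\<in>S. (\<exists>z\<in>H. meets y z) \<longrightarrow> (\<exists>z\<in>H. meets y z \<and> \<rho> y \<le> 2 * \<rho> z))}"
  have "\<exists>D\<in>\<A>. \<forall>X\<in>\<A>. D \<subseteq> X \<longrightarrow> X = D"
  proof (rule subset_Zorn')
    fix C assume "subset.chain \<A> C"
    then have C: "C \<subseteq> \<A>" and ch: "\<And>X Y. X \<in> C \<Longrightarrow> Y \<in> C \<Longrightarrow> X \<subseteq> Y \<or> Y \<subseteq> X"
      by (auto simp: subset.chain_def)
    have "disjoint_family_on (\<lambda>y. ball y (\<rho> y)) (\<Union>C)"
      unfolding disjoint_family_on_def
    proof (intro ballI impI)
      fix y z assume "y \<in> \<Union>C" "z \<in> \<Union>C" and ne: "y \<noteq> z"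
      then obtain X Y where "X \<in> C" "Y \<in> C" "y \<in> X" "z \<in> Y" by auto
      with ch[of X Y] obtain Z where "Z \<in> C" "y \<in> Z" "z \<in> Z" by blast
      with C ne show "ball y (\<rho> y) \<inter> ball z (\<rho> z) = {}"
        unfolding \<A>_def disjoint_family_on_def by blast
    qed
    moreover have "\<Union>C \<subseteq> S" using C unfolding \<A>_def by blast
    moreover have "\<exists>z\<in>\<Union>C. meets y z \<and> \<rho> y \<le> 2 * \<rho> z" if "y \<in> S" "\<exists>z\<in>\<Union>C. meets y z" for y
    proof -
      from that obtain z X where "X \<in> C" "z \<in> X" "meets y z" by blast
      moreover from this have "X \<in> \<A>" using C by blast
      ultimately have "\<exists>z\<in>X. meets y z \<and> \<rho> y \<le> 2 * \<rho> z"
        using \<open>y \<in> S\<close> unfolding \<A>_def by blast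
      with \<open>X \<in> C\<close> show ?thesis by blast
    qed
    ultimately show "\<Union>C \<in> \<A>" unfolding \<A>_def by blast
  qed
  then obtain D where D: "D \<in> \<A>" and mx: "\<And>X. X \<in> \<A> \<Longrightarrow> D \<subseteq> X \<Longrightarrow> X = D" by blast
  have meets_all: "\<exists>z\<in>D. meets y z" if y: "y \<in> S" for y
  proof (rule ccontr)
    assume no: "\<not> (\<exists>z\<in>D. meets y z)"
    define N where "N = {w\<in>S. \<not> (\<exists>z\<in>D. meets w z)}"
    have yN: "y \<in> N" using y no by (auto simp: N_def)
    have bddN: "bdd_above (\<rho> ` N)" using bd by (auto simp: N_def bdd_above_def)
    define s where "s = (SUP w\<in>N. \<rho> w)"
    have "0 < s" using pos[OF y] cSUP_upper[OF yN bddN] by (simp add: s_def)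
    then have "s / 2 < s" by simp
    then obtain w where w: "w \<in> N" "s / 2 < \<rho> w"
      unfolding s_def using less_cSUP_iff[of N \<rho>] bddN yN by blast
    have ws: "w \<in> S" and wD: "\<And>z. z \<in> D \<Longrightarrow> \<not> meets w z" using w by (auto simp: N_def)
    have ww: "meets w w" using pos[OF ws] by (auto simp: meets_def)
    have "insert w D \<in> \<A>"
      unfolding \<A>_def
    proof (intro CollectI conjI ballI impI)
      show "insert w D \<subseteq> S" using D ws by (auto simp: \<A>_def)
      show "disjoint_family_on (\<lambda>y. ball y (\<rho> y)) (insert w D)"
        using D wD by (fastforce simp: \<A>_def meets_def disjoint_family_on_def)
    next
      fix v assume v: "v \<in> S" "\<exists>z\<in>insert w D. meets v z"
      show "\<exists>z\<in>insert w D. meets v z \<and> \<rho> v \<le> 2 * \<rho> z"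
      proof (cases "\<exists>z\<in>D. meets v z")
        case True
        then show ?thesis using D v by (auto simp: \<A>_def)
      next
        case False
        then have "v \<in> N" using v by (auto simp: N_def)
        then have "\<rho> v \<le> s" unfolding s_def by (intro cSUP_upper bddN)
        then show ?thesis using v False w by auto
      qed
    qed
    then have "insert w D = D" by (intro mx) auto
    then show False using wD[of w] ww by auto
  qed
  show ?thesis
  proof
    show "D \<subseteq> S" "disjoint_family_on (\<lambda>y. ball y (\<rho> y)) D" using D by (auto simp: \<A>_def)
    show "S \<subseteq> (\<Union>y\<in>D. ball y (5 * \<rho> y))"
    proof
      fix y assume y: "y \<in> S"
      then obtain z where z: "z \<in> D" "meets y z" "\<rho> y \<le> 2 * \<rho> z"
        using meets_all[OF y] D by (auto simp: \<A>_def)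
      then obtain w where "dist y w < \<rho> y" "dist z w < \<rho> z" by (auto simp: meets_def)
      then have "dist z y < 5 * \<rho> z" using z dist_triangle[of z y w] pos[of z] D by (auto simp: dist_commute \<A>_def)
      then show "y \<in> (\<Union>y\<in>D. ball y (5 * \<rho> y))" using z by auto
    qed
  qed
qed

locale doubling_space = metric_measure_space M for M :: "'a::complete_space measure" +
  fixes Cd :: real
  assumes Cd_ge_1: "1 \<le> Cd"
    and doubling_ball: "\<And>x r. 0 < r \<Longrightarrow> measure M (ball x (2 * r)) \<le> Cd * measure M (ball x r)"

lemma (in doubling_space) doubling_iterate:
  assumes "0 < r" shows "measure M (ball x (2 ^ n * r)) \<le> Cd ^ n * measure M (ball x r)"
proof (induction n)
  case (Suc n)
  have "measure M (ball x (2 * (2 ^ n * r))) \<le> Cd * measure M (ball x (2 ^ n * r))"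
    using assms by (intro doubling_ball) auto
  also have "\<dots> \<le> Cd * (Cd ^ n * measure M (ball x r))"
    using Suc Cd_ge_1 by (intro mult_left_mono) auto
  finally show ?case by (simp add: mult.assoc)
qed auto

text \<open>An iterated doubling constant: enlargement by \<open>\<Lambda>\<close> is absorbed by
  the least sufficient number of doublings. One function serves the factors 4, 5, 7 and
  \<open>2 * \<sigma>\<close> that occur below.\<close>

definition (in doubling_space) growth :: "real \<Rightarrow> real" where
  "growth \<Lambda> = Cd ^ (LEAST n. \<Lambda> \<le> 2 ^ n)"

lemma (in doubling_space) growth_ge_1: "1 \<le> growth \<Lambda>"
  using Cd_ge_1 by (simp add: growth_def)

lemma (in doubling_space) growth_ball:
  assumes r: "0 < r" and sub: "ball x R \<subseteq> ball y (\<Lambda> * r)"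
  shows "measure M (ball x R) \<le> growth \<Lambda> * measure M (ball y r)"
proof -
  obtain n where n: "\<Lambda> < 2 ^ n" using real_arch_pow[of 2 \<Lambda>] by auto
  have "\<Lambda> \<le> 2 ^ (LEAST n. \<Lambda> \<le> 2 ^ n)" by (rule LeastI[of _ n]) (use n in auto)
  then have "ball x R \<subseteq> ball y (2 ^ (LEAST n. \<Lambda> \<le> 2 ^ n) * r)"
    using r by (intro order_trans[OF sub] subset_ball mult_right_mono) auto
  then have "measure M (ball x R) \<le> measure M (ball y (2 ^ (LEAST n. \<Lambda> \<le> 2 ^ n) * r))"
    by (rule measure_ball_mono) simp
  also have "\<dots> \<le> growth \<Lambda> * measure M (ball y r)"
    unfolding growth_def by (rule doubling_iterate[OF r])
  finally show ?thesis .
qed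

text \<open>The indicator of the union is at most the counting integral of the indicators, and for
  countable \<open>D\<close> the two integrals commute.\<close>

lemma (in metric_measure_space) emeasure_UN_le_count_space:
  assumes D: "countable D" and A: "\<And>i. i \<in> D \<Longrightarrow> A i \<in> sets M"
  shows "emeasure M (\<Union>i\<in>D. A i) \<le> (\<integral>\<^sup>+i. emeasure M (A i) \<partial>count_space D)"
proof -
  have "emeasure M (\<Union>i\<in>D. A i) = (\<integral>\<^sup>+x. indicator (\<Union>i\<in>D. A i) x \<partial>M)"
    using D A by (intro nn_integral_indicator[symmetric] sets.countable_UN'') auto
  also have "\<dots> \<le> (\<integral>\<^sup>+x. (\<integral>\<^sup>+i. indicator (A i) x \<partial>count_space D) \<partial>M)"
  proof (intro nn_integral_mono)
    fix x
    show "indicator (\<Union>i\<in>D. A i) x \<le> (\<integral>\<^sup>+i. indicator (A i) x \<partial>count_space D)"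
    proof (cases "x \<in> (\<Union>i\<in>D. A i)")
      case True
      then obtain j where j: "j \<in> D" "x \<in> A j" by auto
      then have "indicator (A j) x \<le> (\<integral>\<^sup>+i. indicator (A i) x \<partial>count_space D)"
        by (intro nn_integral_ge_point)
      with j True show ?thesis by simp
    qed auto
  qed
  also have "\<dots> = (\<integral>\<^sup>+i. (\<integral>\<^sup>+x. indicator (A i) x \<partial>M) \<partial>count_space D)"
    using D A by (intro nn_integral_count_space_nn_integral borel_measurable_indicator)
  also have "\<dots> = (\<integral>\<^sup>+i. emeasure M (A i) \<partial>count_space D)"
    using A by (intro nn_integral_cong) auto
  finally show ?thesis .
qed

lemma (in doubling_space) vitali_measure:
  fixes S :: "'a set"
  assumes pos: "\<And>y. y \<in> S \<Longrightarrow> 0 < \<rho> y" and bd: "\<And>y. y \<in> S \<Longrightarrow> \<rho> y \<le> R"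
  obtains D where "countable D" "D \<subseteq> S" "disjoint_family_on (\<lambda>y. ball y (\<rho> y)) D"
    "S \<subseteq> (\<Union>y\<in>D. ball y (5 * \<rho> y))"
proof -
  obtain D where D: "D \<subseteq> S" "disjoint_family_on (\<lambda>y. ball y (\<rho> y)) D"
    "S \<subseteq> (\<Union>y\<in>D. ball y (5 * \<rho> y))"
    by (rule vitali_covering_5r[OF assms])
  have "countable D"
  proof (rule countable_disjoint_positive[where S="\<lambda>y. ball y (\<rho> y)"])
    show "0 < emeasure M (ball y (\<rho> y))" if "y \<in> D" for y
      using that D(1) by (intro ball_pos pos) auto
  qed (use D in auto)
  then show ?thesis using D by (rule that)
qed

text \<open>The weak (1,1) argument: the selected balls are disjoint, so their
  \<open>N\<close>-masses add up to at most \<open>emeasure N U\<close>, and enlarging them by 5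
  costs only \<open>growth 5\<close>. The bound is carried by a measurable \<open>V\<close> because
  the set \<open>S\<close> of bad points may fail to be measurable.\<close>

lemma (in doubling_space) vitali_outer_measure:
  assumes pos: "\<And>y. y \<in> S \<Longrightarrow> 0 < \<rho> y" and bd: "\<And>y. y \<in> S \<Longrightarrow> \<rho> y \<le> R"
    and N: "sets N = sets M" and U: "U \<in> sets M" "\<And>y. y \<in> S \<Longrightarrow> ball y (\<rho> y) \<subseteq> U"
    and le: "\<And>y. y \<in> S \<Longrightarrow> emeasure M (ball y (\<rho> y)) \<le> c * emeasure N (ball y (\<rho> y))"
  obtains V where "V \<in> sets M" "S \<subseteq> V" "emeasure M V \<le> ennreal (growth 5) * c * emeasure N U"
proof -
  obtain D where D: "countable D" "D \<subseteq> S" "disjoint_family_on (\<lambda>y. ball y (\<rho> y)) D"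
    "S \<subseteq> (\<Union>y\<in>D. ball y (5 * \<rho> y))"
    by (rule vitali_measure[OF pos bd])
  have "emeasure M (\<Union>y\<in>D. ball y (5 * \<rho> y)) \<le> (\<integral>\<^sup>+y. emeasure M (ball y (5 * \<rho> y)) \<partial>count_space D)"
    by (intro emeasure_UN_le_count_space D) auto
  also have "\<dots> \<le> (\<integral>\<^sup>+y. ennreal (growth 5) * c * emeasure N (ball y (\<rho> y)) \<partial>count_space D)"
  proof (intro nn_integral_mono)
    fix y assume "y \<in> space (count_space D)"
    then have y: "y \<in> S" using D by auto
    have "emeasure M (ball y (5 * \<rho> y)) \<le> ennreal (growth 5 * measure M (ball y (\<rho> y)))"
      unfolding emeasure_ball using growth_ball[OF pos[OF y], of y "5 * \<rho> y" y 5] by (simp add: ennreal_leI)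
    also have "\<dots> = ennreal (growth 5) * emeasure M (ball y (\<rho> y))"
      using growth_ge_1[of 5] by (simp add: ennreal_mult emeasure_ball)
    also have "\<dots> \<le> ennreal (growth 5) * (c * emeasure N (ball y (\<rho> y)))"
      by (intro mult_left_mono le y) auto
    finally show "emeasure M (ball y (5 * \<rho> y)) \<le> ennreal (growth 5) * c * emeasure N (ball y (\<rho> y))"
      by (simp add: mult.assoc)
  qed
  also have "\<dots> = ennreal (growth 5) * c * (\<integral>\<^sup>+y. emeasure N (ball y (\<rho> y)) \<partial>count_space D)"
    by (rule nn_integral_cmult) auto
  also have "(\<integral>\<^sup>+y. emeasure N (ball y (\<rho> y)) \<partial>count_space D) = emeasure N (\<Union>y\<in>D. ball y (\<rho> y))"
    using D N by (intro emeasure_UN_countable[symmetric]) auto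
  also have "\<dots> \<le> emeasure N U" using U D N by (intro emeasure_mono) auto
  finally have "emeasure M (\<Union>y\<in>D. ball y (5 * \<rho> y)) \<le> ennreal (growth 5) * c * emeasure N U"
    by (simp add: mult_left_mono)
  moreover have "(\<Union>y\<in>D. ball y (5 * \<rho> y)) \<in> sets M" using D by auto
  ultimately show ?thesis using that D by blast
qed

text \<open>The countably many centres of a Vitali cover with constant radius
  \<open>1 / Suc n\<close> form a net of mesh \<open>5 / Suc n\<close>. Separability later makes
  \<open>dist x y < R\<close> measurable in the product of \<open>M\<close> with itself.\<close>

lemma (in doubling_space) separable:
  obtains D :: "'a set" where "countable D" "\<And>x e. 0 < e \<Longrightarrow> \<exists>c\<in>D. dist c x < e"
proof -
  define P where "P n D \<longleftrightarrow> countable D \<and> (\<forall>x. \<exists>c\<in>D. dist c x < 5 / real (Suc n))" for n and D :: "'a set"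
  have "\<exists>D. P n D" for n
  proof -
    obtain D :: "'a set" where D: "countable D" "UNIV \<subseteq> (\<Union>y\<in>D. ball y (5 * (1 / real (Suc n))))"
    proof (rule vitali_measure[of UNIV "\<lambda>_. 1 / real (Suc n)" "1 / real (Suc n)"])
      fix D :: "'a set"
      assume D: "countable D" "UNIV \<subseteq> (\<Union>y\<in>D. ball y (5 * (1 / real (Suc n))))"
      show thesis by (rule that[OF D])
    qed simp_all
    have "\<exists>c\<in>D. dist c x < 5 / real (Suc n)" for x
    proof -
      have "x \<in> (\<Union>y\<in>D. ball y (5 * (1 / real (Suc n))))" by (rule subsetD[OF D(2) UNIV_I])
      then obtain c where "c \<in> D" "x \<in> ball c (5 * (1 / real (Suc n)))" by (rule UN_E)
      then show ?thesis by (intro bexI[of _ c]) simp_all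
    qed
    then have "P n D" using D(1) by (simp add: P_def)
    then show ?thesis ..
  qed
  then obtain D where D: "\<And>n. P n (D n)" by metis
  show ?thesis
  proof (rule that[of "\<Union>n. D n"])
    show "countable (\<Union>n. D n)" using D by (intro countable_UN) (simp_all add: P_def)
  next
    fix x :: 'a and e :: real assume e: "0 < e"
    obtain n where n: "inverse (real (Suc n)) < e / 5" using reals_Archimedean[of "e/5"] e by auto
    obtain c where c: "c \<in> D n" "dist c x < 5 / real (Suc n)" using D[of n] unfolding P_def by blast
    from n have "5 / real (Suc n) < e" by (simp add: field_simps)
    with c(2) have "dist c x < e" by linarith
    with c(1) show "\<exists>c\<in>\<Union>n. D n. dist c x < e" by (intro bexI[of _ c]) auto
  qed
qed

section \<open>Outer regularity and approximate continuity\<close>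

text \<open>The sets that can be squeezed between a closed and an open set up to arbitrarily small
  measure contain the open sets and are stable under complements and countable unions.\<close>

lemma finite_measure_borel_approx:
  fixes e :: real and B :: "'b::metric_space set" and M :: "'b measure"
  assumes "finite_measure M" and M: "sets borel \<subseteq> sets M" and B: "B \<in> sets borel" and e: "0 < e"
  shows "\<exists>U F. open U \<and> closed F \<and> F \<subseteq> B \<and> B \<subseteq> U \<and> measure M (U - F) < e"
proof -
  interpret finite_measure M by fact
  have op: "A \<in> sets M" if "open A" for A using M that borel_open by blast
  have cl: "A \<in> sets M" if "closed A" for A using M that borel_closed by blast
  have spM: "space M = UNIV" using sets.sets_into_space[OF op[OF open_UNIV]] by auto
  have "B \<in> sigma_sets UNIV {S. open S}" using B by (simp add: borel_def)
  then show ?thesis using e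
  proof (induction B arbitrary: e rule: sigma_sets.induct)
    case (Basic S)
    then have S: "open S" by simp
    \<comment> \<open>The whole space is treated apart because \<open>infdist\<close> to the empty
      set is 0 by convention, which would make every \<open>F k\<close> empty. Any other open set is
      exhausted by the points at distance at least \<open>1 / Suc k\<close> from its
      complement.\<close>
    show ?case
    proof (cases "S = UNIV")
      case True
      then show ?thesis using Basic by (intro exI[of _ UNIV]) auto
    next
      case False
      define F where "F k = {x. infdist x (- S) \<ge> 1 / real (Suc k)}" for k
      have clF: "closed (F k)" for k
        unfolding F_def by (intro closed_Collect_le continuous_intros)
      have FS: "F k \<subseteq> S" for k
      proof
        fix x assume "x \<in> F k"
        moreover have "(0::real) < 1 / real (Suc k)" by simp
        ultimately have "infdist x (- S) \<noteq> 0" unfolding F_def by force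
        then show "x \<in> S" using infdist_zero[of x "- S"] by blast
      qed
      have "(\<Inter>k. S - F k) = {}"
      proof -
        have False if x: "\<And>k. x \<in> S - F k" for x
        proof -
          have "infdist x (- S) \<noteq> 0"
            using x[of 0] in_closed_iff_infdist_zero[of "- S" x] S False by auto
          then have "0 < infdist x (- S)" using infdist_nonneg[of x "- S"] by linarith
          then obtain k where "inverse (real (Suc k)) < infdist x (- S)" using reals_Archimedean by blast
          then show False using x[of k] by (auto simp: F_def field_simps)
        qed
        then show ?thesis by blast
      qed
      moreover have "(\<lambda>k. measure M (S - F k)) \<longlonglongrightarrow> measure M (\<Inter>k. S - F k)"
      proof (intro finite_Lim_measure_decseq decseq_SucI)
        show "range (\<lambda>k. S - F k) \<subseteq> sets M" using op[OF S] cl[OF clF] by auto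
        show "S - F (Suc k) \<subseteq> S - F k" for k
        proof -
          have "1 / real (Suc (Suc k)) \<le> 1 / real (Suc k)" by (simp add: field_simps)
          then show ?thesis unfolding F_def by (auto simp del: of_nat_Suc)
        qed
      qed
      ultimately have "(\<lambda>k. measure M (S - F k)) \<longlonglongrightarrow> 0" by (simp only: measure_empty)
      then have "\<forall>\<^sub>F k in sequentially. measure M (S - F k) < e"
        using Basic by (intro order_tendstoD)
      then obtain k where "measure M (S - F k) < e" by (auto simp: eventually_sequentially)
      then show ?thesis using S clF FS by blast
    qed
  next
    case Empty
    then show ?case by (intro exI[of _ "{}"]) auto
  next
    case (Compl A)
    from Compl.IH[OF \<open>0 < e\<close>] obtain U F where
      "open U" "closed F" "F \<subseteq> A" "A \<subseteq> U" "measure M (U - F) < e" by blast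
    moreover have "- F - - U = U - F" by blast
    ultimately show ?case by (intro exI[of _ "- F"] exI[of _ "- U"]) auto
  next
    case (Union A)
    have "\<exists>U F. open U \<and> closed F \<and> F \<subseteq> A i \<and> A i \<subseteq> U \<and> measure M (U - F) < (e / 4) * (1/2) ^ i" for i
      by (rule Union.IH) (use Union.prems in simp)
    then obtain U F where UF: "\<And>i. open (U i)" "\<And>i. closed (F i)" "\<And>i. F i \<subseteq> A i" "\<And>i. A i \<subseteq> U i"
      "\<And>i. measure M (U i - F i) < (e / 4) * (1/2) ^ i" by metis
    \<comment> \<open>An infinite union of the \<open>F i\<close> need not be closed, so only
      finitely many are kept. The sets \<open>D k\<close> decrease to a subset of the union of the
      \<open>U i - F i\<close>, which the weights \<open>(e / 4) * (1/2) ^ i\<close> keep below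
      \<open>e\<close>.\<close>
    define D where "D k = (\<Union>i. U i) - (\<Union>i<k. F i)" for k :: nat
    have sF: "(\<Union>i<k. F i) \<in> sets M" for k :: nat using cl[OF UF(2)] by auto
    have sU: "(\<Union>i. U i) \<in> sets M" using op[OF UF(1)] by auto
    have lim: "(\<lambda>k. measure M (D k)) \<longlonglongrightarrow> measure M (\<Inter>k. D k)"
    proof (intro finite_Lim_measure_decseq decseq_SucI)
      show "range D \<subseteq> sets M" using sF sU by (auto simp: D_def)
      show "D (Suc k) \<subseteq> D k" for k by (auto simp: D_def)
    qed
    have sm: "summable (\<lambda>i. (e / 4) * (1/2) ^ i :: real)" by (intro summable_mult summable_geometric) simp
    have "(\<Inter>k. D k) \<subseteq> (\<Union>i. U i - F i)" by (auto simp: D_def)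
    then have "measure M (\<Inter>k. D k) \<le> measure M (\<Union>i. U i - F i)"
      using op[OF UF(1)] cl[OF UF(2)] by (intro finite_measure_mono) auto
    also have "\<dots> \<le> (\<Sum>i. measure M (U i - F i))"
    proof (rule finite_measure_subadditive_countably)
      show "range (\<lambda>i. U i - F i) \<subseteq> sets M" using op[OF UF(1)] cl[OF UF(2)] by auto
      show "summable (\<lambda>i. measure M (U i - F i))"
        by (rule summable_comparison_test'[OF sm, of 0]) (use UF(5) in \<open>auto intro: less_imp_le\<close>)
    qed
    also have "\<dots> \<le> (\<Sum>i. (e / 4) * (1/2) ^ i)"
    proof (intro suminf_le sm)
      show "summable (\<lambda>i. measure M (U i - F i))"
        by (rule summable_comparison_test'[OF sm, of 0]) (use UF(5) in \<open>auto intro: less_imp_le\<close>)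
    qed (use UF(5) in \<open>auto intro: less_imp_le\<close>)
    also have "\<dots> = e / 2" by (subst suminf_mult) (auto simp: suminf_geometric)
    also have "\<dots> < e" using Union by simp
    finally have "\<forall>\<^sub>F k in sequentially. measure M (D k) < e" by (intro order_tendstoD(2)[OF lim])
    then obtain k where "measure M (D k) < e" by (auto simp: eventually_sequentially)
    moreover have "open (\<Union>i. U i)" "closed (\<Union>i<k. F i)" "(\<Union>i<k. F i) \<subseteq> (\<Union>i. A i)" "(\<Union>i. A i) \<subseteq> (\<Union>i. U i)"
      using UF by (auto intro!: closed_UN) blast+
    ultimately show ?case unfolding D_def by blast
  qed
qed

text \<open>Restricting \<open>M\<close> to the ball gives a finite measure, and the Borel
  approximation is applied to a Borel hull of \<open>A\<close>. Since \<open>A\<close> has finite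
  measure, the hull exceeds it by a null set only.\<close>

lemma (in metric_measure_space) outer_open:
  assumes A: "A \<in> sets M" "A \<subseteq> ball x0 R" and e: "0 < e"
  obtains U where "open U" "A \<subseteq> U" "emeasure M (U - A) < ennreal e"
proof -
  obtain B where B: "B \<in> sets borel" "A \<subseteq> B" "emeasure M B = emeasure M A"
    using borel_regular[OF A(1)] by blast
  define N where "N = density M (indicator (ball x0 R))"
  have eN: "emeasure N X = emeasure M (ball x0 R \<inter> X)" if "X \<in> sets M" for X
    using that unfolding N_def by (subst emeasure_density) (auto simp: indicator_inter_arith[symmetric])
  interpret N: finite_measure N
    using ball_fin[of x0 R] eN[of UNIV] sets.top[of M] by (intro finite_measureI) (auto simp: N_def less_top)
  have bN: "sets borel \<subseteq> sets N" using borel_measurable_sets by (simp add: N_def)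
  obtain U F where U: "open U" "closed F" "F \<subseteq> B" "B \<subseteq> U" "measure N (U - F) < e"
    using finite_measure_borel_approx[OF N.finite_measure_axioms bN B(1) e] by blast
  have sU: "U \<in> sets M" "F \<in> sets M" "B \<in> sets M" using U B by (auto intro: open_setD borel_setD)
  have finA: "emeasure M A < \<infinity>" using ball_fin[of x0 R] emeasure_mono[OF A(2), of M] by (auto simp: le_less_trans)
  have "emeasure M (B - A) = 0"
    using B A sU finA by (subst emeasure_Diff) auto
  then have nullBA: "B - A \<in> null_sets M" using sU A by auto
  have "emeasure M (U \<inter> ball x0 R - A) \<le> emeasure M (ball x0 R \<inter> (U - F) \<union> (B - A))"
    using U A B sU by (intro emeasure_mono) auto
  also have "\<dots> = emeasure M (ball x0 R \<inter> (U - F))"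
    using nullBA sU by (intro emeasure_Un_null_set) auto
  also have "\<dots> = ennreal (measure N (U - F))"
    using sU by (subst N.emeasure_eq_measure[symmetric]) (simp add: eN)
  also have "\<dots> < ennreal e" using U e by (intro ennreal_lessI) auto
  finally have "emeasure M (U \<inter> ball x0 R - A) < ennreal e" .
  moreover have "open (U \<inter> ball x0 R)" "A \<subseteq> U \<inter> ball x0 R" using U A B by auto
  ultimately show ?thesis using that by blast
qed

text \<open>Even if \<open>S\<close> is not measurable, the intersection of covers of measure at
  most \<open>1 / Suc n\<close> is a measurable null set containing it.\<close>

lemma (in metric_measure_space) AE_not_in_small_covers:
  assumes "\<And>e. 0 < e \<Longrightarrow> \<exists>V\<in>sets M. S \<subseteq> V \<and> emeasure M V \<le> ennreal e"
  shows "AE y in M. y \<notin> S"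
proof -
  have "\<exists>V. V \<in> sets M \<and> S \<subseteq> V \<and> emeasure M V \<le> ennreal (1 / real (Suc n))" for n
    using assms[of "1 / real (Suc n)"] by auto
  then obtain V where V: "\<And>n. V n \<in> sets M" "\<And>n. S \<subseteq> V n" "\<And>n. emeasure M (V n) \<le> ennreal (1 / real (Suc n))"
    by metis
  have "emeasure M (\<Inter>n. V n) \<le> 0"
  proof (rule ennreal_le_epsilon)
    fix e :: real assume "0 < e"
    then obtain n where "inverse (real (Suc n)) < e" using reals_Archimedean by blast
    have "emeasure M (\<Inter>n. V n) \<le> emeasure M (V n)" using V by (intro emeasure_mono) auto
    also have "\<dots> \<le> ennreal (1 / real (Suc n))" by (rule V)
    also have "\<dots> \<le> ennreal e" using \<open>inverse (real (Suc n)) < e\<close> by (intro ennreal_leI) (simp add: field_simps)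
    finally show "emeasure M (\<Inter>n. V n) \<le> 0 + ennreal e" by simp
  qed
  then have "(\<Inter>n. V n) \<in> null_sets M" using V by (auto intro!: null_setsI)
  then show ?thesis by (rule AE_I') (use V in auto)
qed

text \<open>A weak form of the Lebesgue density theorem. A bad point of \<open>A\<close> has
  arbitrarily small balls with more than half of their mass outside \<open>A\<close>. Taken inside
  an open \<open>U\<close> around \<open>A\<close> with \<open>U - A\<close> small, these balls
  yield a cover of the bad points of small measure.\<close>

lemma (in doubling_space) AE_density:
  assumes A: "A \<in> sets M" "A \<subseteq> ball x0 R"
  shows "AE y in M. y \<in> A \<longrightarrow> (\<exists>s0>0. \<forall>s. 0 < s \<and> s < s0 \<longrightarrow>
    measure M (ball y s - A) \<le> measure M (ball y s) / 2)"
proof -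
  define S where "S = {y\<in>A. \<not> (\<exists>s0>0. \<forall>s. 0 < s \<and> s < s0 \<longrightarrow>
    measure M (ball y s - A) \<le> measure M (ball y s) / 2)}"
  have "AE y in M. y \<notin> S"
  proof (rule AE_not_in_small_covers)
    fix e :: real assume e: "0 < e"
    \<comment> \<open>Compensates the factor \<open>growth 5\<close> of the covering and the factor
      2 of the half-mass condition.\<close>
    define e' where "e' = e / (2 * growth 5)"
    have e': "0 < e'" using e growth_ge_1[of 5] by (simp add: e'_def)
    obtain U where U: "open U" "A \<subseteq> U" "emeasure M (U - A) < ennreal e'" by (rule outer_open[OF A e'])
    have "\<exists>s. 0 < s \<and> s \<le> 1 \<and> ball y s \<subseteq> U \<and> measure M (ball y s) \<le> 2 * measure M (ball y s - A)" if y: "y \<in> S" for y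
    proof -
      obtain s1 where s1: "0 < s1" "ball y s1 \<subseteq> U"
        using U y unfolding S_def by (metis (no_types, lifting) mem_Collect_eq openE subsetD)
      have "\<not> (\<forall>s. 0 < s \<and> s < min 1 s1 \<longrightarrow> measure M (ball y s - A) \<le> measure M (ball y s) / 2)"
        using y s1 unfolding S_def by (auto simp del: min_less_iff_conj)
      then obtain s where s: "0 < s" "s < min 1 s1" "\<not> measure M (ball y s - A) \<le> measure M (ball y s) / 2" by blast
      then have "ball y s \<subseteq> ball y s1" by (intro subset_ball) auto
      then show ?thesis using s s1 by (intro exI[of _ s]) auto
    qed
    then obtain \<rho> where \<rho>: "\<And>y. y \<in> S \<Longrightarrow> 0 < \<rho> y" "\<And>y. y \<in> S \<Longrightarrow> \<rho> y \<le> 1" "\<And>y. y \<in> S \<Longrightarrow> ball y (\<rho> y) \<subseteq> U"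
      "\<And>y. y \<in> S \<Longrightarrow> measure M (ball y (\<rho> y)) \<le> 2 * measure M (ball y (\<rho> y) - A)" by metis
    define N where "N = density M (indicator (- A))"
    have sA: "- A \<in> sets M" using sets.compl_sets[OF A(1)] by (simp add: Compl_eq_Diff_UNIV)
    have eN: "emeasure N X = emeasure M (X - A)" if "X \<in> sets M" for X
      using that sA unfolding N_def
      by (subst emeasure_density) (auto simp: indicator_inter_arith[symmetric] Diff_eq Int_commute)
    have sU: "U \<in> sets M" using U open_setD by auto
    have le: "emeasure M (ball y (\<rho> y)) \<le> 2 * emeasure N (ball y (\<rho> y))" if y: "y \<in> S" for y
    proof -
      have "emeasure M (ball y (\<rho> y) - A) = ennreal (measure M (ball y (\<rho> y) - A))"
        using A emeasure_mono[of "ball y (\<rho> y) - A" "ball y (\<rho> y)" M] ball_fin[of y "\<rho> y"]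
        by (intro emeasure_eq_ennreal_measure) auto
      then show ?thesis unfolding eN[OF ball_sets] emeasure_ball
        using ennreal_leI[OF \<rho>(4)[OF y]] by (simp add: ennreal_mult'')
    qed
    obtain V where V: "V \<in> sets M" "S \<subseteq> V" "emeasure M V \<le> ennreal (growth 5) * 2 * emeasure N U"
      by (rule vitali_outer_measure[of S \<rho> 1 N U 2, OF \<rho>(1) \<rho>(2) _ sU \<rho>(3) le]) (auto simp: N_def)
    have "emeasure M V \<le> ennreal (growth 5) * 2 * ennreal e'"
      using V(3) U(3) eN[OF sU] by (intro order_trans[OF V(3)] mult_left_mono) auto
    also have "\<dots> = ennreal (growth 5 * 2 * e')"
      using growth_ge_1[of 5] e' by (simp add: ennreal_mult)
    also have "growth 5 * 2 * e' = e" using growth_ge_1[of 5] by (simp add: e'_def)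
    finally show "\<exists>V\<in>sets M. S \<subseteq> V \<and> emeasure M V \<le> ennreal e" using V by blast
  qed
  then show ?thesis by eventually_elim (auto simp: S_def)
qed

text \<open>Weaker than the usual notion, where the deviating part has density zero. One half is
  enough for the use made of it: a small mean oscillation confines another kind of deviation to less
  than the other half.\<close>

definition (in metric_measure_space) approx_continuous :: "('a \<Rightarrow> real) \<Rightarrow> 'a \<Rightarrow> bool" where
  "approx_continuous v y \<longleftrightarrow> (\<forall>e>0. \<exists>s0>0. \<forall>s. 0 < s \<and> s < s0 \<longrightarrow>
     measure M {z\<in>ball y s. e \<le> \<bar>v z - v y\<bar>} \<le> measure M (ball y s) / 2)"

text \<open>The density statement is applied to the countably many sets where \<open>v\<close> lies
  between two rationals, cut with balls of integer radius. At a remaining point \<open>y\<close>,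
  rational bounds within \<open>e / 2\<close> of \<open>v y\<close> select the right set.\<close>

lemma (in doubling_space) AE_approx_continuous:
  assumes v[measurable]: "v \<in> borel_measurable M"
  shows "AE y in M. approx_continuous v y"
proof -
  fix x0 :: 'a
  define A where "A a b n = {z\<in>ball x0 (real n). of_rat a < v z \<and> v z < of_rat b}" for a b n
  have "AE y in M. \<forall>a b n. y \<in> A a b n \<longrightarrow> (\<exists>s0>0. \<forall>s. 0 < s \<and> s < s0 \<longrightarrow>
    measure M (ball y s - A a b n) \<le> measure M (ball y s) / 2)"
    unfolding AE_all_countable
  proof (intro allI)
    fix a b n
    have "A a b n = ball x0 (real n) \<inter> {z\<in>space M. of_rat a < v z \<and> v z < of_rat b}" by (auto simp: A_def)
    also have "\<dots> \<in> sets M" by measurable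
    finally show "AE y in M. y \<in> A a b n \<longrightarrow> (\<exists>s0>0. \<forall>s. 0 < s \<and> s < s0 \<longrightarrow>
      measure M (ball y s - A a b n) \<le> measure M (ball y s) / 2)"
      by (rule AE_density[of _ x0 "real n"]) (auto simp: A_def)
  qed
  then show ?thesis
  proof eventually_elim
    case (elim y)
    show ?case unfolding approx_continuous_def
    proof (intro allI impI)
      fix e :: real assume e: "0 < e"
      obtain a where a: "v y - e / 2 < of_rat a" "of_rat a < v y" using of_rat_dense[of "v y - e/2" "v y"] e by auto
      obtain b where b: "v y < of_rat b" "of_rat b < v y + e / 2" using of_rat_dense[of "v y" "v y + e/2"] e by auto
      obtain n where n: "dist x0 y < real n" using reals_Archimedean2 by blast
      have "y \<in> A a b n" using a b n by (simp add: A_def)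
      with elim obtain s0 where s0: "s0 > 0" "\<And>s. 0 < s \<Longrightarrow> s < s0 \<Longrightarrow>
        measure M (ball y s - A a b n) \<le> measure M (ball y s) / 2" by blast
      have "measure M {z \<in> ball y s. e \<le> \<bar>v z - v y\<bar>} \<le> measure M (ball y s) / 2" if s: "0 < s" "s < min s0 (real n - dist x0 y)" for s
      proof -
        have "z \<in> ball x0 (real n)" if "z \<in> ball y s" for z
          using that s dist_triangle[of x0 z y] by auto
        then have sub: "{z \<in> ball y s. e \<le> \<bar>v z - v y\<bar>} \<subseteq> ball y s - A a b n"
          using a b by (auto simp: A_def abs_if split: if_splits)
        have "A a b n = ball x0 (real n) \<inter> {z\<in>space M. of_rat a < v z \<and> v z < of_rat b}" by (auto simp: A_def)
        also have "\<dots> \<in> sets M" by measurable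
        finally have sA: "A a b n \<in> sets M" .
        have "{z \<in> ball y s. e \<le> \<bar>v z - v y\<bar>} = ball y s \<inter> {z\<in>space M. e \<le> \<bar>v z - v y\<bar>}" by auto
        also have "\<dots> \<in> sets M" by measurable
        finally have "measure M {z \<in> ball y s. e \<le> \<bar>v z - v y\<bar>} \<le> measure M (ball y s - A a b n)"
          using sA by (intro measure_mono_fmeasurable sub fmeasurable_Diff) auto
        also have "\<dots> \<le> measure M (ball y s) / 2" using s by (intro s0) auto
        finally show ?thesis .
      qed
      then show "\<exists>s0>0. \<forall>s. 0 < s \<and> s < s0 \<longrightarrow> measure M {z \<in> ball y s. e \<le> \<bar>v z - v y\<bar>} \<le> measure M (ball y s) / 2"
        using s0(1) n by (intro exI[of _ "min s0 (real n - dist x0 y)"]) auto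
    qed
  qed
qed

section \<open>Means over balls and their convergence\<close>

definition (in metric_measure_space) locally_integrable :: "('a \<Rightarrow> real) \<Rightarrow> bool" where
  "locally_integrable v \<longleftrightarrow> v \<in> borel_measurable M \<and> (\<forall>x r. set_integrable M (ball x r) v)"

lemma (in metric_measure_space) locally_integrable_diff_const:
  "locally_integrable v \<Longrightarrow> locally_integrable (\<lambda>z. v z - c)"
  using ball_fin unfolding locally_integrable_def set_integrable_def scaleR_diff_right
  by (auto simp: less_top intro!: Bochner_Integration.integrable_diff integrable_mult_left integrable_real_indicator)

lemma (in metric_measure_space) locally_integrable_abs:
  "locally_integrable v \<Longrightarrow> locally_integrable (\<lambda>z. \<bar>v z\<bar>)"
  by (auto simp: locally_integrable_def intro: set_integrable_abs)

lemma (in metric_measure_space) average_diff_const: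
  assumes v: "locally_integrable v" and r: "0 < r"
  shows "average M (ball x r) (\<lambda>z. v z - c) = average M (ball x r) v - c"
proof -
  have c: "set_integrable M (ball x r) (\<lambda>_. c)" using ball_fin[of x r]
    by (auto simp: set_integrable_def less_top intro!: integrable_mult_left integrable_real_indicator)
  have vi: "set_integrable M (ball x r) v" using v by (auto simp: locally_integrable_def)
  have "(LINT y:ball x r|M. v y - c) = (LINT y:ball x r|M. v y) - (LINT y:ball x r|M. c)"
    by (rule set_integral_diff(2)[OF vi c])
  also have "(LINT y:ball x r|M. c) = c * measure M (ball x r)"
    unfolding set_lebesgue_integral_def by simp
  finally show ?thesis using measure_ball_pos[OF r, of x] by (simp add: average_def field_simps)
qed

lemma (in metric_measure_space) average_nonneg: "(\<And>z. 0 \<le> w z) \<Longrightarrow> 0 \<le> average M B w"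
  unfolding average_def set_lebesgue_integral_def by (intro divide_nonneg_nonneg Bochner_Integration.integral_nonneg) auto

lemma (in metric_measure_space) average_subball:
  assumes v: "locally_integrable v" and s: "0 < s" and sub: "ball y s \<subseteq> ball x R"
    and N: "measure M (ball x R) \<le> N * measure M (ball y s)"
  shows "\<bar>average M (ball y s) v - c\<bar> \<le> N * average M (ball x R) (\<lambda>z. \<bar>v z - c\<bar>)"
proof -
  let ?w = "\<lambda>z. v z - c"
  have w: "locally_integrable ?w" "locally_integrable (\<lambda>z. \<bar>?w z\<bar>)"
    using locally_integrable_abs locally_integrable_diff_const[OF v] by auto
  have i: "set_integrable M (ball x r) ?w" "set_integrable M (ball x r) (\<lambda>z. \<bar>?w z\<bar>)" for x r
    using w by (auto simp: locally_integrable_def)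
  have p: "0 < measure M (ball y s)" using s by (rule measure_ball_pos)
  then have pR: "0 < measure M (ball x R)" using measure_ball_mono[OF sub] by simp
  have I0: "0 \<le> (LINT z:ball x R|M. \<bar>?w z\<bar>)"
    unfolding set_lebesgue_integral_def by (intro Bochner_Integration.integral_nonneg) auto
  have "\<bar>average M (ball y s) v - c\<bar> = \<bar>LINT z:ball y s|M. ?w z\<bar> / measure M (ball y s)"
    unfolding average_diff_const[OF v s, symmetric] using p by (simp add: average_def abs_divide)
  also have "\<dots> \<le> (LINT z:ball y s|M. \<bar>?w z\<bar>) / measure M (ball y s)"
    using p set_integral_norm_bound[OF i(1)] by (intro divide_right_mono) auto
  also have "\<dots> \<le> (LINT z:ball x R|M. \<bar>?w z\<bar>) / measure M (ball y s)"
  proof (intro divide_right_mono)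
    show "(LINT z:ball y s|M. \<bar>?w z\<bar>) \<le> (LINT z:ball x R|M. \<bar>?w z\<bar>)"
      using i(2) sub unfolding set_lebesgue_integral_def set_integrable_def
      by (intro integral_mono) (auto simp: indicator_def)
  qed (use p in simp)
  also have "\<dots> \<le> N * average M (ball x R) (\<lambda>z. \<bar>?w z\<bar>)"
    using p pR N mult_right_mono[OF N I0] by (simp add: average_def field_simps)
  finally show ?thesis .
qed

lemma (in metric_measure_space) markov_average:
  assumes w: "locally_integrable w" "\<And>z. 0 \<le> w z" and e: "0 < e" and r: "0 < r"
  shows "measure M {z\<in>ball x r. e \<le> w z} \<le> average M (ball x r) w * measure M (ball x r) / e"
proof -
  have wm[measurable]: "w \<in> borel_measurable M" using w by (simp add: locally_integrable_def)
  have wi: "set_integrable M (ball x r) w" using w by (simp add: locally_integrable_def)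
  let ?A = "{z\<in>ball x r. e \<le> w z}"
  have "?A = ball x r \<inter> {z\<in>space M. e \<le> w z}" by auto
  also have "\<dots> \<in> sets M" by measurable
  finally have A: "?A \<in> sets M" .
  have Af: "?A \<in> fmeasurable M" using A by (rule fmeasurableI2[OF ball_fmeasurable[of x r], rotated]) auto
  have Ai: "integrable M (\<lambda>z. e * indicator ?A z)"
    using Af by (intro integrable_mult_right integrable_real_indicator) (auto simp: fmeasurable_def)
  have "e * measure M ?A = (LINT z|M. e * indicator ?A z)" using Af by simp
  also have "\<dots> \<le> (LINT z|M. indicator (ball x r) z *\<^sub>R w z)"
    using w by (intro integral_mono Ai wi[unfolded set_integrable_def]) (auto simp: indicator_def)
  also have "\<dots> = average M (ball x r) w * measure M (ball x r)"
    using measure_ball_pos[OF r, of x] by (simp add: average_def set_lebesgue_integral_def)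
  finally show ?thesis using e by (simp add: field_simps)
qed

text \<open>If the mean stayed at distance \<open>e\<close> from \<open>v y\<close>, every point of
  the ball would be \<open>e / 2\<close> away from \<open>v y\<close> or from the mean. Approximate
  continuity leaves at most half of the ball to the former; Markov's inequality, with oscillation
  below \<open>e / 4\<close>, leaves strictly less than half to the latter.\<close>

lemma (in metric_measure_space) tendsto_average_approx_continuous:
  assumes v: "locally_integrable v" and ac: "approx_continuous v y"
    and s: "\<And>k. 0 < s k" "s \<longlonglongrightarrow> 0"
    and osc: "(\<lambda>k. average M (ball y (s k)) (\<lambda>z. \<bar>v z - average M (ball y (s k)) v\<bar>)) \<longlonglongrightarrow> 0"
  shows "(\<lambda>k. average M (ball y (s k)) v) \<longlonglongrightarrow> v y"
proof (rule LIMSEQ_I)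
  fix e :: real assume e: "0 < e"
  obtain s0 where s0: "0 < s0" "\<And>s. 0 < s \<Longrightarrow> s < s0 \<Longrightarrow>
     measure M {z\<in>ball y s. e / 2 \<le> \<bar>v z - v y\<bar>} \<le> measure M (ball y s) / 2"
    using ac e unfolding approx_continuous_def by (meson half_gt_zero)
  have "\<forall>\<^sub>F k in sequentially. s k < s0" using s(2) s0(1) by (rule order_tendstoD)
  moreover have "\<forall>\<^sub>F k in sequentially. average M (ball y (s k)) (\<lambda>z. \<bar>v z - average M (ball y (s k)) v\<bar>) < e / 4"
    using osc e by (intro order_tendstoD) auto
  ultimately have "\<forall>\<^sub>F k in sequentially. norm (average M (ball y (s k)) v - v y) < e"
  proof eventually_elim
    case (elim k)
    let ?B = "ball y (s k)" let ?m = "average M ?B v"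
    show ?case
    proof (rule ccontr)
      assume "\<not> ?thesis"
      then have far: "e \<le> \<bar>?m - v y\<bar>" by simp
      have w: "locally_integrable (\<lambda>z. \<bar>v z - ?m\<bar>)"
        by (intro locally_integrable_abs locally_integrable_diff_const v)
      have wm[measurable]: "v \<in> borel_measurable M" using v by (simp add: locally_integrable_def)
      have meas: "{z\<in>?B. c \<le> \<bar>v z - d\<bar>} \<in> fmeasurable M" for c d
      proof (rule fmeasurableI2[OF ball_fmeasurable[of y "s k"]])
        have "{z\<in>?B. c \<le> \<bar>v z - d\<bar>} = ?B \<inter> {z\<in>space M. c \<le> \<bar>v z - d\<bar>}" by auto
        also have "\<dots> \<in> sets M" by measurable
        finally show "{z\<in>?B. c \<le> \<bar>v z - d\<bar>} \<in> sets M" .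
      qed auto
      have p: "0 < measure M ?B" using s by (intro measure_ball_pos)
      have "measure M ?B \<le> measure M ({z\<in>?B. e / 2 \<le> \<bar>v z - v y\<bar>} \<union> {z\<in>?B. e / 2 \<le> \<bar>v z - ?m\<bar>})"
      proof (intro measure_mono_fmeasurable fmeasurable.Un meas ball_sets subsetI)
        fix z assume "z \<in> ?B"
        moreover have "e / 2 \<le> \<bar>v z - v y\<bar> \<or> e / 2 \<le> \<bar>v z - ?m\<bar>" using far by linarith
        ultimately show "z \<in> {z\<in>?B. e / 2 \<le> \<bar>v z - v y\<bar>} \<union> {z\<in>?B. e / 2 \<le> \<bar>v z - ?m\<bar>}" by blast
      qed
      also have "\<dots> \<le> measure M {z\<in>?B. e / 2 \<le> \<bar>v z - v y\<bar>} + measure M {z\<in>?B. e / 2 \<le> \<bar>v z - ?m\<bar>}"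
        by (intro measure_Un_le fmeasurableD meas)
      also have "\<dots> \<le> measure M ?B / 2 + average M ?B (\<lambda>z. \<bar>v z - ?m\<bar>) * measure M ?B / (e / 2)"
        using s elim e by (intro add_mono s0 markov_average w) auto
      also have "\<dots> < measure M ?B / 2 + (e / 4) * measure M ?B / (e / 2)"
        using elim e p by (intro add_strict_left_mono divide_strict_right_mono mult_strict_right_mono) auto
      also have "\<dots> = measure M ?B" using e by simp
      finally show False by simp
    qed
  qed
  then show "\<exists>no. \<forall>n\<ge>no. norm (average M (ball y (s n)) v - v y) < e"
    by (simp add: eventually_sequentially)
qed

section \<open>Telescoping the Poincare inequality\<close>

locale poincare_space = doubling_space M Cd
  for M :: "'a::complete_space measure" and Cd +
  fixes p C \<sigma> :: real
  assumes p_gt_1: "1 < p" and C_ge_1: "1 \<le> C" and \<sigma>_ge_1: "1 \<le> \<sigma>"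

text \<open>For \<nu> with density \<open>g\<close> to the power \<open>p\<close>, \<open>T\<close>
  bounds the mean of order \<open>p\<close> of \<open>g\<close> over the enlarged ball of the
  Poincare inequality. As a predicate with free \<open>T\<close> it accepts any upper bound and
  avoids a root of a possibly infinite quotient.\<close>

definition (in poincare_space) level :: "'a measure \<Rightarrow> 'a \<Rightarrow> real \<Rightarrow> real \<Rightarrow> bool" where
  "level \<nu> x r T \<longleftrightarrow> 0 \<le> T \<and>
     emeasure \<nu> (ball x (\<sigma> * r)) \<le> ennreal (T powr p * measure M (ball x (\<sigma> * r)))"

text \<open>
  The measure \<open>\<nu>\<close> plays the role of \<open>g\<^sup>p d\<mu>\<close> for an upper gradient \<open>g\<close> of \<open>v\<close>.
\<close>

definition (in poincare_space) poincare_pair :: "('a \<Rightarrow> real) \<Rightarrow> 'a measure \<Rightarrow> bool" where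
  "poincare_pair v \<nu> \<longleftrightarrow> locally_integrable v \<and> sets \<nu> = sets M \<and>
     (\<forall>x r T. 0 < r \<and> level \<nu> x r T \<longrightarrow>
        average M (ball x r) (\<lambda>z. \<bar>v z - average M (ball x r) v\<bar>) \<le> C * r * T)"

context poincare_space
begin

lemma levelI_subset:
  assumes T: "0 \<le> T" and \<nu>: "sets \<nu> = sets M" and sub: "ball y (\<sigma> * s) \<subseteq> U" "U \<in> sets M"
    and U: "emeasure \<nu> U \<le> ennreal m" and m: "m \<le> T powr p * measure M (ball y s)" and s: "0 < s"
  shows "level \<nu> y s T"
proof -
  have "ball y s \<subseteq> ball y (\<sigma> * s)" using s \<sigma>_ge_1 by (intro subset_ball) auto
  then have "measure M (ball y s) \<le> measure M (ball y (\<sigma> * s))" by (intro measure_ball_mono) auto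
  then have "m \<le> T powr p * measure M (ball y (\<sigma> * s))"
    using m by (meson mult_left_mono order_trans powr_ge_zero)
  moreover have "emeasure \<nu> (ball y (\<sigma> * s)) \<le> ennreal m"
    using sub \<nu> by (intro order_trans[OF emeasure_mono U]) auto
  ultimately show ?thesis using T unfolding level_def by (meson ennreal_leI order_trans)
qed

lemma poincare_pairD:
  assumes "poincare_pair v \<nu>" "0 < r" "level \<nu> x r T"
  shows "average M (ball x r) (\<lambda>z. \<bar>v z - average M (ball x r) v\<bar>) \<le> C * r * T"
  using assms by (auto simp: poincare_pair_def)

lemma average_subball_diff:
  assumes pp: "poincare_pair v \<nu>" and s: "0 < s" and sub: "ball y s \<subseteq> ball x R" and R: "0 < R"
    and N: "measure M (ball x R) \<le> N * measure M (ball y s)" and l: "level \<nu> x R T"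
  shows "\<bar>average M (ball y s) v - average M (ball x R) v\<bar> \<le> N * (C * R * T)"
proof -
  have "0 < N * measure M (ball y s)" using N measure_ball_pos[OF R, of x] by linarith
  then have N0: "0 \<le> N" using measure_ball_pos[OF s, of y] by (simp add: zero_less_mult_iff)
  have "\<bar>average M (ball y s) v - average M (ball x R) v\<bar>
      \<le> N * average M (ball x R) (\<lambda>z. \<bar>v z - average M (ball x R) v\<bar>)"
    using pp s sub N by (intro average_subball) (auto simp: poincare_pair_def)
  also have "\<dots> \<le> N * (C * R * T)"
    by (intro mult_left_mono N0 poincare_pairD[OF pp R l])
  finally show ?thesis .
qed

lemma average_halving:
  assumes pp: "poincare_pair v \<nu>" and r: "0 < r" and l: "level \<nu> y r T" and s: "r / 2 \<le> s" "s \<le> r"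
  shows "\<bar>average M (ball y s) v - average M (ball y r) v\<bar> \<le> Cd * (C * r * T)"
proof (rule average_subball_diff[OF pp _ _ r _ l])
  show "0 < s" "ball y s \<subseteq> ball y r" using r s by (auto intro!: subset_ball)
  have "measure M (ball y r) \<le> Cd * measure M (ball y (r / 2))"
    using doubling_ball[of "r / 2" y] r by simp
  also have "\<dots> \<le> Cd * measure M (ball y s)"
    using s Cd_ge_1 by (intro mult_left_mono measure_ball_mono subset_ball) auto
  finally show "measure M (ball y r) \<le> Cd * measure M (ball y s)" .
qed

lemma average_chain:
  assumes pp: "poincare_pair v \<nu>" and r: "0 < r" and l: "\<And>k. k < n \<Longrightarrow> level \<nu> y (r / 2 ^ k) (T k)"
  shows "\<bar>average M (ball y (r / 2 ^ n)) v - average M (ball y r) v\<bar> \<le> (\<Sum>k<n. Cd * (C * (r / 2 ^ k) * T k))"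
  using l
proof (induction n)
  case (Suc n)
  have "\<bar>average M (ball y (r / 2 ^ Suc n)) v - average M (ball y (r / 2 ^ n)) v\<bar> \<le> Cd * (C * (r / 2 ^ n) * T n)"
    using r by (intro average_halving[OF pp _ Suc.prems]) (auto simp: field_simps)
  with Suc show ?case by simp
qed simp

definition telescope :: "real \<Rightarrow> real" where
  "telescope \<beta> = Cd * C / (1 - 2 powr (\<beta> - 1))"

lemma telescope_nonneg: "\<beta> < 1 \<Longrightarrow> 0 \<le> telescope \<beta>"
  using Cd_ge_1 C_ge_1 powr_less_mono[of "\<beta> - 1" 0 2] by (auto simp: telescope_def)

lemma average_telescope:
  assumes pp: "poincare_pair v \<nu>" and r: "0 < r" and D: "0 \<le> D" and \<beta>: "\<beta> < 1"
    and l: "\<And>k. level \<nu> y (r / 2 ^ k) (D * 2 powr (\<beta> * real k))" and s: "0 < s" "s \<le> r"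
  shows "\<bar>average M (ball y s) v - average M (ball y r) v\<bar> \<le> telescope \<beta> * (r * D)"
proof -
  define \<theta> :: real where "\<theta> = 2 powr (\<beta> - 1)"
  have \<theta>: "0 < \<theta>" "\<theta> < 1" using \<beta> powr_less_mono[of "\<beta> - 1" 0 2] by (auto simp: \<theta>_def)
  have \<theta>k: "\<theta> ^ k = 2 powr (\<beta> * real k) / 2 ^ k" for k
    by (simp add: \<theta>_def powr_diff power_divide powr_realpow[symmetric] powr_powr powr_powr mult.commute)
  have trm: "Cd * (C * (r / 2 ^ k) * (D * 2 powr (\<beta> * real k))) = Cd * C * (r * D) * \<theta> ^ k" for k
    by (simp add: \<theta>k)
  obtain m where "r / s < 2 ^ m" using real_arch_pow[of 2 "r / s"] by auto
  then have ex: "\<exists>m. r / 2 ^ m < s" using s by (intro exI[of _ m]) (simp add: field_simps)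
  \<comment> \<open>As \<open>s \<le> r\<close>, \<open>m\<close> is positive, and its predecessor
    \<open>n\<close> has \<open>r / 2 ^ Suc n < s \<le> r / 2 ^ n\<close>. A single partial halving
    then leads from \<open>r / 2 ^ n\<close> to \<open>s\<close>.\<close>
  define m where "m = (LEAST m. r / 2 ^ m < s)"
  have m: "r / 2 ^ m < s" unfolding m_def by (rule LeastI_ex[OF ex])
  then have "m \<noteq> 0" using s by (intro notI) simp
  then obtain n where n: "m = Suc n" by (cases m) auto
  have ge: "s \<le> r / 2 ^ n" using not_less_Least[of n "\<lambda>m. r / 2 ^ m < s"] n by (simp add: m_def not_less)
  have "\<bar>average M (ball y s) v - average M (ball y (r / 2 ^ n)) v\<bar>
      \<le> Cd * (C * (r / 2 ^ n) * (D * 2 powr (\<beta> * real n)))"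
    using m n ge r by (intro average_halving[OF pp _ l]) auto
  moreover have "\<bar>average M (ball y (r / 2 ^ n)) v - average M (ball y r) v\<bar>
     \<le> (\<Sum>k<n. Cd * (C * (r / 2 ^ k) * (D * 2 powr (\<beta> * real k))))"
    by (intro average_chain[OF pp r l])
  ultimately have "\<bar>average M (ball y s) v - average M (ball y r) v\<bar>
     \<le> (\<Sum>k<Suc n. Cd * (C * (r / 2 ^ k) * (D * 2 powr (\<beta> * real k))))" by simp
  also have "\<dots> = Cd * C * (r * D) * (\<Sum>k<Suc n. \<theta> ^ k)"
    by (simp only: trm sum_distrib_left)
  also have "\<dots> \<le> Cd * C * (r * D) * (1 / (1 - \<theta>))"
  proof (intro mult_left_mono)
    show "(\<Sum>k<Suc n. \<theta> ^ k) \<le> 1 / (1 - \<theta>)"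
      using \<theta> by (subst sum_gp_strict) (auto intro!: divide_right_mono)
  qed (use Cd_ge_1 C_ge_1 r D in auto)
  finally show ?thesis by (simp add: telescope_def \<theta>_def field_simps)
qed

end

locale poincare_decay_space = poincare_space M Cd p C \<sigma>
  for M :: "'a::complete_space measure" and Cd p C \<sigma> +
  fixes c Q :: real
  assumes c_pos: "0 < c" and Q_pos: "0 < Q"
    and decay: "\<And>x y r R. y \<in> ball x R \<Longrightarrow> 0 < r \<Longrightarrow> r \<le> R \<Longrightarrow>
      c * (r / R) powr Q * measure M (ball x R) \<le> measure M (ball y r)"

context poincare_decay_space
begin

text \<open>Shrinking the ball does not increase its \<nu>-mass, and by volume decay it keeps at
  least the fraction \<open>c * 2 powr (- Q * k)\<close> of its measure. The root of order
  \<open>p\<close> of the quotient therefore grows at most by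
  \<open>c powr (- 1 / p) * 2 powr (Q / p * k)\<close>.\<close>

lemma level_dyadic:
  assumes \<nu>: "sets \<nu> = sets M" and y: "y \<in> ball x r" and T: "0 \<le> T" and r: "0 < r"
    and U: "emeasure \<nu> (ball x (2 * \<sigma> * r)) \<le> ennreal (T powr p * measure M (ball x r))"
  shows "level \<nu> y (r / 2 ^ k) ((T * c powr (- 1 / p)) * 2 powr (Q / p * real k))"
proof (rule levelI_subset[OF _ \<nu> _ ball_sets U])
  show "0 \<le> T * c powr (- 1 / p) * 2 powr (Q / p * real k)" using T by simp
  show "0 < r / 2 ^ k" using r by simp
  show "ball y (\<sigma> * (r / 2 ^ k)) \<subseteq> ball x (2 * \<sigma> * r)"
  proof
    fix z assume z: "z \<in> ball y (\<sigma> * (r / 2 ^ k))"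
    have "r / 2 ^ k \<le> r" using r by (simp add: divide_le_eq_1 field_simps mult_le_cancel_left1)
    then have "\<sigma> * (r / 2 ^ k) \<le> \<sigma> * r" using \<sigma>_ge_1 by (intro mult_left_mono) auto
    moreover have "r \<le> \<sigma> * r" using r \<sigma>_ge_1 by simp
    ultimately show "z \<in> ball x (2 * \<sigma> * r)" using y z dist_triangle[of x z y] by simp
  qed
  have pp: "0 < p" using p_gt_1 by simp
  have "(T * c powr (- 1 / p) * 2 powr (Q / p * real k)) powr p = T powr p * (1 / c) * 2 powr (Q * real k)"
  proof -
    have "(c powr (- 1 / p)) powr p = c powr (- 1)" "(2 powr (Q / p * real k)) powr p = 2 powr (Q * real k)"
      using pp by (simp_all add: powr_powr)
    moreover have "c powr (- 1) = 1 / c" using c_pos powr_minus_divide[of c 1] by simp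
    ultimately show ?thesis using T by (simp add: powr_mult)
  qed
  moreover have "c * (1 / 2 ^ k) powr Q * measure M (ball x r) \<le> measure M (ball y (r / 2 ^ k))"
  proof -
    have "c * ((r / 2 ^ k) / r) powr Q * measure M (ball x r) \<le> measure M (ball y (r / 2 ^ k))"
      using r by (intro decay y) (auto simp: field_simps mult_le_cancel_left1)
    then show ?thesis using r by simp
  qed
  moreover have "(1 / 2 ^ k) powr Q = 1 / 2 powr (Q * real k)"
    by (simp add: powr_divide powr_realpow[symmetric] powr_powr mult.commute)
  ultimately have "measure M (ball x r) \<le> (1 / c) * 2 powr (Q * real k) * measure M (ball y (r / 2 ^ k))"
    using c_pos by (simp add: field_simps)
  from mult_left_mono[OF this, of "T powr p"]
  show "T powr p * measure M (ball x r) \<le> (T * c powr (- 1 / p) * 2 powr (Q / p * real k)) powr p * measure M (ball y (r / 2 ^ k))"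
    unfolding \<open>(T * c powr (- 1 / p) * 2 powr (Q / p * real k)) powr p = T powr p * (1 / c) * 2 powr (Q * real k)\<close>
    by (simp add: mult.assoc)
qed

text \<open>Both means are compared with the mean over \<open>ball x (2 * r)\<close>, which contains
  both balls and lies in \<open>ball z (4 * r)\<close> for either centre \<open>z\<close>. Two
  comparisons at radius \<open>2 * r\<close> produce the factor \<open>4 * growth 4\<close>.\<close>

lemma average_nearby:
  assumes pp: "poincare_pair v \<nu>" and y: "y \<in> ball x r" and T: "0 \<le> T" and r: "0 < r"
    and U: "emeasure \<nu> (ball x (2 * \<sigma> * r)) \<le> ennreal (T powr p * measure M (ball x r))"
  shows "\<bar>average M (ball y r) v - average M (ball x r) v\<bar> \<le> 4 * growth 4 * C * (r * T)"
proof -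
  have \<nu>: "sets \<nu> = sets M" using pp by (simp add: poincare_pair_def)
  have l: "level \<nu> x (2 * r) T"
  proof (rule levelI_subset[OF T \<nu> _ ball_sets U])
    show "T powr p * measure M (ball x r) \<le> T powr p * measure M (ball x (2 * r))"
      using r by (intro mult_left_mono measure_ball_mono subset_ball) auto
  qed (use r in \<open>auto simp: mult.assoc mult.left_commute\<close>)
  have *: "\<bar>average M (ball z r) v - average M (ball x (2 * r)) v\<bar> \<le> growth 4 * (C * (2 * r) * T)"
    if z: "z \<in> ball x r" for z
  proof (rule average_subball_diff[OF pp r _ _ _ l])
    have tri: "dist x w \<le> dist x z + dist z w" "dist z w \<le> dist x z + dist x w" for w
      using dist_triangle[of x w z] dist_triangle[of z w x] by (auto simp: dist_commute)
    show "ball z r \<subseteq> ball x (2 * r)"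
    proof
      fix w assume "w \<in> ball z r" then show "w \<in> ball x (2 * r)" using z tri(1)[of w] by simp
    qed
    have "ball x (2 * r) \<subseteq> ball z (4 * r)"
    proof
      fix w assume "w \<in> ball x (2 * r)" then show "w \<in> ball z (4 * r)" using z r tri(2)[of w] by simp
    qed
    then show "measure M (ball x (2 * r)) \<le> growth 4 * measure M (ball z r)"
      by (rule growth_ball[OF r])
  qed (use r in simp)
  have "x \<in> ball x r" using r by simp
  from *[OF y] *[OF this] show ?thesis by (simp add: algebra_simps)
qed

end

section \<open>The Sobolev-Poincare inequality\<close>

locale sobolev_space = poincare_decay_space M Cd p C \<sigma> c Q
  for M :: "'a::complete_space measure" and Cd p C \<sigma> c Q +
  assumes p_less_Q: "p < Q"

context sobolev_space
begin

text \<open>The Sobolev conjugate of \<open>p\<close> in dimension \<open>Q\<close>; it enters the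
  estimates through \<open>P / p - P / Q = 1\<close>.\<close>

definition P :: real where "P = Q * p / (Q - p)"

lemma P_identities: "P / p - P / Q = 1" "P > p" "P > 1"
proof -
  have *: "0 < p" "0 < Q" "0 < Q - p" using p_gt_1 p_less_Q by auto
  have "P / p - P / Q = (Q - p) / (Q - p)"
    using *(1,2) by (simp only: P_def diff_divide_distrib[of Q p "Q - p"]) simp
  then show "P / p - P / Q = 1" using *(3) by simp
  have "p * (Q - p) < Q * p" using * by (simp add: field_simps)
  with * show "P > p" by (simp add: P_def field_simps)
  with p_gt_1 show "P > 1" by simp
qed

text \<open>A splitting of the chain of balls at a radius \<open>s\<close>, in the manner of
  Hedberg. With \<open>\<tau> = t / (r * T)\<close>, \<open>s\<close> is about
  \<open>r / \<tau> powr (P / Q)\<close>. Below \<open>s\<close> the assumed level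
  \<open>a = T * \<tau> powr (P / p)\<close> gives at most a multiple of \<open>s * a\<close>, hence
  of \<open>t\<close>, because \<open>P / p - P / Q = 1\<close>. Above \<open>s\<close> volume decay
  gives a geometric sum with ratio \<open>\<phi> > 1\<close>. It is dominated by its last power,
  which is of order \<open>\<tau>\<close> by the same identity.\<close>

lemma good_point_bound:
  obtains K where "0 < K" "\<And>v \<nu> x y r T t. \<lbrakk>poincare_pair v \<nu>; y \<in> ball x r; 0 < r; 0 < T; r * T \<le> t;
    emeasure \<nu> (ball x (2 * \<sigma> * r)) \<le> ennreal (T powr p * measure M (ball x r));
    approx_continuous v y;
    \<And>\<rho>. 0 < \<rho> \<Longrightarrow> \<rho> \<le> r \<Longrightarrow> level \<nu> y \<rho> (T * (t / (r * T)) powr (P / p))\<rbrakk>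
    \<Longrightarrow> \<bar>v y - average M (ball x r) v\<bar> \<le> K * t"
proof -
  define \<phi> :: real where "\<phi> = 2 powr (Q / p - 1)"
  have "0 < Q / p - 1" using p_less_Q p_gt_1 by simp
  then have \<phi>: "1 < \<phi>" using powr_less_mono[of 0 "Q / p - 1" 2] by (simp add: \<phi>_def)
  define K2 where "K2 = Cd * C * c powr (- 1 / p) * (\<phi> / (\<phi> - 1))"
  define K where "K = telescope 0 + K2 + 4 * growth 4 * C"
  have K2: "0 \<le> K2" using Cd_ge_1 C_ge_1 c_pos \<phi> by (simp add: K2_def)
  have g: "0 < 4 * growth 4 * C" using growth_ge_1[of 4] C_ge_1 by simp
  show ?thesis
  proof (rule that[of K])
    show "0 < K" using K2 g telescope_nonneg[of 0] unfolding K_def by linarith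
    fix v \<nu> x y r T t
    assume pp: "poincare_pair v \<nu>" and y: "y \<in> ball x r" and r: "0 < r" and T: "0 < T" and t: "r * T \<le> t"
      and U: "emeasure \<nu> (ball x (2 * \<sigma> * r)) \<le> ennreal (T powr p * measure M (ball x r))"
      and ac: "approx_continuous v y"
      and good: "\<And>\<rho>. 0 < \<rho> \<Longrightarrow> \<rho> \<le> r \<Longrightarrow> level \<nu> y \<rho> (T * (t / (r * T)) powr (P / p))"
    have \<nu>: "sets \<nu> = sets M" and vi: "locally_integrable v" using pp by (auto simp: poincare_pair_def)
    define \<tau> where "\<tau> = t / (r * T)"
    have \<tau>: "1 \<le> \<tau>" using r T t by (simp add: \<tau>_def)
    have t_eq: "t = r * T * \<tau>" using r T by (simp add: \<tau>_def)
    define a where "a = T * \<tau> powr (P / p)"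
    have a: "0 < a" using T \<tau> by (simp add: a_def)
    define X where "X = \<tau> powr (P / Q)"
    have X: "1 \<le> X" using \<tau> P_identities Q_pos by (auto simp: X_def intro!: ge_one_powr_ge_zero)
    have \<tau>X: "\<tau> powr (P / p) = \<tau> * X"
    proof -
      have "P / p = 1 + P / Q" using P_identities(1) by simp
      then show ?thesis using \<tau> by (simp add: X_def powr_add)
    qed
    obtain m where "X < 2 ^ m" using real_arch_pow[of 2 X] by auto
    then have ex: "\<exists>n. X \<le> 2 ^ n" by (intro exI[of _ m]) simp
    \<comment> \<open>The radius \<open>s = r / 2 ^ n\<close> agrees with \<open>r / X\<close> up to
      a factor 2; \<open>X \<ge> 1\<close> yields \<open>2 ^ n \<le> 2 * X\<close> also for
      \<open>n = 0\<close>.\<close>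
    define n where "n = (LEAST n. X \<le> 2 ^ n)"
    have n1: "X \<le> 2 ^ n" unfolding n_def by (rule LeastI_ex[OF ex])
    have n2: "2 ^ n \<le> 2 * X"
    proof (cases n)
      case (Suc k)
      then have "\<not> X \<le> 2 ^ k" using not_less_Least[of k "\<lambda>n. X \<le> 2 ^ n"] by (simp add: n_def)
      then show ?thesis using Suc by simp
    qed (use X in simp)
    define s where "s = r / 2 ^ n"
    have s: "0 < s" "s \<le> r" using r by (auto simp: s_def field_simps mult_le_cancel_left1)
    have sa: "s * a \<le> t"
    proof -
      have "s \<le> r / X" unfolding s_def using r X n1 by (intro divide_left_mono) auto
      then have "s * a \<le> r / X * a" using a by (intro mult_right_mono) auto
      also have "\<dots> = t" using X by (simp add: a_def t_eq \<tau>X)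
      finally show ?thesis .
    qed
    have lv: "level \<nu> y (s / 2 ^ k) a" for k
    proof -
      have "s / 2 ^ k \<le> s / 1" using s(1) by (intro divide_left_mono) auto
      then show ?thesis using good[of "s / 2 ^ k"] s by (auto simp: a_def \<tau>_def)
    qed
    have tel: "\<bar>average M (ball y (s / 2 ^ k)) v - average M (ball y s) v\<bar> \<le> telescope 0 * (s * a)" for k
      using s(1) a lv by (intro average_telescope[OF pp, where \<beta>=0]) (auto simp: field_simps mult_le_cancel_left1)
    have to0: "(\<lambda>k. B * (s / 2 ^ k) * a) \<longlonglongrightarrow> 0" for B
      using tendsto_mult_right_zero[OF LIMSEQ_inverse_realpow_zero[of 2], of "B * s * a"]
      by (simp add: field_simps)
    have "(\<lambda>k. average M (ball y (s / 2 ^ k)) v) \<longlonglongrightarrow> v y"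
    proof (rule tendsto_average_approx_continuous[OF vi ac])
      show "0 < s / 2 ^ k" for k using s by simp
      show "(\<lambda>k. s / 2 ^ k) \<longlonglongrightarrow> 0" using to0[of "1 / a"] a by simp
      show "(\<lambda>k. average M (ball y (s / 2 ^ k)) (\<lambda>z. \<bar>v z - average M (ball y (s / 2 ^ k)) v\<bar>)) \<longlonglongrightarrow> 0"
      proof (rule tendsto_sandwich[OF _ _ tendsto_const to0[of C]])
        show "\<forall>\<^sub>F k in sequentially. 0 \<le> average M (ball y (s / 2 ^ k)) (\<lambda>z. \<bar>v z - average M (ball y (s / 2 ^ k)) v\<bar>)"
          by (intro always_eventually allI average_nonneg) simp
        show "\<forall>\<^sub>F k in sequentially. average M (ball y (s / 2 ^ k)) (\<lambda>z. \<bar>v z - average M (ball y (s / 2 ^ k)) v\<bar>) \<le> C * (s / 2 ^ k) * a"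
          using s by (intro always_eventually allI poincare_pairD[OF pp _ lv]) simp
      qed
    qed
    then have "(\<lambda>k. \<bar>average M (ball y (s / 2 ^ k)) v - average M (ball y s) v\<bar>) \<longlonglongrightarrow> \<bar>v y - average M (ball y s) v\<bar>"
      by (intro tendsto_intros)
    then have "\<bar>v y - average M (ball y s) v\<bar> \<le> telescope 0 * (s * a)"
      by (rule tendsto_upperbound) (use tel in auto)
    also have "\<dots> \<le> telescope 0 * t" using sa telescope_nonneg[of 0] by (intro mult_left_mono) auto
    finally have 1: "\<bar>v y - average M (ball y s) v\<bar> \<le> telescope 0 * t" .
    define T' where "T' k = (T * c powr (- 1 / p)) * 2 powr (Q / p * real k)" for k :: nat
    have "\<bar>average M (ball y s) v - average M (ball y r) v\<bar> \<le> (\<Sum>k<n. Cd * (C * (r / 2 ^ k) * T' k))"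
      unfolding s_def T'_def using T by (intro average_chain[OF pp r] level_dyadic[OF \<nu> y _ r U]) auto
    also have "\<dots> = (\<Sum>k<n. Cd * C * c powr (- 1 / p) * (r * T) * \<phi> ^ k)"
      by (intro sum.cong) (auto simp: T'_def \<phi>_def powr_diff power_divide powr_realpow[symmetric] powr_powr mult_ac)
    also have "\<dots> = Cd * C * c powr (- 1 / p) * (r * T) * (\<Sum>k<n. \<phi> ^ k)" by (simp add: sum_distrib_left)
    also have "\<dots> \<le> Cd * C * c powr (- 1 / p) * (r * T) * (\<phi> * \<tau> / (\<phi> - 1))"
    proof (intro mult_left_mono)
      have "\<phi> ^ n = (2 ^ n) powr (Q / p - 1)"
        by (simp add: \<phi>_def powr_realpow[symmetric] powr_powr mult.commute)
      also have "\<dots> \<le> (2 * X) powr (Q / p - 1)"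
        using n2 \<open>0 < Q / p - 1\<close> by (intro powr_mono2) auto
      also have "\<dots> = \<phi> * X powr (Q / p - 1)" using X by (simp add: \<phi>_def powr_mult)
      also have "X powr (Q / p - 1) = \<tau>"
      proof -
        have "P / Q * (Q / p - 1) = 1"
        proof -
          have "P / Q * (Q / p - 1) = P / p - P / Q" using Q_pos by (simp add: right_diff_distrib)
          then show ?thesis using P_identities(1) by simp
        qed
        then show ?thesis using \<tau> by (simp add: X_def powr_powr)
      qed
      finally have "\<phi> ^ n \<le> \<phi> * \<tau>" .
      moreover have "(\<Sum>k<n. \<phi> ^ k) = (\<phi> ^ n - 1) / (\<phi> - 1)"
        using \<phi> by (subst sum_gp_strict) (auto simp: field_simps)
      ultimately show "(\<Sum>k<n. \<phi> ^ k) \<le> \<phi> * \<tau> / (\<phi> - 1)"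
        using \<phi> by (auto intro!: divide_right_mono)
    qed (use Cd_ge_1 C_ge_1 r T in auto)
    also have "\<dots> = K2 * t" by (simp add: K2_def t_eq)
    finally have 2: "\<bar>average M (ball y s) v - average M (ball y r) v\<bar> \<le> K2 * t" .
    have "\<bar>average M (ball y r) v - average M (ball x r) v\<bar> \<le> 4 * growth 4 * C * (r * T)"
      using T by (intro average_nearby[OF pp y _ r U]) auto
    also have "\<dots> \<le> 4 * growth 4 * C * t" using t g by (intro mult_left_mono) auto
    finally have 3: "\<bar>average M (ball y r) v - average M (ball x r) v\<bar> \<le> 4 * growth 4 * C * t" .
    show "\<bar>v y - average M (ball x r) v\<bar> \<le> K * t"
      using 1 2 3 by (simp add: K_def distrib_right)
  qed
qed

text \<open>Almost every point with large deviation must violate the level \<open>a\<close> at some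
  scale, so it is the centre of a ball on which \<nu> exceeds \<open>a powr p\<close> times the
  measure. The Vitali estimate bounds the measure of all such points by
  \<open>growth 5 / a powr p\<close> times the \<nu>-mass, and \<open>1 / a powr p\<close> is the
  factor in the conclusion.\<close>

lemma weak_type_estimate:
  obtains K where "0 < K" "\<And>v \<nu> x r T t. \<lbrakk>poincare_pair v \<nu>; 0 < r; 0 < T; r * T \<le> t;
    emeasure \<nu> (ball x (2 * \<sigma> * r)) \<le> ennreal (T powr p * measure M (ball x r))\<rbrakk>
    \<Longrightarrow> emeasure M {y\<in>ball x r. K * t < \<bar>v y - average M (ball x r) v\<bar>}
      \<le> ennreal (K * ((r * T / t) powr P * T powr - p)) * emeasure \<nu> (ball x (2 * \<sigma> * r))"
proof -
  obtain K0 where K0: "0 < K0" "\<And>v \<nu> x y r T t. \<lbrakk>poincare_pair v \<nu>; y \<in> ball x r; 0 < r; 0 < T; r * T \<le> t;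
    emeasure \<nu> (ball x (2 * \<sigma> * r)) \<le> ennreal (T powr p * measure M (ball x r));
    approx_continuous v y;
    \<And>\<rho>. 0 < \<rho> \<Longrightarrow> \<rho> \<le> r \<Longrightarrow> level \<nu> y \<rho> (T * (t / (r * T)) powr (P / p))\<rbrakk>
    \<Longrightarrow> \<bar>v y - average M (ball x r) v\<bar> \<le> K0 * t"
    using good_point_bound by blast
  \<comment> \<open>One constant in two roles: \<open>K0\<close> raises the threshold
    \<open>K * t\<close> to that of the pointwise bound, \<open>growth 5\<close> is the loss in the
    covering.\<close>
  define K where "K = K0 + growth 5"
  show ?thesis
  proof (rule that[of K])
    show "0 < K" using K0 growth_ge_1[of 5] by (simp add: K_def)
    fix v \<nu> x r T t
    assume pp: "poincare_pair v \<nu>" and r: "0 < r" and T: "0 < T" and t: "r * T \<le> t"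
      and U: "emeasure \<nu> (ball x (2 * \<sigma> * r)) \<le> ennreal (T powr p * measure M (ball x r))"
    have \<nu>: "sets \<nu> = sets M" and vi: "locally_integrable v" using pp by (auto simp: poincare_pair_def)
    have t0: "0 < t" using r T t by (meson less_le_trans mult_pos_pos)
    define a where "a = T * (t / (r * T)) powr (P / p)"
    have a: "0 < a" using T t0 r by (simp add: a_def)
    have p0: "0 < p" using p_gt_1 by simp
    have ap: "1 / a powr p = (r * T / t) powr P * T powr - p"
      using T t0 r p0 by (simp add: a_def powr_mult powr_divide powr_powr powr_minus_divide field_simps)
    define S where "S = {y\<in>ball x r. \<not> (\<forall>\<rho>. 0 < \<rho> \<and> \<rho> \<le> r \<longrightarrow> level \<nu> y \<rho> a)}"
    have "\<exists>\<rho>. 0 < \<rho> \<and> \<rho> \<le> r \<and> \<not> level \<nu> y \<rho> a" if "y \<in> S" for y using that by (auto simp: S_def)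
    then obtain \<rho> where \<rho>: "\<And>y. y \<in> S \<Longrightarrow> 0 < \<rho> y" "\<And>y. y \<in> S \<Longrightarrow> \<rho> y \<le> r" "\<And>y. y \<in> S \<Longrightarrow> \<not> level \<nu> y (\<rho> y) a"
      by metis
    have \<sigma>\<rho>: "\<sigma> * \<rho> y \<le> \<sigma> * r" if "y \<in> S" for y using \<rho>(2)[OF that] \<sigma>_ge_1 by (intro mult_left_mono) auto
    have sub: "ball y (\<sigma> * \<rho> y) \<subseteq> ball x (2 * \<sigma> * r)" if "y \<in> S" for y
    proof
      fix z assume z: "z \<in> ball y (\<sigma> * \<rho> y)"
      have "r \<le> \<sigma> * r" using r \<sigma>_ge_1 by simp
      moreover have "dist x y < r" using that by (simp add: S_def)
      ultimately show "z \<in> ball x (2 * \<sigma> * r)" using z \<sigma>\<rho>[OF that] dist_triangle[of x z y] by simp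
    qed
    have le: "emeasure M (ball y (\<sigma> * \<rho> y)) \<le> ennreal (1 / a powr p) * emeasure \<nu> (ball y (\<sigma> * \<rho> y))" if y: "y \<in> S" for y
    proof -
      have "ennreal (a powr p * measure M (ball y (\<sigma> * \<rho> y))) \<le> emeasure \<nu> (ball y (\<sigma> * \<rho> y))"
        using \<rho>(3)[OF y] a by (simp add: level_def not_le less_imp_le)
      then have "ennreal (1 / a powr p) * ennreal (a powr p * measure M (ball y (\<sigma> * \<rho> y))) \<le> ennreal (1 / a powr p) * emeasure \<nu> (ball y (\<sigma> * \<rho> y))"
        by (intro mult_left_mono) auto
      then show ?thesis using a by (simp add: emeasure_ball ennreal_mult'[symmetric])
    qed
    obtain V where V: "V \<in> sets M" "S \<subseteq> V"
      "emeasure M V \<le> ennreal (growth 5) * ennreal (1 / a powr p) * emeasure \<nu> (ball x (2 * \<sigma> * r))"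
    proof (rule vitali_outer_measure[of S "\<lambda>y. \<sigma> * \<rho> y" "\<sigma> * r" \<nu> "ball x (2 * \<sigma> * r)" "ennreal (1 / a powr p)"])
      show "0 < \<sigma> * \<rho> y" if "y \<in> S" for y using \<rho>(1)[OF that] \<sigma>_ge_1 by simp
    qed (use \<sigma>\<rho> \<nu> sub le in auto)
    have "emeasure M {y\<in>ball x r. K * t < \<bar>v y - average M (ball x r) v\<bar>} \<le> emeasure M V"
    proof (rule emeasure_mono_AE)
      have "AE y in M. approx_continuous v y"
        using vi by (intro AE_approx_continuous) (simp add: locally_integrable_def)
      then show "AE y in M. y \<in> {y\<in>ball x r. K * t < \<bar>v y - average M (ball x r) v\<bar>} \<longrightarrow> y \<in> V"
      proof eventually_elim
        case (elim y)
        have "y \<in> S" if y: "y \<in> ball x r" "K * t < \<bar>v y - average M (ball x r) v\<bar>"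
        proof (rule ccontr)
          assume "y \<notin> S"
          with y have "\<bar>v y - average M (ball x r) v\<bar> \<le> K0 * t"
            by (intro K0(2)[OF pp _ r T t U elim]) (auto simp: S_def a_def)
          also have "\<dots> \<le> K * t" using t0 growth_ge_1[of 5] by (simp add: K_def)
          finally show False using y by simp
        qed
        with V show ?case by auto
      qed
    qed (rule V)
    also have "\<dots> \<le> ennreal (growth 5) * ennreal (1 / a powr p) * emeasure \<nu> (ball x (2 * \<sigma> * r))" by (rule V)
    also have "\<dots> \<le> ennreal K * ennreal (1 / a powr p) * emeasure \<nu> (ball x (2 * \<sigma> * r))"
      using K0 by (intro mult_right_mono ennreal_leI) (auto simp: K_def)
    also have "ennreal K * ennreal (1 / a powr p) = ennreal (K * (1 / a powr p))"
      using K0 growth_ge_1[of 5] by (intro ennreal_mult[symmetric]) (auto simp: K_def)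
    finally show "emeasure M {y\<in>ball x r. K * t < \<bar>v y - average M (ball x r) v\<bar>}
      \<le> ennreal (K * ((r * T / t) powr P * T powr - p)) * emeasure \<nu> (ball x (2 * \<sigma> * r))"
      unfolding ap .
  qed
qed

text \<open>A truncation between two heights has gradient only where the function lies strictly
  between them, hence the restricted measure. All \<open>m\<close>, \<open>a\<close>,
  \<open>b\<close> are quantified because the mean and the dyadic heights depend on the ball. This
  isolates the property of curves that the Sobolev-Poincare inequality uses.\<close>

definition truncatable :: "('a \<Rightarrow> real) \<Rightarrow> 'a measure \<Rightarrow> bool" where
  "truncatable f \<nu> \<longleftrightarrow> poincare_pair f \<nu> \<and> (\<forall>m a b. 0 < a \<and> a < b \<longrightarrow>
     poincare_pair (\<lambda>y. max a (min b \<bar>f y - m\<bar>))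
       (density \<nu> (indicator {y. a < \<bar>f y - m\<bar> \<and> \<bar>f y - m\<bar> < b})))"

text \<open>Maz'ya's truncation method. The weak type bound alone, summed over dyadic heights, would
  diverge logarithmically. Applied to the layer \<open>v j\<close> of
  \<open>\<bar>f - m\<bar>\<close> between \<open>Lj j\<close> and \<open>2 * Lj j\<close>, it
  involves only the \<nu>-mass of \<open>Aj j\<close>; these sets are disjoint, so the masses sum to
  at most that of the ball.\<close>

lemma sobolev_poincare:
  obtains K where "0 < K" "\<And>f \<nu> x r T. \<lbrakk>truncatable f \<nu>; 0 < r; 0 < T;
    emeasure \<nu> (ball x (2 * \<sigma> * r)) \<le> ennreal (T powr p * measure M (ball x r))\<rbrakk>
    \<Longrightarrow> (\<integral>\<^sup>+y\<in>ball x r. ennreal (\<bar>f y - average M (ball x r) f\<bar> powr P) \<partial>M)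
       \<le> ennreal (K * (r * T) powr P * measure M (ball x r))"
proof -
  obtain K0 where K0: "0 < K0" "\<And>v \<nu> x r T t. \<lbrakk>poincare_pair v \<nu>; 0 < r; 0 < T; r * T \<le> t;
    emeasure \<nu> (ball x (2 * \<sigma> * r)) \<le> ennreal (T powr p * measure M (ball x r))\<rbrakk>
    \<Longrightarrow> emeasure M {y\<in>ball x r. K0 * t < \<bar>v y - average M (ball x r) v\<bar>}
      \<le> ennreal (K0 * ((r * T / t) powr P * T powr - p)) * emeasure \<nu> (ball x (2 * \<sigma> * r))"
    using weak_type_estimate by blast
  \<comment> \<open>The base height is \<open>L = A * (r * T)\<close>. The part \<open>2 * C\<close>
    makes \<open>\<bar>f - m\<bar> < L\<close> on at least half of the ball, and
    \<open>4 * K0\<close> makes \<open>Lj j / (4 * K0)\<close> an admissible threshold in the weak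
    type estimate.\<close>
  define A where "A = 2 * C + 4 * K0"
  have A: "0 < A" "2 * C \<le> A" "4 * K0 \<le> A" using C_ge_1 K0 by (auto simp: A_def)
  define K where "K = (2 * A) powr P + (4 * A) powr P * (2 * K0)"
  show ?thesis
  proof (rule that[of K])
    show "0 < K" using A K0 by (simp add: K_def add_pos_pos)
    fix f \<nu> x r T
    assume tr: "truncatable f \<nu>" and r: "0 < r" and T: "0 < T"
      and U: "emeasure \<nu> (ball x (2 * \<sigma> * r)) \<le> ennreal (T powr p * measure M (ball x r))"
    define B where "B = ball x r"
    define m where "m = average M B f"
    define w where "w y = \<bar>f y - m\<bar>" for y
    define L where "L = A * (r * T)"
    define Lj where "Lj j = L * 2 ^ j" for j :: nat
    define Aj where "Aj j = {y. Lj j < w y \<and> w y < Lj (Suc j)}" for j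
    define v where "v j y = max (Lj j) (min (Lj (Suc j)) (w y))" for j y
    define \<nu>' where "\<nu>' j = density \<nu> (indicator (Aj j))" for j
    have pp: "poincare_pair f \<nu>" using tr by (simp add: truncatable_def)
    have \<nu>: "sets \<nu> = sets M" and fi: "locally_integrable f" using pp by (auto simp: poincare_pair_def)
    have L: "0 < L" using A r T by (simp add: L_def)
    have Lj: "0 < Lj j" "Lj (Suc j) = 2 * Lj j" for j using L by (auto simp: Lj_def)
    have ppj: "poincare_pair (v j) (\<nu>' j)" for j
      using tr Lj[of j] unfolding truncatable_def v_def \<nu>'_def Aj_def w_def by auto
    have wi: "locally_integrable w" unfolding w_def
      by (intro locally_integrable_abs locally_integrable_diff_const fi)
    then have [measurable]: "w \<in> borel_measurable M" by (simp add: locally_integrable_def)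
    have w0: "0 \<le> w y" for y by (simp add: w_def)
    have vm[measurable]: "v j \<in> borel_measurable M" for j unfolding v_def by measurable
    have UM: "ball x (2 * \<sigma> * r) \<in> sets \<nu>" using \<nu> by simp
    have AjM: "Aj j \<in> sets \<nu>" for j
    proof -
      have "Aj j = {y\<in>space M. Lj j < w y \<and> w y < Lj (Suc j)}" by (simp add: Aj_def)
      also have "\<dots> \<in> sets M" by measurable
      finally show ?thesis using \<nu> by simp
    qed
    have e\<nu>': "emeasure (\<nu>' j) X = emeasure \<nu> (Aj j \<inter> X)" if "X \<in> sets \<nu>" for j X
      using that AjM unfolding \<nu>'_def by (subst emeasure_density) (auto simp: indicator_inter_arith[symmetric])
    have BM: "B \<in> fmeasurable M" "B \<in> sets M" by (auto simp: B_def)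
    have setM: "{y\<in>B. R (w y) (v j y)} \<in> sets M" if "Measurable.pred M (\<lambda>y. R (w y) (v j y))" for R j
    proof -
      have "{y\<in>B. R (w y) (v j y)} = B \<inter> {y\<in>space M. R (w y) (v j y)}" by auto
      also have "\<dots> \<in> sets M" using that BM by measurable
      finally show ?thesis .
    qed
    have setF: "{y\<in>B. R (w y) (v j y)} \<in> fmeasurable M" if "Measurable.pred M (\<lambda>y. R (w y) (v j y))" for R j
      by (rule fmeasurableI2[OF BM(1) _ setM[OF that]]) auto
    have Bpos: "0 < measure M B" using measure_ball_pos[OF r] by (simp add: B_def)
    have half: "measure M B \<le> 2 * measure M {y\<in>B. w y < L}"
    proof -
      have "level \<nu> x r T"
      proof (rule levelI_subset[OF _ \<nu> _ ball_sets U])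
        show "ball x (\<sigma> * r) \<subseteq> ball x (2 * \<sigma> * r)" using r \<sigma>_ge_1 by (intro subset_ball) auto
      qed (use T r in auto)
      then have "average M B w \<le> C * r * T"
        using poincare_pairD[OF pp r] unfolding B_def w_def m_def by blast
      then have "average M B w * measure M B / L \<le> (C * r * T) * measure M B / L"
        using Bpos L by (intro divide_right_mono mult_right_mono) auto
      also have "\<dots> = C / A * measure M B" using r T by (simp add: L_def)
      also have "\<dots> \<le> 1 / 2 * measure M B" using A Bpos by (intro mult_right_mono) (auto simp: field_simps)
      finally have "measure M {y\<in>B. L \<le> w y} \<le> measure M B / 2"
        using markov_average[OF wi w0 L r, of x] unfolding B_def by linarith
      moreover have "measure M B \<le> measure M {y\<in>B. L \<le> w y} + measure M {y\<in>B. w y < L}"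
      proof -
        have "measure M B \<le> measure M ({y\<in>B. L \<le> w y} \<union> {y\<in>B. w y < L})"
          by (intro measure_mono_fmeasurable fmeasurable.Un setF[of "\<lambda>a b. L \<le> a"] setF[of "\<lambda>a b. a < L"] BM) auto
        also have "\<dots> \<le> measure M {y\<in>B. L \<le> w y} + measure M {y\<in>B. w y < L}"
          by (intro measure_Un_le setM[of "\<lambda>a b. L \<le> a"] setM[of "\<lambda>a b. a < L"]) auto
        finally show ?thesis .
      qed
      ultimately show ?thesis by simp
    qed
    have key: "emeasure M {y\<in>B. Lj (Suc j) \<le> w y} \<le> ennreal (2 * K0 * ((1 / 2 ^ j) powr P * T powr - p)) * emeasure (\<nu>' j) (ball x (2 * \<sigma> * r))" for j
    proof -
      define mj where "mj = average M B (v j)"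
      define F where "F = {y\<in>B. Lj j / 4 < \<bar>v j y - mj\<bar>}"
      have FF: "F \<in> fmeasurable M" unfolding F_def by (rule setF[of "\<lambda>a b. Lj j / 4 < \<bar>b - mj\<bar>"]) measurable
      have GF: "{y\<in>B. Lj (Suc j) \<le> w y} \<in> fmeasurable M" by (rule setF[of "\<lambda>a b. Lj (Suc j) \<le> a"]) measurable
      have Lge: "L \<le> Lj j" using L by (simp add: Lj_def)
      \<comment> \<open>The unknown mean \<open>mj\<close> of the layer is either far from its lower
        value or far from its upper value. In the first case \<open>v j\<close> deviates on
        \<open>{w < L}\<close>, where it equals \<open>Lj j\<close> and which fills half of the
        ball; in the second it deviates on the set to be measured, where it equals
        \<open>2 * Lj j\<close>.\<close>
      have "measure M {y\<in>B. Lj (Suc j) \<le> w y} \<le> 2 * measure M F"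
      proof (cases "3 / 2 * Lj j \<le> mj")
        case True
        have "measure M {y\<in>B. Lj (Suc j) \<le> w y} \<le> measure M B"
          using GF by (intro measure_mono_fmeasurable BM) auto
        also have "\<dots> \<le> 2 * measure M {y\<in>B. w y < L}" by (rule half)
        also have "\<dots> \<le> 2 * measure M F"
        proof (intro mult_left_mono measure_mono_fmeasurable FF)
          show "{y\<in>B. w y < L} \<subseteq> F"
          proof
            fix y assume y: "y \<in> {y\<in>B. w y < L}"
            then have "w y \<le> Lj j" using Lge by simp
            then have "v j y = Lj j" by (simp add: v_def max_def min_def)
            then show "y \<in> F" using y True Lj(1)[of j] by (auto simp: F_def)
          qed
          show "{y\<in>B. w y < L} \<in> sets M" by (rule setM[of "\<lambda>a b. a < L"]) measurable
        qed simp
        finally show ?thesis .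
      next
        case False
        have "measure M {y\<in>B. Lj (Suc j) \<le> w y} \<le> measure M F"
        proof (intro measure_mono_fmeasurable FF)
          show "{y\<in>B. Lj (Suc j) \<le> w y} \<subseteq> F"
          proof
            fix y assume y: "y \<in> {y\<in>B. Lj (Suc j) \<le> w y}"
            then have "v j y = 2 * Lj j" using Lj[of j] by (simp add: v_def max_def min_def)
            then show "y \<in> F" using y False Lj(1)[of j] by (auto simp: F_def)
          qed
        qed (use GF in auto)
        also have "\<dots> \<le> 2 * measure M F" by simp
        finally show ?thesis .
      qed
      then have "emeasure M {y\<in>B. Lj (Suc j) \<le> w y} \<le> ennreal (2 * measure M F)"
        using GF by (subst emeasure_eq_measure2) (auto simp: ennreal_leI)
      also have "\<dots> = 2 * emeasure M F"
        using FF by (simp add: emeasure_eq_measure2 ennreal_mult)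
      also have "emeasure M F \<le> ennreal (K0 * ((r * T / (Lj j / (4 * K0))) powr P * T powr - p)) * emeasure (\<nu>' j) (ball x (2 * \<sigma> * r))"
      proof -
        have eq: "F = {y\<in>ball x r. K0 * (Lj j / (4 * K0)) < \<bar>v j y - average M (ball x r) (v j)\<bar>}"
          using K0 by (simp add: F_def mj_def B_def)
        show ?thesis unfolding eq
        proof (rule K0(2)[OF ppj r T])
          have "r * T \<le> L / (4 * K0)" using A(3) r T K0(1) by (simp add: L_def field_simps)
          also have "\<dots> \<le> Lj j / (4 * K0)" using Lge K0(1) by (intro divide_right_mono) auto
          finally show "r * T \<le> Lj j / (4 * K0)" .
          have "emeasure (\<nu>' j) (ball x (2 * \<sigma> * r)) \<le> emeasure \<nu> (ball x (2 * \<sigma> * r))"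
            unfolding e\<nu>'[OF UM] using UM by (intro emeasure_mono) auto
          with U show "emeasure (\<nu>' j) (ball x (2 * \<sigma> * r)) \<le> ennreal (T powr p * measure M (ball x r))"
            by (rule order_trans[rotated])
        qed
      qed
      also have "\<dots> \<le> ennreal (K0 * ((1 / 2 ^ j) powr P * T powr - p)) * emeasure (\<nu>' j) (ball x (2 * \<sigma> * r))"
      proof (intro mult_right_mono ennreal_leI mult_left_mono powr_mono2)
        have "r * T / (Lj j / (4 * K0)) = 4 * K0 / A / 2 ^ j" using r T by (simp add: Lj_def L_def)
        also have "\<dots> \<le> 1 / 2 ^ j" using A by (intro divide_right_mono) (auto simp: field_simps)
        finally show "r * T / (Lj j / (4 * K0)) \<le> 1 / 2 ^ j" .
      qed (use K0 r T Lj(1)[of j] P_identities in \<open>auto simp: less_imp_le\<close>)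
      finally have "emeasure M {y\<in>B. Lj (Suc j) \<le> w y} \<le> 2 * (ennreal (K0 * ((1 / 2 ^ j) powr P * T powr - p)) * emeasure (\<nu>' j) (ball x (2 * \<sigma> * r)))"
        by (auto simp: mult_left_mono)
      moreover have "2 * ennreal (K0 * ((1 / 2 ^ j) powr P * T powr - p)) = ennreal (2 * K0 * ((1 / 2 ^ j) powr P * T powr - p))"
        using K0 by (simp add: ennreal_mult' mult.assoc)
      ultimately show ?thesis by (simp add: mult.assoc[symmetric])
    qed
    \<comment> \<open>Beyond \<open>2 * L = Lj 1\<close> the least \<open>k\<close> with
      \<open>w y < Lj k\<close> is at least 2. With \<open>j = k - 2\<close>, \<open>w y\<close>
      lies between \<open>Lj (Suc j)\<close> and its double, so a single term of the series is
      enough.\<close>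
    have point: "ennreal (w y powr P) \<le> ennreal ((2 * L) powr P) + (\<Sum>j. ennreal ((2 * Lj (Suc j)) powr P) * indicator {y\<in>B. Lj (Suc j) \<le> w y} y)"
      if y: "y \<in> B" for y
    proof (cases "w y \<le> 2 * L")
      case True
      then have "w y powr P \<le> (2 * L) powr P" using P_identities by (intro powr_mono2) (auto simp: w_def)
      then show ?thesis by (meson add_increasing2 ennreal_leI zero_le)
    next
      case False
      obtain k where "w y / L < 2 ^ k" using real_arch_pow[of 2 "w y / L"] by auto
      then have ex: "\<exists>k. w y < Lj k" using L by (intro exI[of _ k]) (simp add: Lj_def field_simps)
      define k where "k = (LEAST k. w y < Lj k)"
      have k: "w y < Lj k" unfolding k_def by (rule LeastI_ex[OF ex])
      have "k \<noteq> 0" "k \<noteq> 1" using k False L by (auto intro!: Nat.gr0I simp: Lj_def)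
      then obtain j where j: "k = Suc (Suc j)" by (metis One_nat_def not0_implies_Suc)
      then have ge: "Lj (Suc j) \<le> w y" using not_less_Least[of "Suc j" "\<lambda>k. w y < Lj k"] by (simp add: k_def not_less)
      have "w y powr P \<le> (2 * Lj (Suc j)) powr P"
        using k j Lj(2)[of "Suc j"] P_identities by (intro powr_mono2) (auto simp: w_def)
      then have "ennreal (w y powr P) \<le> (\<Sum>j\<in>{j}. ennreal ((2 * Lj (Suc j)) powr P) * indicator {y\<in>B. Lj (Suc j) \<le> w y} y)"
        using y ge by (simp add: ennreal_leI)
      also have "\<dots> \<le> (\<Sum>j. ennreal ((2 * Lj (Suc j)) powr P) * indicator {y\<in>B. Lj (Suc j) \<le> w y} y)"
        by (intro sum_le_suminf) auto
      finally show ?thesis by (meson add_increasing zero_le)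
    qed
    have "(\<integral>\<^sup>+y\<in>B. ennreal (w y powr P) \<partial>M)
      \<le> (\<integral>\<^sup>+y. ennreal ((2 * L) powr P) * indicator B y + (\<Sum>j. ennreal ((2 * Lj (Suc j)) powr P) * indicator {y\<in>B. Lj (Suc j) \<le> w y} y) \<partial>M)"
      using point by (intro nn_integral_mono) (auto split: split_indicator)
    also have "\<dots> = ennreal ((2 * L) powr P) * emeasure M B + (\<Sum>j. ennreal ((2 * Lj (Suc j)) powr P) * emeasure M {y\<in>B. Lj (Suc j) \<le> w y})"
    proof -
      have sj: "{y\<in>B. Lj (Suc j) \<le> w y} \<in> sets M" for j by (rule setM[of "\<lambda>a b. Lj (Suc j) \<le> a"]) measurable
      then have im: "indicator {y\<in>B. Lj (Suc j) \<le> w y} \<in> borel_measurable M" for j by (rule borel_measurable_indicator)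
      have "(\<integral>\<^sup>+y. ennreal ((2 * L) powr P) * indicator B y + (\<Sum>j. ennreal ((2 * Lj (Suc j)) powr P) * indicator {y\<in>B. Lj (Suc j) \<le> w y} y) \<partial>M)
         = (\<integral>\<^sup>+y. ennreal ((2 * L) powr P) * indicator B y \<partial>M) + (\<integral>\<^sup>+y. (\<Sum>j. ennreal ((2 * Lj (Suc j)) powr P) * indicator {y\<in>B. Lj (Suc j) \<le> w y} y) \<partial>M)"
        using BM im by (intro nn_integral_add borel_measurable_suminf borel_measurable_times_ennreal) auto
      also have "(\<integral>\<^sup>+y. (\<Sum>j. ennreal ((2 * Lj (Suc j)) powr P) * indicator {y\<in>B. Lj (Suc j) \<le> w y} y) \<partial>M)
         = (\<Sum>j. \<integral>\<^sup>+y. ennreal ((2 * Lj (Suc j)) powr P) * indicator {y\<in>B. Lj (Suc j) \<le> w y} y \<partial>M)"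
        using im by (intro nn_integral_suminf borel_measurable_times_ennreal) auto
      finally show ?thesis using BM sj by (simp add: nn_integral_cmult_indicator)
    qed
    also have "\<dots> \<le> ennreal ((2 * L) powr P) * emeasure M B + (\<Sum>j. ennreal ((4 * L) powr P * (2 * K0) * T powr - p) * emeasure \<nu> (Aj j \<inter> ball x (2 * \<sigma> * r)))"
    proof (intro add_left_mono suminf_le summableI)
      fix j
      have "ennreal ((2 * Lj (Suc j)) powr P) * emeasure M {y\<in>B. Lj (Suc j) \<le> w y}
        \<le> ennreal ((2 * Lj (Suc j)) powr P) * (ennreal (2 * K0 * ((1 / 2 ^ j) powr P * T powr - p)) * emeasure (\<nu>' j) (ball x (2 * \<sigma> * r)))"
        by (intro mult_left_mono key) simp
      also have "\<dots> = ennreal ((2 * Lj (Suc j)) powr P * (2 * K0 * ((1 / 2 ^ j) powr P * T powr - p))) * emeasure (\<nu>' j) (ball x (2 * \<sigma> * r))"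
        using K0 by (simp add: ennreal_mult mult.assoc)
      \<comment> \<open>The exponent \<open>P\<close> is balanced: the growth of the heights cancels
        the decay in the weak type factor, every layer receives the same weight, and only the masses
        of the \<open>Aj j\<close> remain to be summed.\<close>
      also have "(2 * Lj (Suc j)) powr P * (2 * K0 * ((1 / 2 ^ j) powr P * T powr - p)) = (4 * L) powr P * (2 * K0) * T powr - p"
      proof -
        have "(2 * Lj (Suc j)) powr P * (1 / 2 ^ j) powr P = (4 * L) powr P"
          using L by (subst powr_mult[symmetric]) (auto simp: Lj_def)
        then show ?thesis by (simp add: mult_ac)
      qed
      finally show "ennreal ((2 * Lj (Suc j)) powr P) * emeasure M {y\<in>B. Lj (Suc j) \<le> w y}
        \<le> ennreal ((4 * L) powr P * (2 * K0) * T powr - p) * emeasure \<nu> (Aj j \<inter> ball x (2 * \<sigma> * r))"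
        by (simp only: e\<nu>'[OF UM])
    qed
    also have "(\<Sum>j. ennreal ((4 * L) powr P * (2 * K0) * T powr - p) * emeasure \<nu> (Aj j \<inter> ball x (2 * \<sigma> * r)))
       = ennreal ((4 * L) powr P * (2 * K0) * T powr - p) * (\<Sum>j. emeasure \<nu> (Aj j \<inter> ball x (2 * \<sigma> * r)))"
      by (rule ennreal_suminf_cmult)
    also have "(\<Sum>j. emeasure \<nu> (Aj j \<inter> ball x (2 * \<sigma> * r))) = emeasure \<nu> (\<Union>j. Aj j \<inter> ball x (2 * \<sigma> * r))"
    proof (rule suminf_emeasure)
      have "Aj i \<inter> Aj j = {}" if "i < j" for i j
      proof -
        have "Lj (Suc i) \<le> Lj j" using that L unfolding Lj_def by (intro mult_left_mono power_increasing) auto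
        then show ?thesis by (auto simp: Aj_def)
      qed
      then have "Aj i \<inter> Aj j = {}" if "i \<noteq> j" for i j using that by (metis Int_commute nat_neq_iff)
      then show "disjoint_family (\<lambda>j. Aj j \<inter> ball x (2 * \<sigma> * r))"
        unfolding disjoint_family_on_def by blast
    qed (use AjM UM in auto)
    also have "\<dots> \<le> emeasure \<nu> (ball x (2 * \<sigma> * r))" using UM by (intro emeasure_mono) auto
    also have "\<dots> \<le> ennreal (T powr p * measure M (ball x r))" by (rule U)
    finally have "(\<integral>\<^sup>+y\<in>B. ennreal (w y powr P) \<partial>M) \<le> ennreal ((2 * L) powr P) * emeasure M B
      + ennreal ((4 * L) powr P * (2 * K0) * T powr - p) * ennreal (T powr p * measure M B)"
      by (simp add: B_def add_left_mono mult_left_mono)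
    also have "\<dots> = ennreal ((2 * L) powr P * measure M B + (4 * L) powr P * (2 * K0) * T powr - p * (T powr p * measure M B))"
      using K0 by (simp add: B_def emeasure_ball ennreal_mult'' [symmetric] ennreal_plus[symmetric] del: ennreal_plus)
    also have "(2 * L) powr P * measure M B + (4 * L) powr P * (2 * K0) * T powr - p * (T powr p * measure M B)
      = K * (r * T) powr P * measure M B"
    proof -
      have "(2 * L) powr P = (2 * A) powr P * (r * T) powr P" "(4 * L) powr P = (4 * A) powr P * (r * T) powr P"
        using A r T by (auto simp: L_def powr_mult mult_ac)
      moreover have "T powr - p * T powr p = 1" using T by (simp add: powr_minus)
      ultimately show ?thesis by (simp add: K_def algebra_simps)
    qed
    finally show "(\<integral>\<^sup>+y\<in>ball x r. ennreal (\<bar>f y - average M (ball x r) f\<bar> powr P) \<partial>M)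
       \<le> ennreal (K * (r * T) powr P * measure M (ball x r))"
      by (simp add: B_def w_def m_def)
  qed
qed

end

section \<open>Upper gradients along curves\<close>

lemma epowr_ennreal: "0 \<le> t \<Longrightarrow> ennreal t epowr a = ennreal (t powr a)"
  by (simp add: epowr_def)

lemma epowr_mono: "x \<le> y \<Longrightarrow> 0 \<le> a \<Longrightarrow> x epowr a \<le> y epowr a"
  by (auto simp: epowr_def top_unique less_top intro!: ennreal_leI powr_mono2 enn2real_mono)

lemma epowr_zero [simp]: "0 epowr a = 0"
  by (simp add: epowr_def)

lemma borel_measurable_epowr [measurable]: "(\<lambda>x. x epowr a) \<in> borel_measurable borel"
  unfolding epowr_def by measurable

lemma curve_length_shift_le:
  "curve_length (\<lambda>t. \<gamma> (t + a)) c d \<le> curve_length \<gamma> (c + a) (d + a)"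
  unfolding curve_length_def
proof (rule SUP_least)
  fix z :: "nat \<times> (nat \<Rightarrow> real)"
  assume "z \<in> {(n, t). mono_on {..n} t \<and> t ` {..n} \<subseteq> {c..d}}"
  then obtain n t where z: "z = (n, t)" and t: "mono_on {..n} t" "t ` {..n} \<subseteq> {c..d}" by auto
  have "(n, \<lambda>i. t i + a) \<in> {(n, t). mono_on {..n} t \<and> t ` {..n} \<subseteq> {c + a..d + a}}"
    using t by (auto simp: mono_on_def)
  then show "(case z of (n, t) \<Rightarrow> \<Sum>i<n. ennreal (dist (\<gamma> (t i + a)) (\<gamma> (t (Suc i) + a)))) \<le>
    (SUP (n, t)\<in>{(n, t). mono_on {..n} t \<and> t ` {..n} \<subseteq> {c + a..d + a}}. \<Sum>i<n. ennreal (dist (\<gamma> (t i)) (\<gamma> (t (Suc i)))))"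
    by (rule SUP_upper2) (simp add: z)
qed

lemma curve_length_shift: "curve_length (\<lambda>t. \<gamma> (t + a)) c d = curve_length \<gamma> (c + a) (d + a)"
  using curve_length_shift_le[of \<gamma> a c d] curve_length_shift_le[of "\<lambda>t. \<gamma> (t + a)" "- a" "c + a" "d + a"]
  by (simp add: antisym)

lemma curve_subcurve:
  assumes "curve l \<gamma>" "0 \<le> a" "a < b" "b \<le> l"
  shows "curve (b - a) (\<lambda>t. \<gamma> (t + a))"
proof -
  have "continuous_on {0..b - a} (\<lambda>t. \<gamma> (t + a))"
  proof (rule continuous_on_compose2[of "{0..l}" \<gamma>])
    show "continuous_on {0..l} \<gamma>" using assms(1) by (simp add: curve_def)
    show "continuous_on {0..b - a} (\<lambda>t. t + a)" by (intro continuous_intros)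
  qed (use assms in auto)
  then show ?thesis using assms by (auto simp: curve_def curve_length_shift)
qed

text \<open>A curve is continuous on its parameter interval only; clamping the parameter to that
  interval extends it continuously to the line without changing the product with the
  indicator.\<close>

lemma curve_measurable:
  assumes \<gamma>: "curve l \<gamma>" and g: "g \<in> borel_measurable borel" and sub: "A \<subseteq> {0..l}" "A \<in> sets borel"
  shows "(\<lambda>t. g (\<gamma> t) * indicator A t :: ennreal) \<in> borel_measurable borel"
proof -
  define \<gamma>' where "\<gamma>' t = \<gamma> (max 0 (min l t))" for t
  have "continuous_on UNIV \<gamma>'" unfolding \<gamma>'_def
  proof (rule continuous_on_compose2[of "{0..l}" \<gamma>])
    show "continuous_on {0..l} \<gamma>" using \<gamma> by (simp add: curve_def)
    show "continuous_on UNIV (\<lambda>t. max 0 (min l t))" by (intro continuous_intros)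
  qed (use \<gamma> in \<open>auto simp: curve_def\<close>)
  then have [measurable]: "\<gamma>' \<in> borel_measurable borel" by (rule borel_measurable_continuous_onI)
  note g[measurable] sub(2)[measurable]
  have "(\<lambda>t. g (\<gamma>' t) * indicator A t :: ennreal) \<in> borel_measurable borel" by measurable
  moreover have "g (\<gamma>' t) * indicator A t = g (\<gamma> t) * indicator A t" for t
    using sub(1) by (auto simp: \<gamma>'_def max_def min_def split: split_indicator)
  ultimately show ?thesis by simp
qed

lemma curve_integral_subcurve:
  assumes \<gamma>: "curve l \<gamma>" and g: "g \<in> borel_measurable borel" and ab: "0 \<le> a" "b \<le> l"
  shows "curve_integral (b - a) (\<lambda>t. \<gamma> (t + a)) g = (\<integral>\<^sup>+t\<in>{a..b}. g (\<gamma> t) \<partial>lborel)"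
proof -
  have "(\<integral>\<^sup>+t. g (\<gamma> t) * indicator {a..b} t \<partial>lborel)
    = (\<integral>\<^sup>+t. g (\<gamma> (a + 1 * t)) * indicator {a..b} (a + 1 * t) \<partial>lborel)"
    using nn_integral_real_affine[of "\<lambda>t. g (\<gamma> t) * indicator {a..b} t" 1 a] curve_measurable[OF \<gamma> g, of "{a..b}"] ab
    by simp
  also have "\<dots> = curve_integral (b - a) (\<lambda>t. \<gamma> (t + a)) g"
    unfolding curve_integral_def by (intro nn_integral_cong) (auto simp: add.commute split: split_indicator)
  finally show ?thesis by simp
qed

lemma upper_gradient_subcurve:
  assumes u: "upper_gradient u g" and \<gamma>: "curve l \<gamma>" and ab: "0 \<le> a" "a \<le> b" "b \<le> l"
  shows "ennreal \<bar>u (\<gamma> a) - u (\<gamma> b)\<bar> \<le> (\<integral>\<^sup>+t\<in>{a..b}. g (\<gamma> t) \<partial>lborel)"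
proof (cases "a = b")
  case False
  with ab have "curve (b - a) (\<lambda>t. \<gamma> (t + a))" by (intro curve_subcurve[OF \<gamma>]) auto
  then have "ennreal \<bar>u (\<gamma> (0 + a)) - u (\<gamma> (b - a + a))\<bar> \<le> curve_integral (b - a) (\<lambda>t. \<gamma> (t + a)) g"
    using u unfolding upper_gradient_def by blast
  then show ?thesis using curve_integral_subcurve[OF \<gamma> _ ab(1,3), of g] u by (simp add: upper_gradient_def)
qed simp

text \<open>The increments of \<open>\<phi>\<close> are dominated by those of an indefinite
  integral. \<open>H\<close> is a real-valued version of \<open>G\<close>, which is finite almost
  everywhere, so the indefinite integral is continuous.\<close>

lemma continuous_on_if_integral_bound:
  fixes \<phi> :: "real \<Rightarrow> real" and G :: "real \<Rightarrow> ennreal"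
  assumes G: "(\<lambda>t. G t * indicator {0..l} t) \<in> borel_measurable borel"
    and fin: "(\<integral>\<^sup>+t\<in>{0..l}. G t \<partial>lborel) < \<infinity>"
    and bound: "\<And>s t. 0 \<le> s \<Longrightarrow> s \<le> t \<Longrightarrow> t \<le> l \<Longrightarrow> ennreal \<bar>\<phi> s - \<phi> t\<bar> \<le> (\<integral>\<^sup>+\<tau>\<in>{s..t}. G \<tau> \<partial>lborel)"
  shows "continuous_on {0..l} \<phi>"
proof -
  define H where "H t = enn2real (G t * indicator {0..l} t)" for t
  have Hm[measurable]: "H \<in> borel_measurable borel" unfolding H_def using G by measurable
  have AE: "AE t in lborel. G t * indicator {0..l} t = ennreal (H t)"
    using nn_integral_PInf_AE[of "\<lambda>t. G t * indicator {0..l} t" lborel] fin G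
    by (auto simp: H_def less_top intro: eventually_mono)
  have "integrable lborel H"
  proof (rule integrableI_nonneg)
    have "(\<integral>\<^sup>+t. ennreal (H t) \<partial>lborel) = (\<integral>\<^sup>+t\<in>{0..l}. G t \<partial>lborel)"
      using AE by (intro nn_integral_cong_AE) auto
    then show "(\<integral>\<^sup>+t. ennreal (H t) \<partial>lborel) < \<infinity>" using fin by simp
  qed (auto simp: H_def)
  then have Hi: "set_integrable lborel {a..b} H" for a b
    unfolding set_integrable_def by (intro integrable_mult_indicator) auto
  then have HK: "H integrable_on {a..b}" for a b by (rule set_borel_integral_eq_integral)
  define \<Phi> where "\<Phi> t = integral {0..t} H" for t
  have cont: "continuous_on {0..l} \<Phi>" unfolding \<Phi>_def by (rule indefinite_integral_continuous_1[OF HK])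
  have le: "\<bar>\<phi> s - \<phi> t\<bar> \<le> \<Phi> t - \<Phi> s" if st: "0 \<le> s" "s \<le> t" "t \<le> l" for s t
  proof -
    have "(\<integral>\<^sup>+\<tau>\<in>{s..t}. G \<tau> \<partial>lborel) = (\<integral>\<^sup>+\<tau>. ennreal (H \<tau>) * indicator {s..t} \<tau> \<partial>lborel)"
      using AE st by (intro nn_integral_cong_AE) (auto elim!: eventually_mono split: split_indicator_asm split_indicator)
    also have "\<dots> = (\<integral>\<^sup>+\<tau>. ennreal (indicator {s..t} \<tau> *\<^sub>R H \<tau>) \<partial>lborel)"
      by (intro nn_integral_cong) (auto split: split_indicator)
    also have "\<dots> = ennreal (LINT \<tau>:{s..t}|lborel. H \<tau>)"
      unfolding set_lebesgue_integral_def using Hi[unfolded set_integrable_def]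
      by (intro nn_integral_eq_integral) (auto simp: H_def)
    also have "(LINT \<tau>:{s..t}|lborel. H \<tau>) = integral {s..t} H" by (rule set_borel_integral_eq_integral[OF Hi])
    also have "\<dots> = \<Phi> t - \<Phi> s"
      using Henstock_Kurzweil_Integration.integral_combine[of 0 s t H] HK st by (simp add: \<Phi>_def)
    finally have "ennreal \<bar>\<phi> s - \<phi> t\<bar> \<le> ennreal (\<Phi> t - \<Phi> s)" using bound[OF st] by simp
    moreover have "0 \<le> \<Phi> t - \<Phi> s"
    proof -
      have "0 \<le> integral {s..t} H" by (intro Henstock_Kurzweil_Integration.integral_nonneg HK) (simp add: H_def)
      then show ?thesis using Henstock_Kurzweil_Integration.integral_combine[of 0 s t H] HK st by (simp add: \<Phi>_def)
    qed
    ultimately show ?thesis by simp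
  qed
  show ?thesis
    unfolding continuous_on_iff
  proof (intro ballI allI impI)
    fix x e :: real assume x: "x \<in> {0..l}" and e: "0 < e"
    then obtain d where d: "0 < d" "\<And>y. y \<in> {0..l} \<Longrightarrow> dist y x < d \<Longrightarrow> dist (\<Phi> y) (\<Phi> x) < e"
      using cont unfolding continuous_on_iff by blast
    have "dist (\<phi> y) (\<phi> x) < e" if y: "y \<in> {0..l}" "dist y x < d" for y
    proof -
      have "dist (\<phi> y) (\<phi> x) \<le> dist (\<Phi> y) (\<Phi> x)"
        using le[of x y] le[of y x] x y by (cases "x \<le> y") (auto simp: dist_real_def)
      also have "\<dots> < e" by (rule d(2)[OF y])
      finally show ?thesis .
    qed
    then show "\<exists>d>0. \<forall>x'\<in>{0..l}. dist x' x < d \<longrightarrow> dist (\<phi> x') (\<phi> x) < e" using d(1) by blast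
  qed
qed

text \<open>Let \<open>t1\<close> be the last time with \<phi> \<le> \<alpha> and \<open>t2\<close>
  the first later time with \<phi> \<ge> \<beta>. Strictly in between, \<phi> stays between \<alpha>
  and \<beta>, hence between \<open>a\<close> and \<open>b\<close>, and this stretch already
  accounts for the whole rise.\<close>

lemma truncation_integral_bound_aux:
  fixes \<phi> :: "real \<Rightarrow> real" and G :: "real \<Rightarrow> ennreal"
  assumes l: "0 \<le> l" and cont: "continuous_on {0..l} \<phi>"
    and bound: "\<And>s t. 0 \<le> s \<Longrightarrow> s \<le> t \<Longrightarrow> t \<le> l \<Longrightarrow> ennreal \<bar>\<phi> s - \<phi> t\<bar> \<le> (\<integral>\<^sup>+\<tau>\<in>{s..t}. G \<tau> \<partial>lborel)"
    and ab: "a < b" and less: "max a (min b (\<phi> 0)) < max a (min b (\<phi> l))"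
  shows "ennreal \<bar>max a (min b (\<phi> 0)) - max a (min b (\<phi> l))\<bar> \<le>
    (\<integral>\<^sup>+t\<in>{0..l}. G t * indicator {t. a < \<phi> t \<and> \<phi> t < b} t \<partial>lborel)"
proof -
  define \<alpha> \<beta> where "\<alpha> = max a (min b (\<phi> 0))" and "\<beta> = max a (min b (\<phi> l))"
  have \<alpha>\<beta>: "a \<le> \<alpha>" "\<alpha> < \<beta>" "\<beta> \<le> b" "\<phi> 0 \<le> \<alpha>" "\<beta> \<le> \<phi> l" using less ab by (auto simp: \<alpha>_def \<beta>_def)
  have "closed {t\<in>{0..l}. \<phi> t \<le> \<alpha>}" using cont by (intro continuous_on_closed_Collect_le continuous_intros) auto
  then have "compact ({0..l} \<inter> {t\<in>{0..l}. \<phi> t \<le> \<alpha>})" by (intro compact_Int_closed compact_Icc)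
  also have "{0..l} \<inter> {t\<in>{0..l}. \<phi> t \<le> \<alpha>} = {t\<in>{0..l}. \<phi> t \<le> \<alpha>}" by auto
  finally have "compact {t\<in>{0..l}. \<phi> t \<le> \<alpha>}" .
  moreover have "{t\<in>{0..l}. \<phi> t \<le> \<alpha>} \<noteq> {}" using \<alpha>\<beta> l by (auto intro!: exI[of _ 0])
  ultimately obtain t1 where t1: "0 \<le> t1" "t1 \<le> l" "\<phi> t1 \<le> \<alpha>" "\<And>t. 0 \<le> t \<Longrightarrow> t \<le> l \<Longrightarrow> \<phi> t \<le> \<alpha> \<Longrightarrow> t \<le> t1"
    using compact_attains_sup[of "{t\<in>{0..l}. \<phi> t \<le> \<alpha>}"] by auto
  have c1: "continuous_on {t1..l} \<phi>" using cont by (rule continuous_on_subset) (use t1 in auto)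
  then have "closed {t\<in>{t1..l}. \<beta> \<le> \<phi> t}" by (intro continuous_on_closed_Collect_le continuous_intros) auto
  then have "compact ({t1..l} \<inter> {t\<in>{t1..l}. \<beta> \<le> \<phi> t})" by (intro compact_Int_closed compact_Icc)
  also have "{t1..l} \<inter> {t\<in>{t1..l}. \<beta> \<le> \<phi> t} = {t\<in>{t1..l}. \<beta> \<le> \<phi> t}" by auto
  finally have "compact {t\<in>{t1..l}. \<beta> \<le> \<phi> t}" .
  moreover have "{t\<in>{t1..l}. \<beta> \<le> \<phi> t} \<noteq> {}" using \<alpha>\<beta> t1 by (auto intro!: exI[of _ l])
  ultimately obtain t2 where t2: "t1 \<le> t2" "t2 \<le> l" "\<beta> \<le> \<phi> t2" "\<And>t. t1 \<le> t \<Longrightarrow> t \<le> l \<Longrightarrow> \<beta> \<le> \<phi> t \<Longrightarrow> t2 \<le> t"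
    using compact_attains_inf[of "{t\<in>{t1..l}. \<beta> \<le> \<phi> t}"] by auto
  have inside: "a < \<phi> t \<and> \<phi> t < b" if "t1 < t" "t < t2" for t
    using t1(1,2) t1(4)[of t] t2(1,2) t2(4)[of t] that \<alpha>\<beta> by force
  have "ennreal \<bar>\<alpha> - \<beta>\<bar> \<le> ennreal \<bar>\<phi> t1 - \<phi> t2\<bar>" using t1 t2 \<alpha>\<beta> by (intro ennreal_leI) auto
  also have "\<dots> \<le> (\<integral>\<^sup>+\<tau>\<in>{t1..t2}. G \<tau> \<partial>lborel)" using t1 t2 by (intro bound) auto
  also have "\<dots> \<le> (\<integral>\<^sup>+t\<in>{0..l}. G t * indicator {t. a < \<phi> t \<and> \<phi> t < b} t \<partial>lborel)"
  proof (rule nn_integral_mono_AE)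
    have "AE t in lborel. t \<noteq> t1 \<and> t \<noteq> t2" using AE_lborel_singleton[of t1] AE_lborel_singleton[of t2] by eventually_elim auto
    then show "AE t in lborel. G t * indicator {t1..t2} t \<le> G t * indicator {t. a < \<phi> t \<and> \<phi> t < b} t * indicator {0..l} t"
    proof eventually_elim
      case (elim t)
      then show ?case using inside[of t] t1 t2 by (auto split: split_indicator)
    qed
  qed
  finally show ?thesis by (simp add: \<alpha>_def \<beta>_def)
qed

text \<open>A falling truncation becomes a rising one when \<phi> is replaced by its negative and
  the heights \<open>a\<close>, \<open>b\<close> by \<open>- b\<close>, \<open>- a\<close>.\<close>

lemma truncation_integral_bound:
  fixes \<phi> :: "real \<Rightarrow> real" and G :: "real \<Rightarrow> ennreal"
  assumes l: "0 \<le> l" and cont: "continuous_on {0..l} \<phi>"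
    and bound: "\<And>s t. 0 \<le> s \<Longrightarrow> s \<le> t \<Longrightarrow> t \<le> l \<Longrightarrow> ennreal \<bar>\<phi> s - \<phi> t\<bar> \<le> (\<integral>\<^sup>+\<tau>\<in>{s..t}. G \<tau> \<partial>lborel)"
    and ab: "a < b"
  shows "ennreal \<bar>max a (min b (\<phi> 0)) - max a (min b (\<phi> l))\<bar> \<le>
    (\<integral>\<^sup>+t\<in>{0..l}. G t * indicator {t. a < \<phi> t \<and> \<phi> t < b} t \<partial>lborel)"
proof (cases "max a (min b (\<phi> 0))" "max a (min b (\<phi> l))" rule: linorder_cases)
  case less
  then show ?thesis by (intro truncation_integral_bound_aux assms)
next
  case greater
  have neg: "max (- b) (min (- a) (- z)) = - max a (min b z)" for z using ab by auto
  have set: "{t. - b < - \<phi> t \<and> - \<phi> t < - a} = {t. a < \<phi> t \<and> \<phi> t < b}" by auto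
  have "ennreal \<bar>max (- b) (min (- a) (- \<phi> 0)) - max (- b) (min (- a) (- \<phi> l))\<bar> \<le>
    (\<integral>\<^sup>+t\<in>{0..l}. G t * indicator {t. - b < - \<phi> t \<and> - \<phi> t < - a} t \<partial>lborel)"
  proof (rule truncation_integral_bound_aux[OF l])
    show "continuous_on {0..l} (\<lambda>t. - \<phi> t)" using cont by (intro continuous_intros)
    show "ennreal \<bar>- \<phi> s - - \<phi> t\<bar> \<le> (\<integral>\<^sup>+\<tau>\<in>{s..t}. G \<tau> \<partial>lborel)" if "0 \<le> s" "s \<le> t" "t \<le> l" for s t
      using bound[OF that] by (simp add: abs_minus_commute)
    show "max (- b) (min (- a) (- \<phi> 0)) < max (- b) (min (- a) (- \<phi> l))"
      unfolding neg using greater by simp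
  qed (use ab in simp)
  then show ?thesis unfolding neg set by (simp add: abs_minus_commute)
qed simp

text \<open>Since \<open>g\<close> bounds the function on every subcurve, finiteness of the integral
  forces continuity along the curve, so the truncation bound applies. The contraction
  \<open>w\<close> covers both \<open>\<bar>f - m\<bar>\<close> and the function itself; the set
  \<open>A\<close> may exceed the level strip, which leaves room for a Borel set.\<close>

lemma upper_gradient_truncation_curve:
  assumes u: "upper_gradient u g" and \<gamma>: "curve l \<gamma>" and fin: "curve_integral l \<gamma> g < \<infinity>"
    and w: "\<And>x y. \<bar>w x - w y\<bar> \<le> \<bar>u x - u y\<bar>" and ab: "a < b" and A: "{y. a < w y \<and> w y < b} \<subseteq> A"
  shows "ennreal \<bar>max a (min b (w (\<gamma> 0))) - max a (min b (w (\<gamma> l)))\<bar> \<le> curve_integral l \<gamma> (\<lambda>y. g y * indicator A y)"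
proof -
  have g: "g \<in> borel_measurable borel" using u by (simp add: upper_gradient_def)
  have l: "0 \<le> l" using \<gamma> by (simp add: curve_def)
  have bound: "ennreal \<bar>w (\<gamma> s) - w (\<gamma> t)\<bar> \<le> (\<integral>\<^sup>+\<tau>\<in>{s..t}. g (\<gamma> \<tau>) \<partial>lborel)" if "0 \<le> s" "s \<le> t" "t \<le> l" for s t
    using upper_gradient_subcurve[OF u \<gamma> that] w[of "\<gamma> s" "\<gamma> t"] by (meson ennreal_leI order_trans)
  have cont: "continuous_on {0..l} (\<lambda>t. w (\<gamma> t))"
    using curve_measurable[OF \<gamma> g, of "{0..l}"] fin bound
    by (intro continuous_on_if_integral_bound[where G="\<lambda>t. g (\<gamma> t)"]) (auto simp: curve_integral_def)
  have "ennreal \<bar>max a (min b (w (\<gamma> 0))) - max a (min b (w (\<gamma> l)))\<bar>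
      \<le> (\<integral>\<^sup>+t\<in>{0..l}. g (\<gamma> t) * indicator {t. a < w (\<gamma> t) \<and> w (\<gamma> t) < b} t \<partial>lborel)"
    by (rule truncation_integral_bound[OF l cont bound ab])
  also have "\<dots> \<le> curve_integral l \<gamma> (\<lambda>y. g y * indicator A y)"
    unfolding curve_integral_def using A by (intro nn_integral_mono) (auto split: split_indicator)
  finally show ?thesis .
qed

text \<open>The only possible exceptions are curves along which \<open>g\<close> has infinite
  integral, so \<open>g\<close> itself witnesses that almost every curve is good.\<close>

lemma weak_upper_gradient_truncation:
  assumes u: "upper_gradient u g" and fin: "(\<integral>\<^sup>+x. g x epowr p \<partial>M) < \<infinity>"
    and w: "\<And>x y. \<bar>w x - w y\<bar> \<le> \<bar>u x - u y\<bar>" and ab: "a < b" and A: "{y. a < w y \<and> w y < b} \<subseteq> A" "A \<in> sets borel"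
  shows "weak_upper_gradient M p (\<lambda>y. max a (min b (w y))) (\<lambda>y. g y * indicator A y)"
  unfolding weak_upper_gradient_def almost_every_curve_def
proof (intro conjI exI[of _ g] allI impI)
  show g: "g \<in> borel_measurable borel" using u by (simp add: upper_gradient_def)
  with A(2) show "(\<lambda>y. g y * indicator A y) \<in> borel_measurable borel" by measurable
  show "(\<integral>\<^sup>+x. g x epowr p \<partial>M) < \<infinity>" by (rule fin)
  fix l \<gamma>
  assume *: "curve l \<gamma> \<and> \<not> ennreal \<bar>max a (min b (w (\<gamma> 0))) - max a (min b (w (\<gamma> l)))\<bar> \<le> curve_integral l \<gamma> (\<lambda>y. g y * indicator A y)"
  show "curve_integral l \<gamma> g = \<infinity>"
  proof (rule ccontr)
    assume "curve_integral l \<gamma> g \<noteq> \<infinity>"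
    then show False using upper_gradient_truncation_curve[OF u _ _ w ab A(1), of l \<gamma>] * by (auto simp: less_top)
  qed
qed

lemma weak_upper_gradient_upper_gradient:
  assumes "upper_gradient u g" and "(\<integral>\<^sup>+x. g x epowr p \<partial>M) < \<infinity>"
  shows "weak_upper_gradient M p u g"
  using assms unfolding weak_upper_gradient_def almost_every_curve_def upper_gradient_def by blast

text \<open>
  A curve leaving \<open>ball x (2 * R)\<close> spends positive time outside \<open>ball x R\<close>, where the
  modified gradient is infinite.
\<close>

lemma weak_upper_gradient_localize:
  fixes v :: "'a::metric_space \<Rightarrow> real"
  assumes v: "weak_upper_gradient M p v g" and R: "0 < R"
  shows "weak_upper_gradient M p (\<lambda>y. indicator (ball x (2 * R)) y * v y) (\<lambda>y. if y \<in> ball x R then g y else \<infinity>)"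
proof -
  let ?v = "\<lambda>y. indicator (ball x (2 * R)) y * v y" let ?g = "\<lambda>y. if y \<in> ball x R then g y else \<infinity>"
  have gm: "g \<in> borel_measurable borel" using v by (simp add: weak_upper_gradient_def)
  have main: "ennreal \<bar>?v (\<gamma> 0) - ?v (\<gamma> l)\<bar> \<le> curve_integral l \<gamma> ?g"
    if \<gamma>: "curve l \<gamma>" and le: "ennreal \<bar>v (\<gamma> 0) - v (\<gamma> l)\<bar> \<le> curve_integral l \<gamma> g" for l \<gamma>
  proof (cases "\<gamma> 0 \<in> ball x (2 * R) \<and> \<gamma> l \<in> ball x (2 * R)")
    case True
    then have "ennreal \<bar>?v (\<gamma> 0) - ?v (\<gamma> l)\<bar> \<le> curve_integral l \<gamma> g" using le by simp
    also have "\<dots> \<le> curve_integral l \<gamma> ?g"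
      unfolding curve_integral_def by (intro nn_integral_mono mult_right_mono) auto
    finally show ?thesis .
  next
    case False
    have l: "0 < l" and cont: "continuous_on {0..l} \<gamma>" using \<gamma> by (auto simp: curve_def)
    from False l obtain t where t: "t \<in> {0..l}" "2 * R \<le> dist x (\<gamma> t)"
      by (metis atLeastAtMost_iff less_eq_real_def mem_ball not_less order_refl)
    obtain d where d: "0 < d" "\<And>s. s \<in> {0..l} \<Longrightarrow> dist s t < d \<Longrightarrow> dist (\<gamma> s) (\<gamma> t) < R"
      using cont t(1) R unfolding continuous_on_iff by blast
    define I where "I = {max 0 (t - d)<..<min l (t + d)}"
    have I: "s \<in> {0..l} \<and> ?g (\<gamma> s) = \<infinity>" if "s \<in> I" for s
    proof -
      have s: "s \<in> {0..l}" "dist s t < d" using that by (auto simp: I_def dist_real_def)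
      then have "R \<le> dist x (\<gamma> s)" using d(2)[OF s] t(2) dist_triangle[of x "\<gamma> t" "\<gamma> s"] by simp
      then show ?thesis using s by simp
    qed
    have lt: "max 0 (t - d) < min l (t + d)" using t(1) d(1) l by auto
    have "emeasure lborel I = ennreal (min l (t + d) - max 0 (t - d))"
      unfolding I_def using lt by (intro emeasure_lborel_Ioo) simp
    then have "emeasure lborel I \<noteq> 0" using lt by (simp only: ennreal_eq_0_iff)
    then have "(\<integral>\<^sup>+s. \<infinity> * indicator I s \<partial>lborel) = \<infinity>"
      by (subst nn_integral_cmult_indicator) (auto simp: I_def ennreal_top_mult)
    moreover have "(\<integral>\<^sup>+s. \<infinity> * indicator I s \<partial>lborel) \<le> curve_integral l \<gamma> ?g"
      unfolding curve_integral_def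
    proof (intro nn_integral_mono)
      fix s
      show "\<infinity> * indicator I s \<le> ?g (\<gamma> s) * indicator {0..l} s"
      proof (cases "s \<in> I")
        case True
        then have "?g (\<gamma> s) = \<infinity>" "indicator {0..l} s = (1 :: ennreal)" using I[OF True] by auto
        then show ?thesis by (simp only:) (simp add: indicator_def)
      qed simp
    qed
    ultimately show ?thesis by (simp add: top_unique)
  qed
  have "?g \<in> borel_measurable borel" using gm by (intro measurable_If_set) auto
  then show ?thesis using v main unfolding weak_upper_gradient_def almost_every_curve_def by blast
qed

section \<open>From weak upper gradients to Poincare pairs\<close>

lemma (in metric_measure_space) borel_hull:
  assumes A: "A \<in> sets M"
  obtains B where "B \<in> sets borel" "A \<subseteq> B" "B - A \<in> null_sets M"
proof -
  fix x0 :: 'a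
  \<comment> \<open>A hull of equal measure says nothing about the difference when the measure is
    infinite; hulls of the pieces in balls of integer radius, which have finite measure, are joined
    instead.\<close>
  have "\<exists>B. B \<in> sets borel \<and> A \<inter> ball x0 (real n) \<subseteq> B \<and> B - A \<in> null_sets M" for n
  proof -
    have An: "A \<inter> ball x0 (real n) \<in> sets M" using A by auto
    then obtain B where B: "B \<in> sets borel" "A \<inter> ball x0 (real n) \<subseteq> B" "emeasure M B = emeasure M (A \<inter> ball x0 (real n))"
      using borel_regular by blast
    have "emeasure M (A \<inter> ball x0 (real n)) \<noteq> \<infinity>"
      using ball_fin[of x0 "real n"] emeasure_mono[of "A \<inter> ball x0 (real n)" "ball x0 (real n)" M] by (auto simp: top_unique)
    have sB: "B \<in> sets M" by (rule borel_setD[OF B(1)])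
    have "emeasure M (B - A \<inter> ball x0 (real n)) = 0"
      by (subst emeasure_Diff) (simp_all add: B An sB \<open>emeasure M (A \<inter> ball x0 (real n)) \<noteq> \<infinity>\<close>[unfolded infinity_ennreal_def])
    then have "B - A \<inter> ball x0 (real n) \<in> null_sets M" by (intro null_setsI sets.Diff sB An)
    then have "B - A \<in> null_sets M" by (rule null_sets_subset) (use sB A in auto)
    with B show ?thesis by (intro exI[of _ B] conjI)
  qed
  then have "\<forall>n. \<exists>B. B \<in> sets borel \<and> A \<inter> ball x0 (real n) \<subseteq> B \<and> B - A \<in> null_sets M" ..
  from choice[OF this] obtain B where B: "\<And>n. B n \<in> sets borel" "\<And>n. A \<inter> ball x0 (real n) \<subseteq> B n" "\<And>n. B n - A \<in> null_sets M" by auto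
  show ?thesis
  proof (rule that[of "\<Union>n. B n"])
    show "A \<subseteq> (\<Union>n. B n)"
    proof
      fix x assume x: "x \<in> A"
      obtain n where "dist x0 x < real n" using reals_Archimedean2 by blast
      then have "x \<in> B n" using x B(2)[of n] by auto
      then show "x \<in> (\<Union>n. B n)" by blast
    qed
    have "(\<Union>n. B n) - A = (\<Union>n. B n - A)" by auto
    also have "\<dots> \<in> null_sets M" using B(3) by (intro null_sets_UN') auto
    finally show "(\<Union>n. B n) - A \<in> null_sets M" .
  qed (use B(1) in auto)
qed

lemma (in metric_measure_space) locally_integrable_bounded:
  assumes v: "v \<in> borel_measurable M" and b: "\<And>y. \<bar>v y\<bar> \<le> b"
  shows "locally_integrable v"
  unfolding locally_integrable_def set_integrable_def
proof (intro conjI allI v)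
  fix x r
  have "integrable M (\<lambda>y. b * indicator (ball x r) y)"
    using ball_fin[of x r] by (intro integrable_mult_right integrable_real_indicator) auto
  then show "integrable M (\<lambda>y. indicator (ball x r) y *\<^sub>R v y)"
  proof (rule Bochner_Integration.integrable_bound)
    have "\<bar>v y\<bar> \<le> \<bar>b\<bar>" for y using b[of y] by simp
    then show "AE y in M. norm (indicator (ball x r) y *\<^sub>R v y) \<le> norm (b * indicator (ball x r) y)"
      by (auto split: split_indicator)
  qed (use v in measurable)
qed

lemma (in metric_measure_space) locally_integrable_powr:
  assumes v: "v \<in> borel_measurable M" and p: "1 \<le> p" and fin: "(\<integral>\<^sup>+x. ennreal (\<bar>v x\<bar> powr p) \<partial>M) < \<infinity>"
  shows "locally_integrable v"
  unfolding locally_integrable_def set_integrable_def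
proof (intro conjI allI v)
  fix x r
  have "integrable M (\<lambda>y. indicator (ball x r) y :: real)"
    using ball_fin[of x r] by (intro integrable_real_indicator) auto
  moreover have "integrable M (\<lambda>y. \<bar>v y\<bar> powr p)"
    using fin v by (intro integrableI_nonneg) auto
  ultimately have "integrable M (\<lambda>y. indicator (ball x r) y + \<bar>v y\<bar> powr p)" by (rule Bochner_Integration.integrable_add)
  then show "integrable M (\<lambda>y. indicator (ball x r) y *\<^sub>R v y)"
  proof (rule Bochner_Integration.integrable_bound)
    have "\<bar>v y\<bar> \<le> 1 + \<bar>v y\<bar> powr p" for y
    proof (cases "\<bar>v y\<bar> \<le> 1")
      case False
      then have "\<bar>v y\<bar> powr 1 \<le> \<bar>v y\<bar> powr p" using p by (intro powr_mono) auto
      then show ?thesis by simp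
    qed (simp add: add_increasing2)
    then show "AE y in M. norm (indicator (ball x r) y *\<^sub>R v y) \<le> norm (indicator (ball x r) y + \<bar>v y\<bar> powr p)"
      by (auto split: split_indicator)
  qed (use v in measurable)
qed

lemma (in metric_measure_space) nn_average_le:
  assumes r: "0 < r" and le: "(\<integral>\<^sup>+y\<in>ball x r. f y \<partial>M) \<le> ennreal (t * measure M (ball x r))" and t: "0 \<le> t"
  shows "nn_average M (ball x r) f \<le> ennreal t"
proof -
  have "nn_average M (ball x r) f \<le> ennreal (t * measure M (ball x r)) / ennreal (measure M (ball x r))"
    unfolding nn_average_def emeasure_ball using le by (rule divide_right_mono_ennreal)
  also have "\<dots> = ennreal t" using measure_ball_pos[OF r, of x] t by (simp add: divide_ennreal)
  finally show ?thesis .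
qed

text \<open>The Poincare inequality asks for global integrability, but only local integrability is
  at hand, so \<open>v\<close> is cut off outside a ball. In the constant, \<open>2 * C0\<close>
  comes from \<open>diameter (ball x r) \<le> 2 * r\<close>, and 1 is added because the locale asks
  for a constant of at least 1.\<close>

lemma (in doubling_space) poincare_pair_weak_upper_gradient:
  assumes p: "1 < p" and C0: "0 < C0" and \<sigma>: "1 \<le> \<sigma>"
    and poin: "\<And>x r u g. 0 < r \<Longrightarrow> integrable M u \<Longrightarrow> weak_upper_gradient M p u g \<Longrightarrow>
     ennreal (average M (ball x r) (\<lambda>y. \<bar>u y - average M (ball x r) u\<bar>))
       \<le> ennreal (C0 * diameter (ball x r)) * (nn_average M (ball x (\<sigma> * r)) (\<lambda>y. g y epowr p)) epowr (1 / p)"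
    and v: "locally_integrable v" and g: "weak_upper_gradient M p v g"
  shows "poincare_space.poincare_pair M p (1 + 2 * C0) \<sigma> v (density M (\<lambda>y. g y epowr p))"
proof -
  interpret poincare_space M Cd p "1 + 2 * C0" \<sigma>
    using p C0 \<sigma> by unfold_locales auto
  have gm: "g \<in> borel_measurable borel" using g by (simp add: weak_upper_gradient_def)
  then have [measurable]: "g \<in> borel_measurable M" by (rule borel_funD)
  let ?\<nu> = "density M (\<lambda>y. g y epowr p)"
  have "average M (ball x r) (\<lambda>z. \<bar>v z - average M (ball x r) v\<bar>) \<le> (1 + 2 * C0) * r * T"
    if r: "0 < r" and l: "level ?\<nu> x r T" for x r T
  proof -
    define R where "R = \<sigma> * r"
    have R: "0 < R" "r \<le> R" using r \<sigma> by (auto simp: R_def)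
    have T: "0 \<le> T" and l': "emeasure ?\<nu> (ball x R) \<le> ennreal (T powr p * measure M (ball x R))"
      using l by (auto simp: level_def R_def)
    \<comment> \<open>Both modifications take place outside \<open>ball x R\<close>, which is the
      ball of the right-hand side and contains \<open>ball x r\<close>, so neither side of the
      inequality changes.\<close>
    let ?v = "\<lambda>y. indicator (ball x (2 * R)) y * v y" let ?g = "\<lambda>y. if y \<in> ball x R then g y else \<infinity>"
    have av: "average M (ball x r) (\<lambda>y. F (?v y)) = average M (ball x r) (\<lambda>y. F (v y))" for F
      unfolding average_def set_lebesgue_integral_def using R
      by (intro arg_cong2[of _ _ _ _ "(/)"] Bochner_Integration.integral_cong) (auto split: split_indicator)
    have "ennreal (average M (ball x r) (\<lambda>y. \<bar>?v y - average M (ball x r) ?v\<bar>))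
       \<le> ennreal (C0 * diameter (ball x r)) * (nn_average M (ball x (\<sigma> * r)) (\<lambda>y. ?g y epowr p)) epowr (1 / p)"
      using v R by (intro poin[OF r] weak_upper_gradient_localize[OF g])
        (auto simp: locally_integrable_def set_integrable_def)
    also have "average M (ball x r) (\<lambda>y. \<bar>?v y - average M (ball x r) ?v\<bar>) = average M (ball x r) (\<lambda>y. \<bar>v y - average M (ball x r) v\<bar>)"
      using av[of "\<lambda>z. \<bar>z - average M (ball x r) ?v\<bar>"] av[of "\<lambda>z. z"] by simp
    also have "nn_average M (ball x (\<sigma> * r)) (\<lambda>y. ?g y epowr p) \<le> ennreal (T powr p)"
    proof -
      have "(\<integral>\<^sup>+y\<in>ball x R. ?g y epowr p \<partial>M) = emeasure ?\<nu> (ball x R)"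
        by (subst emeasure_density) (auto intro!: nn_integral_cong split: split_indicator)
      then show ?thesis unfolding R_def[symmetric] using l' by (intro nn_average_le[OF R(1)]) auto
    qed
    then have "(nn_average M (ball x (\<sigma> * r)) (\<lambda>y. ?g y epowr p)) epowr (1 / p) \<le> ennreal (T powr p) epowr (1 / p)"
      using p by (intro epowr_mono) auto
    also have "\<dots> = ennreal T" using T p by (simp add: epowr_ennreal powr_powr)
    finally have "ennreal (average M (ball x r) (\<lambda>z. \<bar>v z - average M (ball x r) v\<bar>)) \<le> ennreal (C0 * diameter (ball x r)) * ennreal T"
      by (simp add: mult_left_mono)
    also have "\<dots> \<le> ennreal (C0 * (2 * r)) * ennreal T"
    proof (intro mult_right_mono ennreal_leI mult_left_mono)
      show "diameter (ball x r) \<le> 2 * r"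
      proof -
        have "dist y z \<le> 2 * r" if "y \<in> ball x r" "z \<in> ball x r" for y z
          using that dist_triangle2[of y z x] by (simp add: dist_commute)
        then show ?thesis using r unfolding diameter_def by (auto intro!: cSUP_least)
      qed
    qed (use C0 in auto)
    also have "\<dots> = ennreal (C0 * (2 * r) * T)" using C0 r T by (simp add: ennreal_mult)
    finally have "average M (ball x r) (\<lambda>z. \<bar>v z - average M (ball x r) v\<bar>) \<le> C0 * (2 * r) * T"
      using C0 r T by (subst (asm) ennreal_le_iff) auto
    also have "\<dots> \<le> (1 + 2 * C0) * r * T" using r T by (simp add: algebra_simps)
    finally show ?thesis .
  qed
  then show ?thesis using v by (auto simp: poincare_pair_def)
qed

text \<open>The strip \<open>A\<close> is measurable for \<open>M\<close> but need not be Borel, as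
  a gradient must be. Its Borel hull \<open>B\<close> differs from it by a null set, so cutting
  \<open>g\<close> to \<open>B\<close> yields the same measure as restricting to
  \<open>A\<close>.\<close>

lemma (in doubling_space) poincare_pair_truncation:
  assumes p: "1 < p" and C0: "0 < C0" and \<sigma>: "1 \<le> \<sigma>"
    and poin: "\<And>x r u g. 0 < r \<Longrightarrow> integrable M u \<Longrightarrow> weak_upper_gradient M p u g \<Longrightarrow>
     ennreal (average M (ball x r) (\<lambda>y. \<bar>u y - average M (ball x r) u\<bar>))
       \<le> ennreal (C0 * diameter (ball x r)) * (nn_average M (ball x (\<sigma> * r)) (\<lambda>y. g y epowr p)) epowr (1 / p)"
    and f: "f \<in> borel_measurable M" and g: "upper_gradient f g" and fin: "(\<integral>\<^sup>+x. g x epowr p \<partial>M) < \<infinity>" and ab: "a < b"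
  shows "poincare_space.poincare_pair M p (1 + 2 * C0) \<sigma> (\<lambda>y. max a (min b \<bar>f y - m\<bar>))
    (density (density M (\<lambda>y. g y epowr p)) (indicator {y. a < \<bar>f y - m\<bar> \<and> \<bar>f y - m\<bar> < b}))"
proof -
  note f[measurable]
  define A where "A = {y. a < \<bar>f y - m\<bar> \<and> \<bar>f y - m\<bar> < b}"
  have "A = {y\<in>space M. a < \<bar>f y - m\<bar> \<and> \<bar>f y - m\<bar> < b}" by (simp add: A_def)
  also have "\<dots> \<in> sets M" by measurable
  finally have A: "A \<in> sets M" .
  obtain B where B: "B \<in> sets borel" "A \<subseteq> B" "B - A \<in> null_sets M" by (rule borel_hull[OF A])
  have gm[measurable]: "g \<in> borel_measurable M" using g by (intro borel_funD) (simp add: upper_gradient_def)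
  have BM[measurable]: "B \<in> sets M" using B borel_setD by auto
  note A[measurable]
  have wug: "weak_upper_gradient M p (\<lambda>y. max a (min b \<bar>f y - m\<bar>)) (\<lambda>y. g y * indicator B y)"
    using B(2) by (intro weak_upper_gradient_truncation[OF g fin _ ab _ B(1)]) (auto simp: A_def)
  have li: "locally_integrable (\<lambda>y. max a (min b \<bar>f y - m\<bar>))"
    by (rule locally_integrable_bounded[where b="\<bar>a\<bar> + \<bar>b\<bar>"]) auto
  have "density (density M (\<lambda>y. g y epowr p)) (indicator A) = density M (\<lambda>y. g y epowr p * indicator A y)"
    by (rule density_density_eq) measurable
  also have "\<dots> = density M (\<lambda>y. (g y * indicator B y) epowr p)"
  proof (rule density_cong)
    have "AE y in M. y \<notin> B - A" using B(3) by (rule AE_not_in)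
    then show "AE y in M. g y epowr p * indicator A y = (g y * indicator B y) epowr p"
      using B(2) by (auto elim!: eventually_mono split: split_indicator)
  qed measurable
  finally have eq: "density (density M (\<lambda>y. g y epowr p)) (indicator A) = density M (\<lambda>y. (g y * indicator B y) epowr p)" .
  show ?thesis
    unfolding eq[unfolded A_def] by (rule poincare_pair_weak_upper_gradient[OF p C0 \<sigma> poin li wug])
qed

section \<open>The Morrey case\<close>

lemma suminf_geometric_finite:
  assumes "0 \<le> A" "0 \<le> \<theta>" "\<theta> < 1"
  shows "(\<Sum>k. ennreal (A * \<theta> ^ k)) < \<infinity>"
proof -
  have "summable (\<lambda>k. A * \<theta> ^ k)" using assms by (intro summable_mult summable_geometric) auto
  then have "(\<Sum>k. ennreal (A * \<theta> ^ k)) = ennreal (\<Sum>k. A * \<theta> ^ k)" using assms by (intro suminf_ennreal2) auto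
  then show ?thesis by simp
qed

text \<open>Each dyadic interval has mass at most 1 for the estimate
  \<open>1 / r \<le> 2 ^ Suc k / \<delta>\<close>. Comparison with a step function by monotonicity
  applies to an arbitrary \<open>F\<close>, so measurability of the oscillation in \<open>r\<close>
  does not enter.\<close>

lemma nn_integral_dyadic_le:
  assumes \<delta>: "0 < \<delta>" and le: "\<And>k r. \<delta> / 2 ^ Suc k \<le> r \<Longrightarrow> r < \<delta> / 2 ^ k \<Longrightarrow> F r \<le> c k"
  shows "(\<integral>\<^sup>+r\<in>{0<..<\<delta>}. F r * ennreal (1 / r) \<partial>lborel) \<le> (\<Sum>k. c k)"
proof -
  define I where "I k = {\<delta> / 2 ^ Suc k..<\<delta> / 2 ^ k}" for k :: nat
  have "F r * ennreal (1 / r) * indicator {0<..<\<delta>} r \<le> (\<Sum>k. c k * ennreal (2 ^ Suc k / \<delta>) * indicator (I k) r)" for r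
  proof (cases "r \<in> {0<..<\<delta>}")
    case True
    then have r: "0 < r" "r < \<delta>" by auto
    obtain m where "\<delta> / r < 2 ^ m" using real_arch_pow[of 2 "\<delta> / r"] by auto
    then have ex: "\<exists>m. \<delta> / 2 ^ m \<le> r" using r by (intro exI[of _ m]) (simp add: field_simps)
    define m where "m = (LEAST m. \<delta> / 2 ^ m \<le> r)"
    have m: "\<delta> / 2 ^ m \<le> r" unfolding m_def by (rule LeastI_ex[OF ex])
    then have "m \<noteq> 0" using r by (intro notI) simp
    then obtain k where k: "m = Suc k" by (cases m) auto
    have lt: "r < \<delta> / 2 ^ k" using not_less_Least[of k "\<lambda>m. \<delta> / 2 ^ m \<le> r"] k by (simp add: m_def)
    have rI: "r \<in> I k" using m lt k by (simp add: I_def)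
    have "1 / r \<le> 2 ^ Suc k / \<delta>" using m k r \<delta> by (simp add: field_simps)
    then have "F r * ennreal (1 / r) \<le> c k * ennreal (2 ^ Suc k / \<delta>)"
      using le[of k r] rI by (intro mult_mono ennreal_leI) (auto simp: I_def)
    also have "\<dots> = (\<Sum>k\<in>{k}. c k * ennreal (2 ^ Suc k / \<delta>) * indicator (I k) r)" using rI by simp
    also have "\<dots> \<le> (\<Sum>k. c k * ennreal (2 ^ Suc k / \<delta>) * indicator (I k) r)" by (intro sum_le_suminf) auto
    finally show ?thesis using True by simp
  qed simp
  then have "(\<integral>\<^sup>+r\<in>{0<..<\<delta>}. F r * ennreal (1 / r) \<partial>lborel) \<le> (\<integral>\<^sup>+r. (\<Sum>k. c k * ennreal (2 ^ Suc k / \<delta>) * indicator (I k) r) \<partial>lborel)"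
    by (intro nn_integral_mono)
  also have "\<dots> = (\<Sum>k. \<integral>\<^sup>+r. c k * ennreal (2 ^ Suc k / \<delta>) * indicator (I k) r \<partial>lborel)"
    by (intro nn_integral_suminf) (auto simp: I_def)
  also have "\<dots> = (\<Sum>k. c k)"
  proof (intro suminf_cong)
    fix k
    have "emeasure lborel (I k) = ennreal (\<delta> / 2 ^ Suc k)"
    proof -
      have le: "\<delta> / 2 ^ Suc k \<le> \<delta> / 2 ^ k" using \<delta> by (simp add: field_simps)
      have "\<delta> / 2 ^ k - \<delta> / 2 ^ Suc k = \<delta> / 2 ^ Suc k" by (simp add: field_simps)
      then show ?thesis unfolding I_def emeasure_lborel_Ico[OF le] by simp
    qed
    moreover have "ennreal (2 ^ Suc k / \<delta>) * ennreal (\<delta> / 2 ^ Suc k) = 1"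
      using \<delta> by (simp add: ennreal_mult''[symmetric])
    ultimately show "(\<integral>\<^sup>+r. c k * ennreal (2 ^ Suc k / \<delta>) * indicator (I k) r \<partial>lborel) = c k"
      by (subst nn_integral_cmult_indicator) (auto simp: I_def mult.assoc)
  qed
  finally show ?thesis .
qed

text \<open>
  Inserting the weights \<open>2 powr (\<eta> * k)\<close> replaces Hoelder's inequality (for \<open>s \<ge> 1\<close>) and
  subadditivity (for \<open>s \<le> 1\<close>) by a single estimate.
\<close>

lemma suminf_epowr_le:
  assumes s: "0 < s" and \<eta>: "0 < \<eta>"
  obtains K where "0 \<le> K" "\<And>a :: nat \<Rightarrow> real. \<forall>k. 0 \<le> a k \<Longrightarrow>
    (\<Sum>k. ennreal (a k)) epowr s \<le> ennreal K * (\<Sum>k. ennreal (2 powr (\<eta> * real k) * a k powr s))"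
proof -
  define \<theta> :: real where "\<theta> = 2 powr (- \<eta> / s)"
  have \<theta>: "0 < \<theta>" "\<theta> < 1" using s \<eta> powr_less_mono[of "- \<eta> / s" 0 2] by (auto simp: \<theta>_def)
  define K where "K = (1 / (1 - \<theta>)) powr s"
  have K: "0 < K" using \<theta> by (simp add: K_def)
  show ?thesis
  proof (rule that[of K])
    fix a :: "nat \<Rightarrow> real" assume a: "\<forall>k. 0 \<le> a k"
    let ?S = "\<Sum>k. ennreal (2 powr (\<eta> * real k) * a k powr s)"
    show "(\<Sum>k. ennreal (a k)) epowr s \<le> ennreal K * ?S"
    proof (cases "?S = \<infinity>")
      case True
      then show ?thesis using K by (simp add: ennreal_mult_top)
    next
      case False
      define S where "S = enn2real ?S"
      have S: "?S = ennreal S" "0 \<le> S" using False by (simp_all add: S_def less_top)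
      \<comment> \<open>A single term is at most the whole weighted sum \<open>S\<close>, so
        \<open>a k\<close> itself decays geometrically with ratio \<open>\<theta>\<close>.\<close>
      have bound: "a k \<le> S powr (1 / s) * \<theta> ^ k" for k
      proof -
        have "(\<Sum>j\<in>{k}. ennreal (2 powr (\<eta> * real j) * a j powr s)) \<le> ?S" by (intro sum_le_suminf) auto
        then have "2 powr (\<eta> * real k) * a k powr s \<le> S" using S by simp
        then have "a k powr s \<le> S * 2 powr (- \<eta> * real k)"
          by (simp add: powr_minus field_simps)
        then have "(a k powr s) powr (1 / s) \<le> (S * 2 powr (- \<eta> * real k)) powr (1 / s)"
          using s by (intro powr_mono2) auto
        also have "\<dots> = S powr (1 / s) * \<theta> ^ k"
          using S(2) by (simp add: powr_mult \<theta>_def powr_realpow[symmetric] powr_powr)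
        finally show ?thesis using s a by (simp add: powr_powr)
      qed
      have sm: "summable (\<lambda>k. S powr (1 / s) * \<theta> ^ k)" using \<theta> by (intro summable_mult summable_geometric) auto
      have "(\<Sum>k. ennreal (a k)) \<le> (\<Sum>k. ennreal (S powr (1 / s) * \<theta> ^ k))"
        by (intro suminf_le ennreal_leI bound) auto
      also have "\<dots> = ennreal (\<Sum>k. S powr (1 / s) * \<theta> ^ k)" using sm \<theta> by (intro suminf_ennreal2) auto
      also have "(\<Sum>k. S powr (1 / s) * \<theta> ^ k) = S powr (1 / s) * (1 / (1 - \<theta>))"
        using \<theta> by (subst suminf_mult) (auto simp: suminf_geometric)
      finally have "(\<Sum>k. ennreal (a k)) epowr s \<le> ennreal (S powr (1 / s) * (1 / (1 - \<theta>))) epowr s"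
        using s by (intro epowr_mono) auto
      also have "\<dots> = ennreal (S * K)"
        using \<theta> S(2) s by (subst epowr_ennreal) (auto simp: powr_mult powr_powr K_def powr_divide)
      finally show ?thesis unfolding S(1) using K S(2) by (simp add: ennreal_mult mult.commute)
    qed
  qed (use K in simp)
qed

text \<open>Confinement of all means at small radii gives both finiteness and location of the upper
  limit; the lower bound passes through the lower limit and uses that the filter
  \<open>at_right 0\<close> is nontrivial.\<close>

lemma limsup_representative_near:
  assumes r: "0 < r" and near: "\<And>s. 0 < s \<Longrightarrow> s \<le> r \<Longrightarrow> \<bar>average M (ball x s) f - m\<bar> \<le> e"
  obtains a where "limsup_representative M f x = ereal a" "\<bar>a - m\<bar> \<le> e"
proof -
  have ev: "\<forall>\<^sub>F s in at_right 0. ereal (m - e) \<le> ereal (average M (ball x s) f)"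
    "\<forall>\<^sub>F s in at_right 0. ereal (average M (ball x s) f) \<le> ereal (m + e)"
    unfolding eventually_at_right_field using r near by (force simp: abs_le_iff algebra_simps intro!: exI[of _ r])+
  have "limsup_representative M f x \<le> ereal (m + e)"
    unfolding limsup_representative_def by (rule Limsup_bounded[OF ev(2)])
  moreover have "ereal (m - e) \<le> limsup_representative M f x"
    unfolding limsup_representative_def
    by (rule order_trans[OF Liminf_bounded[OF ev(1)] Liminf_le_Limsup]) (simp add: trivial_limit_at_right_real)
  ultimately show ?thesis using that by (cases "limsup_representative M f x") (auto simp: abs_le_iff)
qed

lemma e2ennreal_epowr_le:
  assumes "\<bar>a - b\<bar> \<le> t" "0 \<le> h"
  shows "e2ennreal \<bar>ereal a - ereal b\<bar> epowr h \<le> ennreal (t powr h)"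
proof -
  have "e2ennreal \<bar>ereal a - ereal b\<bar> epowr h = ennreal (\<bar>a - b\<bar> powr h)"
    by (simp add: epowr_ennreal)
  also have "\<dots> \<le> ennreal (t powr h)" using assms by (intro ennreal_leI powr_mono2) auto
  finally show ?thesis .
qed

lemma (in metric_measure_space) nn_average_epowr_le:
  assumes r: "0 < r" and le: "(\<integral>\<^sup>+y\<in>ball x r. f y \<partial>M) \<le> ennreal (t powr h * A * measure M (ball x r))"
    and t: "0 \<le> t" and A: "0 \<le> A" and h: "0 < h" and p: "1 < p"
  shows "(nn_average M (ball x r) f) epowr (p / (h * (p - 1))) \<le> ennreal (A powr (p / (h * (p - 1))) * t powr (p / (p - 1)))"
proof -
  have "nn_average M (ball x r) f \<le> ennreal (t powr h * A)" using le A by (intro nn_average_le[OF r]) auto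
  then have "(nn_average M (ball x r) f) epowr (p / (h * (p - 1))) \<le> ennreal (t powr h * A) epowr (p / (h * (p - 1)))"
    using h p by (intro epowr_mono) auto
  also have "\<dots> = ennreal (A powr (p / (h * (p - 1))) * t powr (p / (p - 1)))"
    using h p t A by (subst epowr_ennreal) (auto simp: powr_mult powr_powr mult.commute)
  finally show ?thesis .
qed

text \<open>The product sigma-algebra is generated by rectangles, so the open set is written as a
  countable union of products of balls, with centres in a dense set and rational radii
  \<open>s\<close> against \<open>R - s\<close>.\<close>

lemma (in doubling_space) dist_less_measurable:
  "{z \<in> space (M \<Otimes>\<^sub>M M). dist (fst z) (snd z) < R} \<in> sets (M \<Otimes>\<^sub>M M)"
proof -
  obtain D :: "'a set" where D: "countable D" "\<And>x e. 0 < e \<Longrightarrow> \<exists>c\<in>D. dist c x < e"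
    by (rule separable) (rule that, assumption)
  have "{z \<in> space (M \<Otimes>\<^sub>M M). dist (fst z) (snd z) < R} = (\<Union>c\<in>D. \<Union>s\<in>\<rat>. ball c s \<times> ball c (R - s))"
  proof (intro equalityI subsetI)
    fix z assume "z \<in> {z \<in> space (M \<Otimes>\<^sub>M M). dist (fst z) (snd z) < R}"
    then obtain x y where z: "z = (x, y)" and lt: "dist x y < R" by (cases z) auto
    define e where "e = (R - dist x y) / 3"
    have e: "0 < e" using lt by (simp add: e_def)
    obtain c where c: "c \<in> D" "dist c x < e" using D(2)[OF e] by blast
    obtain s where s: "s \<in> \<rat>" "e < s" "s < 2 * e" using Rats_dense_in_real[of e "2 * e"] e by auto
    have "dist c y \<le> dist c x + dist x y" by (rule dist_triangle)
    then have "dist c y < R - s" using c s by (simp add: e_def)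
    then show "z \<in> (\<Union>c\<in>D. \<Union>s\<in>\<rat>. ball c s \<times> ball c (R - s))" using c s z by fastforce
  next
    fix z assume "z \<in> (\<Union>c\<in>D. \<Union>s\<in>\<rat>. ball c s \<times> ball c (R - s))"
    then obtain c s where cs: "dist c (fst z) < s" "dist c (snd z) < R - s" by auto
    then have "dist (fst z) (snd z) < R" using dist_triangle3[of "fst z" "snd z" c] by simp
    then show "z \<in> {z \<in> space (M \<Otimes>\<^sub>M M). dist (fst z) (snd z) < R}" by (simp add: space_pair_measure)
  qed
  also have "\<dots> \<in> sets (M \<Otimes>\<^sub>M M)"
    using D(1) countable_rat by (intro sets.countable_UN'' pair_measureI ball_sets) auto
  finally show ?thesis .
qed

lemma (in doubling_space) ball_density_measurable:
  assumes G[measurable]: "G \<in> borel_measurable M"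
  shows "(\<lambda>x. emeasure (density M G) (ball x R)) \<in> borel_measurable M"
proof -
  let ?D = "{z \<in> space (M \<Otimes>\<^sub>M M). dist (fst z) (snd z) < R}"
  note dist_less_measurable[of R, measurable]
  have "(\<lambda>x. \<integral>\<^sup>+y. G y * indicator ?D (x, y) \<partial>M) \<in> borel_measurable M"
    by (rule borel_measurable_nn_integral) measurable
  also have "(\<lambda>x. \<integral>\<^sup>+y. G y * indicator ?D (x, y) \<partial>M) = (\<lambda>x. emeasure (density M G) (ball x R))"
    by (subst emeasure_density) (auto simp: space_pair_measure intro!: ext nn_integral_cong split: split_indicator)
  finally show ?thesis .
qed

text \<open>After exchanging the integrals, \<open>y\<close> contributes \<open>G y\<close> times
  the integral of \<open>1 / measure M (ball x R)\<close> over \<open>x \<in> ball y R\<close>.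
  There \<open>ball y R\<close> lies in \<open>ball x (2 * R)\<close>, so doubling bounds that
  integral by \<open>Cd\<close>.\<close>

lemma (in doubling_space) nn_integral_ball_ratio_le:
  assumes G[measurable]: "G \<in> borel_measurable M" and R: "0 < R"
  shows "(\<integral>\<^sup>+x. emeasure (density M G) (ball x R) / emeasure M (ball x R) \<partial>M) \<le> ennreal Cd * emeasure (density M G) UNIV"
proof -
  let ?D = "{z \<in> space (M \<Otimes>\<^sub>M M). dist (fst z) (snd z) < R}"
  note dist_less_measurable[of R, measurable]
  interpret pair_sigma_finite M M ..
  have mm[measurable]: "(\<lambda>x. emeasure M (ball x R)) \<in> borel_measurable M"
    using ball_density_measurable[of "\<lambda>_. 1" R] by (simp add: density_1)
  have inv: "a / emeasure M (ball x R) = a * ennreal (1 / measure M (ball x R))" for a x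
    using measure_ball_pos[OF R, of x] unfolding emeasure_ball
    by (simp add: divide_ennreal_def inverse_ennreal inverse_eq_divide)
  have "(\<integral>\<^sup>+x. emeasure (density M G) (ball x R) / emeasure M (ball x R) \<partial>M)
    = (\<integral>\<^sup>+x. (\<integral>\<^sup>+y. G y * indicator ?D (x, y) / emeasure M (ball x R) \<partial>M) \<partial>M)"
  proof (intro nn_integral_cong)
    fix x
    have "emeasure (density M G) (ball x R) = (\<integral>\<^sup>+y. G y * indicator ?D (x, y) \<partial>M)"
      by (subst emeasure_density) (auto simp: space_pair_measure intro!: nn_integral_cong split: split_indicator)
    then show "emeasure (density M G) (ball x R) / emeasure M (ball x R) = (\<integral>\<^sup>+y. G y * indicator ?D (x, y) / emeasure M (ball x R) \<partial>M)"
      by (simp add: nn_integral_divide)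
  qed
  also have "\<dots> = (\<integral>\<^sup>+y. (\<integral>\<^sup>+x. G y * indicator ?D (x, y) / emeasure M (ball x R) \<partial>M) \<partial>M)"
    by (rule Fubini'[symmetric]) measurable
  also have "\<dots> \<le> (\<integral>\<^sup>+y. G y * ennreal Cd \<partial>M)"
  proof (intro nn_integral_mono)
    fix y
    have "(\<integral>\<^sup>+x. G y * indicator ?D (x, y) / emeasure M (ball x R) \<partial>M)
      \<le> (\<integral>\<^sup>+x. (G y * ennreal (Cd / measure M (ball y R))) * indicator (ball y R) x \<partial>M)"
    proof (intro nn_integral_mono)
      fix x
      show "G y * indicator ?D (x, y) / emeasure M (ball x R) \<le> (G y * ennreal (Cd / measure M (ball y R))) * indicator (ball y R) x"
      proof (cases "dist x y < R")
        case True
        have "ball y R \<subseteq> ball x (2 * R)"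
        proof
          fix z assume "z \<in> ball y R" then show "z \<in> ball x (2 * R)" using True dist_triangle[of x z y] by simp
        qed
        then have "measure M (ball y R) \<le> measure M (ball x (2 * R))" by (intro measure_ball_mono) auto
        also have "\<dots> \<le> Cd * measure M (ball x R)" by (rule doubling_ball[OF R])
        finally have "1 / measure M (ball x R) \<le> Cd / measure M (ball y R)"
          using measure_ball_pos[OF R] by (simp add: field_simps)
        then have "G y * ennreal (1 / measure M (ball x R)) \<le> G y * ennreal (Cd / measure M (ball y R))"
          by (intro mult_left_mono ennreal_leI) auto
        with True show ?thesis unfolding inv by (simp add: space_pair_measure dist_commute)
      qed (simp add: space_pair_measure)
    qed
    also have "\<dots> = G y * ennreal (Cd / measure M (ball y R)) * ennreal (measure M (ball y R))"
      by (simp add: nn_integral_cmult_indicator emeasure_ball)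
    also have "\<dots> = G y * ennreal Cd"
      using measure_ball_pos[OF R, of y] Cd_ge_1 by (simp add: mult.assoc ennreal_mult''[symmetric])
    finally show "(\<integral>\<^sup>+x. G y * indicator ?D (x, y) / emeasure M (ball x R) \<partial>M) \<le> G y * ennreal Cd" .
  qed
  also have "\<dots> = ennreal Cd * emeasure (density M G) UNIV"
    using sets.top[of M] by (subst nn_integral_multc) (auto simp: emeasure_density mult.commute)
  finally show ?thesis .
qed

context poincare_decay_space
begin

text \<open>The first part of the constant comes from the chain of balls centred at
  \<open>y\<close>, which converges because \<open>Q / p < 1\<close>; the second moves the centre
  from \<open>y\<close> to \<open>x\<close> at radius \<open>r\<close>.\<close>

lemma limsup_representative_morrey:
  assumes pp: "poincare_pair f \<nu>" and Q: "Q < p" and r: "0 < r" and T: "0 \<le> T"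
    and U: "emeasure \<nu> (ball x (2 * \<sigma> * r)) \<le> ennreal (T powr p * measure M (ball x r))" and y: "y \<in> ball x r"
  obtains a where "limsup_representative M f y = ereal a"
    "\<bar>a - average M (ball x r) f\<bar> \<le> (telescope (Q / p) * c powr (- 1 / p) + 4 * growth 4 * C) * (r * T)"
proof -
  have \<nu>: "sets \<nu> = sets M" using pp by (simp add: poincare_pair_def)
  have \<beta>: "Q / p < 1" using Q p_gt_1 by simp
  obtain a where a: "limsup_representative M f y = ereal a"
    "\<bar>a - average M (ball y r) f\<bar> \<le> telescope (Q / p) * (r * (T * c powr (- 1 / p)))"
  proof (rule limsup_representative_near[OF r])
    fix s assume "0 < s" "s \<le> r"
    then show "\<bar>average M (ball y s) f - average M (ball y r) f\<bar> \<le> telescope (Q / p) * (r * (T * c powr (- 1 / p)))"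
      using T by (intro average_telescope[OF pp r _ \<beta>] level_dyadic[OF \<nu> y T r U]) auto
  qed
  moreover have "\<bar>average M (ball y r) f - average M (ball x r) f\<bar> \<le> 4 * growth 4 * C * (r * T)"
    by (rule average_nearby[OF pp y T r U])
  ultimately have "\<bar>a - average M (ball x r) f\<bar> \<le> (telescope (Q / p) * c powr (- 1 / p) + 4 * growth 4 * C) * (r * T)"
    by (simp add: algebra_simps)
  with a(1) show ?thesis by (rule that)
qed

text \<open>On each dyadic interval of radii the oscillation is at most a multiple of
  \<open>d k * T k x\<close>. The outer power \<open>p - 1\<close> is moved inside the dyadic sum at
  the price of weights, after which each term is linear in the ratio \<open>A k x\<close>, whose
  integral is bounded uniformly in \<open>k\<close>.\<close>

lemma oscillation_integral_morrey:
  assumes G[measurable]: "G \<in> borel_measurable M" and fin: "emeasure (density M G) UNIV < \<infinity>"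
    and pp: "poincare_pair f (density M G)" and Q: "Q < p" and h: "0 < h" and \<delta>: "0 < \<delta>"
    and u: "\<And>x. u x = limsup_representative M f x"
  shows "(\<integral>\<^sup>+x. oscillation_integral M p h \<delta> u x epowr (p - 1) \<partial>M) < \<infinity>"
proof -
  let ?\<nu> = "density M G"
  define K1 where "K1 = telescope (Q / p) * c powr (- 1 / p) + 4 * growth 4 * C"
  have K1: "0 \<le> K1" using telescope_nonneg[of "Q / p"] Q p_gt_1 growth_ge_1[of 4] C_ge_1 by (simp add: K1_def)
  \<comment> \<open>Compares the measures of \<open>ball x (R k)\<close> and \<open>ball x r\<close>
    for \<open>d k / 2 \<le> r \<le> d k\<close>: \<open>growth (2 * \<sigma>)\<close> leads from
    \<open>R k\<close> to \<open>d k\<close>, and \<open>Cd\<close> from \<open>d k\<close> to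
    \<open>r\<close>.\<close>
  define N where "N = Cd * growth (2 * \<sigma>)"
  have N: "0 \<le> N" using Cd_ge_1 growth_ge_1[of "2 * \<sigma>"] by (simp add: N_def)
  define d where "d k = \<delta> / 2 ^ k" for k :: nat
  have d: "0 < d k" for k using \<delta> by (simp add: d_def)
  define R where "R k = 2 * \<sigma> * d k" for k
  have R: "0 < R k" for k using d \<sigma>_ge_1 by (simp add: R_def)
  \<comment> \<open>One ratio per dyadic scale: \<open>R k\<close> is large enough to contain
    \<open>ball x (2 * \<sigma> * r)\<close> for every \<open>r \<le> d k\<close>.\<close>
  define A where "A k x = emeasure ?\<nu> (ball x (R k)) / emeasure M (ball x (R k))" for k x
  have \<nu>ball: "emeasure ?\<nu> (ball x s) < \<infinity>" for x s
  proof -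
    have "UNIV \<in> sets ?\<nu>" using sets.top[of M] by simp
    then show ?thesis by (rule le_less_trans[OF emeasure_mono[OF subset_UNIV] fin])
  qed
  have \<nu>A: "emeasure ?\<nu> (ball x (R k)) = ennreal (enn2real (A k x) * measure M (ball x (R k)))" and Afin: "A k x < \<infinity>" for k x
  proof -
    have pos: "0 < measure M (ball x (R k))" by (rule measure_ball_pos[OF R])
    obtain e where e: "emeasure ?\<nu> (ball x (R k)) = ennreal e" "0 \<le> e"
      using \<nu>ball[of x "R k"] by (cases "emeasure ?\<nu> (ball x (R k))") auto
    have "A k x = ennreal (e / measure M (ball x (R k)))"
      using pos e unfolding A_def by (simp add: emeasure_ball divide_ennreal)
    then show "emeasure ?\<nu> (ball x (R k)) = ennreal (enn2real (A k x) * measure M (ball x (R k)))" "A k x < \<infinity>"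
      using pos e by auto
  qed
  define T where "T k x = (N * enn2real (A k x)) powr (1 / p)" for k x
  have p0: "0 < p" using p_gt_1 by simp
  have Tp: "T k x powr p = N * enn2real (A k x)" for k x using p0 N by (simp add: T_def powr_powr)
  define p' where "p' = p / (p - 1)"
  define a where "a k x = (2 * K1 * (d k * T k x)) powr p'" for k x
  have osc: "oscillation_integral M p h \<delta> u x \<le> (\<Sum>k. ennreal (a k x))" for x
    unfolding oscillation_integral_def
  proof (rule nn_integral_dyadic_le[OF \<delta>])
    fix k r assume r: "\<delta> / 2 ^ Suc k \<le> r" "r < \<delta> / 2 ^ k"
    have r0: "0 < r" using r(1) \<delta> by (meson divide_pos_pos less_le_trans zero_less_numeral zero_less_power)
    have rd: "r \<le> d k" "d k \<le> 2 * r" using r by (auto simp: d_def field_simps)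
    have T0: "0 \<le> T k x" by (simp add: T_def)
    have U: "emeasure ?\<nu> (ball x (2 * \<sigma> * r)) \<le> ennreal (T k x powr p * measure M (ball x r))"
    proof -
      have "2 * \<sigma> * r \<le> R k" unfolding R_def using rd \<sigma>_ge_1 by (intro mult_left_mono) auto
      then have "emeasure ?\<nu> (ball x (2 * \<sigma> * r)) \<le> emeasure ?\<nu> (ball x (R k))"
        by (intro emeasure_mono subset_ball) auto
      also have "\<dots> = ennreal (enn2real (A k x) * measure M (ball x (R k)))" by (rule \<nu>A)
      also have "\<dots> \<le> ennreal (T k x powr p * measure M (ball x r))"
      proof (intro ennreal_leI)
        have "measure M (ball x (R k)) \<le> growth (2 * \<sigma>) * measure M (ball x (d k))"
          by (rule growth_ball[OF d]) (simp add: R_def)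
        also have "measure M (ball x (d k)) \<le> measure M (ball x (2 * r))"
          using rd by (intro measure_ball_mono subset_ball) auto
        also have "\<dots> \<le> Cd * measure M (ball x r)" by (rule doubling_ball[OF r0])
        finally have "measure M (ball x (R k)) \<le> N * measure M (ball x r)"
          using growth_ge_1[of "2 * \<sigma>"] by (simp add: N_def mult_ac)
        then have "enn2real (A k x) * measure M (ball x (R k)) \<le> enn2real (A k x) * (N * measure M (ball x r))"
          by (intro mult_left_mono) auto
        then show "enn2real (A k x) * measure M (ball x (R k)) \<le> T k x powr p * measure M (ball x r)"
          unfolding Tp by (simp add: mult_ac)
      qed
      finally show ?thesis .
    qed
    have rep: "\<exists>b. u y = ereal b \<and> \<bar>b - average M (ball x r) f\<bar> \<le> K1 * (r * T k x)" if "y \<in> ball x r" for y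
      using limsup_representative_morrey[OF pp Q r0 T0 U that] unfolding u K1_def by metis
    have xb: "x \<in> ball x r" using r0 by simp
    obtain b where b: "u x = ereal b" "\<bar>b - average M (ball x r) f\<bar> \<le> K1 * (r * T k x)" using rep[OF xb] by blast
    have t0: "0 \<le> 2 * K1 * (r * T k x)" using K1 r0 T0 by simp
    have "(\<integral>\<^sup>+y\<in>ball x r. e2ennreal \<bar>u y - u x\<bar> epowr h \<partial>M)
      \<le> (\<integral>\<^sup>+y. ennreal ((2 * K1 * (r * T k x)) powr h) * indicator (ball x r) y \<partial>M)"
    proof (intro nn_integral_mono)
      fix y
      show "e2ennreal \<bar>u y - u x\<bar> epowr h * indicator (ball x r) y \<le> ennreal ((2 * K1 * (r * T k x)) powr h) * indicator (ball x r) y"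
      proof (cases "y \<in> ball x r")
        case True
        from rep[OF this] obtain b' where b': "u y = ereal b'" "\<bar>b' - average M (ball x r) f\<bar> \<le> K1 * (r * T k x)" by blast
        have "\<bar>b' - b\<bar> \<le> 2 * K1 * (r * T k x)" using b(2) b'(2) by linarith
        then show ?thesis unfolding b b' using h True by (simp only: indicator_simps mult_1_right) (intro e2ennreal_epowr_le, auto)
      qed simp
    qed
    also have "\<dots> = ennreal ((2 * K1 * (r * T k x)) powr h * 1 * measure M (ball x r))"
      by (simp add: nn_integral_cmult_indicator emeasure_ball ennreal_mult)
    finally have "nn_average M (ball x r) (\<lambda>y. e2ennreal \<bar>u y - u x\<bar> epowr h) epowr (p / (h * (p - 1)))
      \<le> ennreal (1 powr (p / (h * (p - 1))) * (2 * K1 * (r * T k x)) powr (p / (p - 1)))"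
      using h p_gt_1 t0 by (intro nn_average_epowr_le[OF r0]) auto
    also have "\<dots> \<le> ennreal (a k x)"
      unfolding a_def p'_def using K1 r0 T0 rd p_gt_1
      by (simp only: powr_one_eq_one mult_1_left) (intro ennreal_leI powr_mono2 mult_left_mono mult_right_mono, auto)
    finally show "nn_average M (ball x r) (\<lambda>y. e2ennreal \<bar>u y - u x\<bar> epowr h) epowr (p / (h * (p - 1))) \<le> ennreal (a k x)" .
  qed
  have "0 < p - 1" "0 < p / 2" using p_gt_1 by auto
  then obtain K where K: "0 \<le> K" "\<And>a :: nat \<Rightarrow> real. \<forall>k. 0 \<le> a k \<Longrightarrow>
    (\<Sum>k. ennreal (a k)) epowr (p - 1) \<le> ennreal K * (\<Sum>k. ennreal (2 powr (p / 2 * real k) * a k powr (p - 1)))"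
    by (rule suminf_epowr_le) (rule that, assumption)
  \<comment> \<open>The factor \<open>2 powr (- p * k)\<close> hidden in \<open>d k powr p\<close>
    outweighs the inserted weight \<open>2 powr (p / 2 * k)\<close>; a convergent geometric series
    remains.\<close>
  define B where "B k = (2 * K1 * \<delta>) powr p * N * (2 powr (- p / 2)) ^ k" for k :: nat
  have B0: "0 \<le> B k" for k using N by (simp add: B_def)
  have termeq: "2 powr (p / 2 * real k) * a k x powr (p - 1) = B k * enn2real (A k x)" for k x
  proof -
    have "a k x powr (p - 1) = (2 * K1 * (d k * T k x)) powr p"
      using p_gt_1 K1 d[of k] by (simp add: a_def p'_def powr_powr)
    also have "\<dots> = (2 * K1 * \<delta>) powr p * (1 / 2 ^ k) powr p * T k x powr p"
      using K1 \<delta> by (simp add: d_def T_def powr_mult[symmetric] field_simps)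
    also have "(1 / 2 ^ k) powr p = 2 powr (- p * real k)"
      by (simp add: powr_divide powr_realpow[symmetric] powr_powr powr_minus_divide mult.commute)
    finally have "2 powr (p / 2 * real k) * a k x powr (p - 1) = (2 * K1 * \<delta>) powr p * (2 powr (p / 2 * real k) * 2 powr (- p * real k)) * (N * enn2real (A k x))"
      unfolding Tp by simp
    also have "2 powr (p / 2 * real k) * 2 powr (- p * real k) = (2 powr (- p / 2)) ^ k"
      by (simp add: powr_add[symmetric] powr_realpow[symmetric] powr_powr)
    finally show ?thesis by (simp add: B_def mult_ac)
  qed
  have Am[measurable]: "A k \<in> borel_measurable M" for k
  proof -
    have "(\<lambda>x. emeasure M (ball x (R k))) \<in> borel_measurable M"
      using ball_density_measurable[of "\<lambda>_. 1" "R k"] by (simp add: density_1)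
    then show ?thesis unfolding A_def using ball_density_measurable[OF G, of "R k"] by measurable
  qed
  have "(\<integral>\<^sup>+x. oscillation_integral M p h \<delta> u x epowr (p - 1) \<partial>M) \<le> (\<integral>\<^sup>+x. ennreal K * (\<Sum>k. ennreal (B k) * A k x) \<partial>M)"
  proof (intro nn_integral_mono)
    fix x
    have "oscillation_integral M p h \<delta> u x epowr (p - 1) \<le> (\<Sum>k. ennreal (a k x)) epowr (p - 1)"
      using p_gt_1 by (intro epowr_mono osc) auto
    also have "\<dots> \<le> ennreal K * (\<Sum>k. ennreal (2 powr (p / 2 * real k) * a k x powr (p - 1)))"
      by (rule K(2)) (simp add: a_def)
    also have "(\<lambda>k. ennreal (2 powr (p / 2 * real k) * a k x powr (p - 1))) = (\<lambda>k. ennreal (B k) * A k x)"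
      unfolding termeq using B0 Afin by (auto simp: ennreal_mult less_top)
    finally show "oscillation_integral M p h \<delta> u x epowr (p - 1) \<le> ennreal K * (\<Sum>k. ennreal (B k) * A k x)" .
  qed
  also have "\<dots> = ennreal K * (\<Sum>k. ennreal (B k) * (\<integral>\<^sup>+x. A k x \<partial>M))"
    by (simp add: nn_integral_cmult nn_integral_suminf)
  also have "\<dots> \<le> ennreal K * (\<Sum>k. ennreal (B k) * (ennreal Cd * emeasure ?\<nu> UNIV))"
    unfolding A_def by (intro mult_left_mono suminf_le nn_integral_ball_ratio_le G R) auto
  also have "\<dots> = ennreal K * ((\<Sum>k. ennreal (B k)) * (ennreal Cd * emeasure ?\<nu> UNIV))"
    by (simp only: ennreal_suminf_multc)
  also have "\<dots> < \<infinity>"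
  proof -
    have "(\<Sum>k. ennreal (B k)) < \<infinity>" unfolding B_def
      using N p_gt_1 powr_less_mono[of "- p / 2" 0 2] by (intro suminf_geometric_finite) auto
    then show ?thesis using fin by (auto simp: ennreal_mult_less_top)
  qed
  finally show ?thesis .
qed

end

section \<open>Capacity of the set of high density\<close>

lemma curve_dist_le:
  assumes "curve l \<gamma>" shows "dist (\<gamma> 0) (\<gamma> l) \<le> l"
proof -
  have l: "0 < l" and len: "curve_length \<gamma> 0 l = ennreal l" using assms by (auto simp: curve_def)
  let ?t = "\<lambda>i::nat. if i = 0 then 0 else l"
  have "(1, ?t) \<in> {(n :: nat, t :: nat \<Rightarrow> real). mono_on {..n} t \<and> t ` {..n} \<subseteq> {0..l}}"
    using l by (auto simp: mono_on_def)
  then have "(case (1, ?t) of (n :: nat, t) \<Rightarrow> \<Sum>i<n. ennreal (dist (\<gamma> (t i)) (\<gamma> (t (Suc i))))) \<le> curve_length \<gamma> 0 l"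
    unfolding curve_length_def by (rule SUP_upper)
  then have "ennreal (dist (\<gamma> 0) (\<gamma> l)) \<le> ennreal l" using len by simp
  then show ?thesis using l by simp
qed

text \<open>The radius \<open>5 * \<rho>\<close> on which it equals 1 is that of the Vitali cover;
  it vanishes from distance \<open>6 * \<rho>\<close> on, so the transition region lies within the
  open ball of radius \<open>7 * \<rho>\<close>.\<close>

definition cutoff :: "'a::metric_space \<Rightarrow> real \<Rightarrow> 'a \<Rightarrow> real" where
  "cutoff y \<rho> z = max 0 (min 1 (6 - dist y z / \<rho>))"

lemma cutoff_bounds: "0 \<le> cutoff y \<rho> z" "cutoff y \<rho> z \<le> 1"
  by (auto simp: cutoff_def)

lemma cutoff_eq_1: "0 < \<rho> \<Longrightarrow> z \<in> ball y (5 * \<rho>) \<Longrightarrow> cutoff y \<rho> z = 1"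
  by (simp add: cutoff_def field_simps)

lemma cutoff_eq_0: "0 < \<rho> \<Longrightarrow> z \<notin> ball y (7 * \<rho>) \<Longrightarrow> cutoff y \<rho> z = 0"
  by (simp add: cutoff_def field_simps)

lemma cutoff_measurable [measurable]: "cutoff y \<rho> \<in> borel_measurable borel"
  unfolding cutoff_def divide_inverse by (intro borel_measurable_continuous_onI continuous_intros)

text \<open>Parameterization by arc length makes the constant \<open>1 / \<rho>\<close> an upper
  gradient of \<open>6 - dist y z / \<rho>\<close>; truncation at the heights 0 and 1 then confines
  it to the transition region.\<close>

lemma upper_gradient_cutoff:
  assumes \<rho>: "0 < \<rho>"
  shows "upper_gradient (cutoff y \<rho>) (\<lambda>z. ennreal (1 / \<rho>) * indicator (ball y (7 * \<rho>)) z)"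
  unfolding upper_gradient_def
proof (intro conjI allI impI)
  show "(\<lambda>z. ennreal (1 / \<rho>) * indicator (ball y (7 * \<rho>)) z) \<in> borel_measurable borel"
    by (intro borel_measurable_times_ennreal borel_measurable_indicator) auto
  fix l and \<gamma> :: "real \<Rightarrow> 'a" assume \<gamma>: "curve l \<gamma>"
  have int: "curve_integral l \<gamma> (\<lambda>_. ennreal (1 / \<rho>)) = ennreal (1 / \<rho> * l)" if "curve l \<gamma>" for l and \<gamma> :: "real \<Rightarrow> 'a"
    using that \<rho> by (simp add: curve_integral_def curve_def nn_integral_cmult_indicator ennreal_mult[symmetric])
  have ug: "upper_gradient (\<lambda>z. 6 - dist y z / \<rho>) (\<lambda>_. ennreal (1 / \<rho>))"
    unfolding upper_gradient_def
  proof (intro conjI allI impI)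
    fix l and \<gamma> :: "real \<Rightarrow> 'a" assume \<gamma>: "curve l \<gamma>"
    have "\<bar>(6 - dist y (\<gamma> 0) / \<rho>) - (6 - dist y (\<gamma> l) / \<rho>)\<bar> = \<bar>dist y (\<gamma> l) - dist y (\<gamma> 0)\<bar> / \<rho>"
      using \<rho> by (simp add: diff_divide_distrib[symmetric])
    also have "\<bar>dist y (\<gamma> l) - dist y (\<gamma> 0)\<bar> \<le> dist (\<gamma> 0) (\<gamma> l)"
      using dist_triangle[of y "\<gamma> l" "\<gamma> 0"] dist_triangle[of y "\<gamma> 0" "\<gamma> l"] by (simp add: dist_commute abs_le_iff)
    also have "\<dots> \<le> l" by (rule curve_dist_le[OF \<gamma>])
    finally have "\<bar>(6 - dist y (\<gamma> 0) / \<rho>) - (6 - dist y (\<gamma> l) / \<rho>)\<bar> \<le> 1 / \<rho> * l"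
      using \<rho> by (simp add: divide_right_mono)
    then show "ennreal \<bar>(6 - dist y (\<gamma> 0) / \<rho>) - (6 - dist y (\<gamma> l) / \<rho>)\<bar> \<le> curve_integral l \<gamma> (\<lambda>_. ennreal (1 / \<rho>))"
      unfolding int[OF \<gamma>] by (rule ennreal_leI)
  qed simp
  have "ennreal \<bar>max 0 (min 1 (6 - dist y (\<gamma> 0) / \<rho>)) - max 0 (min 1 (6 - dist y (\<gamma> l) / \<rho>))\<bar>
      \<le> curve_integral l \<gamma> (\<lambda>z. ennreal (1 / \<rho>) * indicator (ball y (7 * \<rho>)) z)"
  proof (rule upper_gradient_truncation_curve[OF ug \<gamma>])
    show "{z. 0 < 6 - dist y z / \<rho> \<and> 6 - dist y z / \<rho> < 1} \<subseteq> ball y (7 * \<rho>)"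
      using \<rho> by (auto simp: field_simps)
  qed (auto simp: int[OF \<gamma>])
  then show "ennreal \<bar>cutoff y \<rho> (\<gamma> 0) - cutoff y \<rho> (\<gamma> l)\<bar> \<le> curve_integral l \<gamma> (\<lambda>z. ennreal (1 / \<rho>) * indicator (ball y (7 * \<rho>)) z)"
    by (simp add: cutoff_def)
qed

text \<open>A common bound for the change of every \<open>w y\<close> along a curve also bounds the
  change of their supremum. Forming it in \<open>ennreal\<close> gives 0 for empty \<open>D\<close>,
  and as all values are at most 1 the passage back to the reals loses nothing.\<close>

lemma upper_gradient_SUP:
  fixes w :: "'i \<Rightarrow> 'a::metric_space \<Rightarrow> real"
  assumes D: "countable D" and ug: "\<And>y. y \<in> D \<Longrightarrow> upper_gradient (w y) (g y)"
    and w: "\<And>y z. 0 \<le> w y z" "\<And>y z. w y z \<le> 1"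
  shows "upper_gradient (\<lambda>z. enn2real (SUP y\<in>D. ennreal (w y z))) (\<lambda>z. SUP y\<in>D. g y z)"
  unfolding upper_gradient_def
proof (intro conjI allI impI)
  show "(\<lambda>z. SUP y\<in>D. g y z) \<in> borel_measurable borel"
    using D ug by (intro borel_measurable_SUP) (auto simp: upper_gradient_def)
  fix l and \<gamma> :: "real \<Rightarrow> 'a" assume \<gamma>: "curve l \<gamma>"
  define W where "W z = (SUP y\<in>D. ennreal (w y z))" for z
  have "W z \<le> 1" for z unfolding W_def using w by (intro SUP_least) simp
  then have fin: "W z = ennreal (enn2real (W z))" for z
    by (simp add: le_less_trans[OF _ ennreal_one_less_top])
  define I where "I = curve_integral l \<gamma> (\<lambda>z. SUP y\<in>D. g y z)"
  have le: "ennreal \<bar>w y (\<gamma> 0) - w y (\<gamma> l)\<bar> \<le> I" if "y \<in> D" for y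
  proof -
    have "ennreal \<bar>w y (\<gamma> 0) - w y (\<gamma> l)\<bar> \<le> curve_integral l \<gamma> (g y)"
      using ug[OF that] \<gamma> by (simp add: upper_gradient_def)
    also have "\<dots> \<le> I" unfolding I_def curve_integral_def
      using that by (intro nn_integral_mono mult_right_mono SUP_upper) auto
    finally show ?thesis .
  qed
  have key: "W s \<le> W t + I" if st: "\<And>y. y \<in> D \<Longrightarrow> ennreal \<bar>w y s - w y t\<bar> \<le> I" for s t
    unfolding W_def[of s]
  proof (rule SUP_least)
    fix y assume y: "y \<in> D"
    have "ennreal (w y s) \<le> ennreal (w y t + \<bar>w y s - w y t\<bar>)" by (intro ennreal_leI) simp
    also have "\<dots> = ennreal (w y t) + ennreal \<bar>w y s - w y t\<bar>" using w by (intro ennreal_plus) auto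
    also have "\<dots> \<le> W t + I" unfolding W_def using y by (intro add_mono SUP_upper st)
    finally show "ennreal (w y s) \<le> W t + I" .
  qed
  have both: "W (\<gamma> 0) \<le> W (\<gamma> l) + I" "W (\<gamma> l) \<le> W (\<gamma> 0) + I"
    using key[of "\<gamma> 0" "\<gamma> l"] key[of "\<gamma> l" "\<gamma> 0"] le by (auto simp: abs_minus_commute)
  have "ennreal \<bar>enn2real (W (\<gamma> 0)) - enn2real (W (\<gamma> l))\<bar> \<le> I"
  proof (cases I)
    case (real i)
    have "ennreal (enn2real (W (\<gamma> 0))) \<le> ennreal (enn2real (W (\<gamma> l)) + i)" "ennreal (enn2real (W (\<gamma> l))) \<le> ennreal (enn2real (W (\<gamma> 0)) + i)"
      using both fin real by (simp_all add: ennreal_plus)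
    then have "enn2real (W (\<gamma> 0)) \<le> enn2real (W (\<gamma> l)) + i" "enn2real (W (\<gamma> l)) \<le> enn2real (W (\<gamma> 0)) + i"
      using real by (auto simp: ennreal_le_iff simp del: ennreal_plus)
    then show ?thesis using real by (auto intro!: ennreal_leI simp: abs_le_iff)
  qed simp
  then show "ennreal \<bar>enn2real (SUP y\<in>D. ennreal (w y (\<gamma> 0))) - enn2real (SUP y\<in>D. ennreal (w y (\<gamma> l)))\<bar>
    \<le> curve_integral l \<gamma> (\<lambda>z. SUP y\<in>D. g y z)" by (simp add: W_def I_def)
qed

lemma epowr_inverse: "0 < a \<Longrightarrow> (x epowr (1 / a)) epowr a = x"
  by (cases x) (auto simp: epowr_def powr_powr)

lemma epowr_inverse': "0 < a \<Longrightarrow> (x epowr a) epowr (1 / a) = x"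
  by (cases x) (auto simp: epowr_def powr_powr)

text \<open>Trades the supremum of gradients for a sum of energies, so that overlaps among the
  enlarged balls do no harm.\<close>

lemma SUP_epowr_le_sum:
  assumes q: "0 < q"
  shows "(SUP y\<in>D. g y) epowr q \<le> (\<integral>\<^sup>+y. g y epowr q \<partial>count_space D)"
proof -
  let ?S = "\<integral>\<^sup>+y. g y epowr q \<partial>count_space D"
  have "(SUP y\<in>D. g y) \<le> ?S epowr (1 / q)"
  proof (rule SUP_least)
    fix y assume y: "y \<in> D"
    have "g y = (g y epowr q) epowr (1 / q)" using q by (simp add: epowr_inverse')
    also have "\<dots> \<le> ?S epowr (1 / q)" using q y by (intro epowr_mono nn_integral_ge_point) auto
    finally show "g y \<le> ?S epowr (1 / q)" .
  qed
  then have "(SUP y\<in>D. g y) epowr q \<le> (?S epowr (1 / q)) epowr q" using q by (intro epowr_mono) auto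
  then show ?thesis using q by (simp add: epowr_inverse)
qed

text \<open>The sum of \<open>\<rho> powr - q\<close> times the measure of a ball is a Hausdorff
  content of codimension \<open>q\<close>, and also the energy of the cutoffs. High density converts
  each summand into \<open>growth 7 / n\<close> times the \<nu>-mass of a selected ball, and the
  selected balls are disjoint.\<close>

lemma (in doubling_space) high_density_cover:
  fixes n :: nat
  assumes \<nu>: "sets \<nu> = sets M" and n: "0 < n"
    and E: "\<And>x. x \<in> E \<Longrightarrow> \<exists>r. 0 < r \<and> r \<le> 1 \<and> ennreal (real n * measure M (ball x r)) \<le> ennreal (r powr q) * emeasure \<nu> (ball x r)"
  obtains D \<rho> where "countable D" "\<forall>y\<in>D. 0 < \<rho> y \<and> \<rho> y \<le> 1" "E \<subseteq> (\<Union>y\<in>D. ball y (5 * \<rho> y))"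
    "(\<integral>\<^sup>+y. ennreal (\<rho> y powr - q) * emeasure M (ball y (7 * \<rho> y)) \<partial>count_space D) \<le> ennreal (growth 7 / real n) * emeasure \<nu> UNIV"
proof -
  from E obtain \<rho> where \<rho>: "\<And>y. y \<in> E \<Longrightarrow> 0 < \<rho> y" "\<And>y. y \<in> E \<Longrightarrow> \<rho> y \<le> 1"
    "\<And>y. y \<in> E \<Longrightarrow> ennreal (real n * measure M (ball y (\<rho> y))) \<le> ennreal (\<rho> y powr q) * emeasure \<nu> (ball y (\<rho> y))"
    by metis
  obtain D where D: "countable D" "D \<subseteq> E" "disjoint_family_on (\<lambda>y. ball y (\<rho> y)) D" "E \<subseteq> (\<Union>y\<in>D. ball y (5 * \<rho> y))"
    by (rule vitali_measure[OF \<rho>(1,2)])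
  have le: "ennreal (\<rho> y powr - q) * emeasure M (ball y (7 * \<rho> y)) \<le> ennreal (growth 7 / real n) * emeasure \<nu> (ball y (\<rho> y))" if "y \<in> D" for y
  proof -
    have y: "y \<in> E" using that D by auto
    have "measure M (ball y (7 * \<rho> y)) \<le> growth 7 * measure M (ball y (\<rho> y))" by (rule growth_ball[OF \<rho>(1)[OF y]]) simp
    also have "\<dots> = growth 7 / real n * (real n * measure M (ball y (\<rho> y)))" using n by simp
    finally have "\<rho> y powr - q * measure M (ball y (7 * \<rho> y)) \<le> \<rho> y powr - q * (growth 7 / real n * (real n * measure M (ball y (\<rho> y))))"
      by (intro mult_left_mono) auto
    then have "ennreal (\<rho> y powr - q * measure M (ball y (7 * \<rho> y))) \<le> ennreal (growth 7 / real n * \<rho> y powr - q * (real n * measure M (ball y (\<rho> y))))"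
      by (intro ennreal_leI) (simp only: mult_ac)
    also have "\<dots> = ennreal (growth 7 / real n * \<rho> y powr - q) * ennreal (real n * measure M (ball y (\<rho> y)))"
      by (rule ennreal_mult'') simp
    also have "\<dots> \<le> ennreal (growth 7 / real n * \<rho> y powr - q) * (ennreal (\<rho> y powr q) * emeasure \<nu> (ball y (\<rho> y)))"
      by (intro mult_left_mono \<rho> y) simp
    also have "\<dots> = ennreal (growth 7 / real n * \<rho> y powr - q * \<rho> y powr q) * emeasure \<nu> (ball y (\<rho> y))"
    proof -
      have "ennreal (growth 7 / real n * \<rho> y powr - q * \<rho> y powr q) = ennreal (growth 7 / real n * \<rho> y powr - q) * ennreal (\<rho> y powr q)"
        by (rule ennreal_mult'') simp
      then show ?thesis by (simp only: mult.assoc)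
    qed
    also have "growth 7 / real n * \<rho> y powr - q * \<rho> y powr q = growth 7 / real n"
      using \<rho>(1)[OF y] by (simp add: powr_minus)
    finally show ?thesis by (simp add: emeasure_ball ennreal_mult'')
  qed
  have "(\<integral>\<^sup>+y. ennreal (\<rho> y powr - q) * emeasure M (ball y (7 * \<rho> y)) \<partial>count_space D)
    \<le> (\<integral>\<^sup>+y. ennreal (growth 7 / real n) * emeasure \<nu> (ball y (\<rho> y)) \<partial>count_space D)"
    using le by (intro nn_integral_mono) auto
  also have "\<dots> = ennreal (growth 7 / real n) * (\<integral>\<^sup>+y. emeasure \<nu> (ball y (\<rho> y)) \<partial>count_space D)"
    by (rule nn_integral_cmult) auto
  also have "(\<integral>\<^sup>+y. emeasure \<nu> (ball y (\<rho> y)) \<partial>count_space D) = emeasure \<nu> (\<Union>y\<in>D. ball y (\<rho> y))"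
    using D \<nu> by (intro emeasure_UN_countable[symmetric]) auto
  also have "\<dots> \<le> emeasure \<nu> UNIV"
    using \<nu> sets.top[of M] by (intro emeasure_mono) auto
  finally have "(\<integral>\<^sup>+y. ennreal (\<rho> y powr - q) * emeasure M (ball y (7 * \<rho> y)) \<partial>count_space D) \<le> ennreal (growth 7 / real n) * emeasure \<nu> UNIV"
    by (simp add: mult_left_mono)
  moreover have "\<forall>y\<in>D. 0 < \<rho> y \<and> \<rho> y \<le> 1" using D(2) \<rho>(1,2) by auto
  ultimately show ?thesis using D(1,4) by (intro that)
qed

text \<open>The test function is the supremum of the cutoffs. Its gradient energy is at most
  \<open>S\<close>; so is its own integral, since it is at most 1 and vanishes off the union of the
  large balls.\<close>

lemma (in doubling_space) capacity_le_cover: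
  assumes q: "1 < q" and D: "countable D" and \<rho>: "\<And>y. y \<in> D \<Longrightarrow> 0 < \<rho> y" "\<And>y. y \<in> D \<Longrightarrow> \<rho> y \<le> 1"
    and E: "E \<subseteq> (\<Union>y\<in>D. ball y (5 * \<rho> y))"
    and fin: "(\<integral>\<^sup>+y. ennreal (\<rho> y powr - q) * emeasure M (ball y (7 * \<rho> y)) \<partial>count_space D) = S" "S < \<infinity>"
  shows "emeasure M (\<Union>y\<in>D. ball y (7 * \<rho> y)) \<le> S" "capacity M q E \<le> 2 * S"
proof -
  define V where "V = (\<Union>y\<in>D. ball y (7 * \<rho> y))"
  have V[measurable]: "V \<in> sets M" unfolding V_def using D by auto
  have "emeasure M V \<le> (\<integral>\<^sup>+y. emeasure M (ball y (7 * \<rho> y)) \<partial>count_space D)"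
    unfolding V_def using D by (intro emeasure_UN_le_count_space) auto
  also have "\<dots> \<le> S" unfolding fin(1)[symmetric]
  proof (intro nn_integral_mono)
    fix y assume "y \<in> space (count_space D)"
    then have y: "y \<in> D" by simp
    \<comment> \<open>Radii at most 1 make the weight at least 1, so the content also dominates the
      measure.\<close>
    have "\<rho> y powr 0 \<le> \<rho> y powr - q" using \<rho>[OF y] q by (intro powr_mono') auto
    then have "1 \<le> ennreal (\<rho> y powr - q)" using \<rho>(1)[OF y] ennreal_leI[of 1 "\<rho> y powr - q"] by simp
    then show "emeasure M (ball y (7 * \<rho> y)) \<le> ennreal (\<rho> y powr - q) * emeasure M (ball y (7 * \<rho> y))"
      using mult_right_mono[of 1 "ennreal (\<rho> y powr - q)" "emeasure M (ball y (7 * \<rho> y))"] by simp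
  qed
  finally have VS: "emeasure M V \<le> S" .
  then show "emeasure M (\<Union>y\<in>D. ball y (7 * \<rho> y)) \<le> S" by (simp add: V_def)
  define W where "W z = enn2real (SUP y\<in>D. ennreal (cutoff y (\<rho> y) z))" for z
  define G where "G z = (SUP y\<in>D. ennreal (1 / \<rho> y) * indicator (ball y (7 * \<rho> y)) z)" for z
  have ug: "upper_gradient W G" unfolding W_def G_def
    using D \<rho> by (intro upper_gradient_SUP upper_gradient_cutoff cutoff_bounds) auto
  have Wm: "W \<in> borel_measurable borel" unfolding W_def using D
    by (intro measurable_compose[OF borel_measurable_SUP borel_measurable_enn2real]) auto
  have SUP1: "(SUP y\<in>D. ennreal (cutoff y (\<rho> y) z)) \<le> 1" for z
    by (intro SUP_least) (use cutoff_bounds in auto)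
  have W01: "0 \<le> W z" "W z \<le> 1" for z
    using SUP1[of z] enn2real_mono[OF SUP1[of z]] by (auto simp: W_def)
  have W0: "W z = 0" if "z \<notin> V" for z
  proof -
    have "(SUP y\<in>D. ennreal (cutoff y (\<rho> y) z)) \<le> 0"
      using that \<rho> by (intro SUP_least) (auto simp: V_def cutoff_eq_0)
    then show ?thesis by (simp add: W_def)
  qed
  have W1: "1 \<le> W z" if zE: "z \<in> E" for z
  proof -
    obtain y where y: "y \<in> D" "z \<in> ball y (5 * \<rho> y)" using E zE by blast
    then have "ennreal (cutoff y (\<rho> y) z) \<le> (SUP y\<in>D. ennreal (cutoff y (\<rho> y) z))" by (intro SUP_upper)
    then have "1 \<le> (SUP y\<in>D. ennreal (cutoff y (\<rho> y) z))" using cutoff_eq_1[OF \<rho>(1)[OF y(1)] y(2)] by simp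
    then have "(SUP y\<in>D. ennreal (cutoff y (\<rho> y) z)) = 1" using SUP1[of z] by (intro antisym)
    then show ?thesis by (simp add: W_def)
  qed
  have intW: "(\<integral>\<^sup>+z. ennreal (\<bar>W z\<bar> powr q) \<partial>M) \<le> S"
  proof -
    have "(\<integral>\<^sup>+z. ennreal (\<bar>W z\<bar> powr q) \<partial>M) \<le> (\<integral>\<^sup>+z. indicator V z \<partial>M)"
    proof (intro nn_integral_mono)
      fix z
      show "ennreal (\<bar>W z\<bar> powr q) \<le> indicator V z"
        using W01[of z] W0[of z] q by (auto split: split_indicator simp: powr_le1)
    qed
    also have "\<dots> = emeasure M V" by (rule nn_integral_indicator[OF V])
    finally show ?thesis using VS by simp
  qed
  have intG: "(\<integral>\<^sup>+z. G z epowr q \<partial>M) \<le> S"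
  proof -
    have "(\<integral>\<^sup>+z. G z epowr q \<partial>M) \<le> (\<integral>\<^sup>+z. (\<integral>\<^sup>+y. (ennreal (1 / \<rho> y) * indicator (ball y (7 * \<rho> y)) z) epowr q \<partial>count_space D) \<partial>M)"
      unfolding G_def using q by (intro nn_integral_mono SUP_epowr_le_sum) auto
    also have "\<dots> = (\<integral>\<^sup>+z. (\<integral>\<^sup>+y. ennreal (\<rho> y powr - q) * indicator (ball y (7 * \<rho> y)) z \<partial>count_space D) \<partial>M)"
    proof (intro nn_integral_cong)
      fix z y assume "y \<in> space (count_space D)"
      then have "0 < \<rho> y" using \<rho> by simp
      then show "(ennreal (1 / \<rho> y) * indicator (ball y (7 * \<rho> y)) z) epowr q = ennreal (\<rho> y powr - q) * indicator (ball y (7 * \<rho> y)) z"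
        by (auto split: split_indicator simp: epowr_ennreal powr_divide powr_minus_divide)
    qed
    also have "\<dots> = (\<integral>\<^sup>+y. (\<integral>\<^sup>+z. ennreal (\<rho> y powr - q) * indicator (ball y (7 * \<rho> y)) z \<partial>M) \<partial>count_space D)"
      by (intro nn_integral_count_space_nn_integral D borel_measurable_times_ennreal borel_measurable_const borel_measurable_indicator ball_sets)
    also have "\<dots> = S" unfolding fin(1)[symmetric] by (intro nn_integral_cong nn_integral_cmult_indicator) auto
    finally show ?thesis .
  qed
  have WN: "W \<in> newton_space M q"
    unfolding newton_space_def using ug intW intG fin(2) borel_funD[OF Wm]
    by (auto intro: le_less_trans)
  have "capacity M q E \<le> newton_norm M q W epowr q"
    unfolding capacity_def using WN W1 by (intro INF_lower) auto
  also have "\<dots> = (\<integral>\<^sup>+z. ennreal (\<bar>W z\<bar> powr q) \<partial>M) + (INF g\<in>{g. upper_gradient W g}. \<integral>\<^sup>+z. g z epowr q \<partial>M)"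
    unfolding newton_norm_def using q by (intro epowr_inverse) auto
  also have "\<dots> \<le> S + S"
  proof (intro add_mono intW)
    have "(INF g\<in>{g. upper_gradient W g}. \<integral>\<^sup>+z. g z epowr q \<partial>M) \<le> (\<integral>\<^sup>+z. G z epowr q \<partial>M)"
      using ug by (intro INF_lower) auto
    then show "(INF g\<in>{g. upper_gradient W g}. \<integral>\<^sup>+z. g z epowr q \<partial>M) \<le> S" using intG by simp
  qed
  finally show "capacity M q E \<le> 2 * S" by (simp add: mult_2)
qed

text \<open>As the density exceeds every \<open>n\<close>, the content of the cover tends to 0 with
  \<open>n\<close>. Both conclusions are used: capacity zero for the final statement, and measure
  zero for identifying the representative with \<open>f\<close> almost everywhere.\<close>

lemma (in doubling_space) high_density_null:
  assumes \<nu>: "sets \<nu> = sets M" and fin: "emeasure \<nu> UNIV < \<infinity>" and q: "1 < q"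
    and E: "\<And>x n. x \<in> E \<Longrightarrow> \<exists>r. 0 < r \<and> r \<le> 1 \<and> ennreal (real n * measure M (ball x r)) \<le> ennreal (r powr q) * emeasure \<nu> (ball x r)"
  shows "capacity M q E = 0" "AE x in M. x \<notin> E"
proof -
  define N where "N = enn2real (emeasure \<nu> UNIV)"
  have N: "emeasure \<nu> UNIV = ennreal N" "0 \<le> N" using fin by (simp_all add: N_def)
  have small: "\<exists>V\<in>sets M. E \<subseteq> V \<and> emeasure M V \<le> ennreal e \<and> capacity M q E \<le> 2 * ennreal e" if e: "0 < e" for e
  proof -
    obtain n :: nat where n: "growth 7 * N / e < real n" using reals_Archimedean2 by blast
    have n0: "0 < n" using n e N(2) growth_ge_1[of 7] by (intro Nat.gr0I) (auto simp: divide_less_0_iff mult_less_0_iff)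
    obtain D \<rho> where D: "countable D" "\<forall>y\<in>D. 0 < \<rho> y \<and> \<rho> y \<le> 1" "E \<subseteq> (\<Union>y\<in>D. ball y (5 * \<rho> y))"
      and S: "(\<integral>\<^sup>+y. ennreal (\<rho> y powr - q) * emeasure M (ball y (7 * \<rho> y)) \<partial>count_space D) \<le> ennreal (growth 7 / real n) * emeasure \<nu> UNIV"
      by (rule high_density_cover[OF \<nu> n0 E])
    let ?S = "\<integral>\<^sup>+y. ennreal (\<rho> y powr - q) * emeasure M (ball y (7 * \<rho> y)) \<partial>count_space D"
    have "?S \<le> ennreal (growth 7 / real n * N)" using S unfolding N(1) ennreal_mult''[OF N(2)] .
    also have "\<dots> \<le> ennreal e" using n n0 e by (intro ennreal_leI) (simp add: field_simps)
    finally have Se: "?S \<le> ennreal e" .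
    then have Sfin: "?S < \<infinity>" by (rule le_less_trans) simp
    have \<rho>: "0 < \<rho> y" "\<rho> y \<le> 1" if "y \<in> D" for y using D(2) that by auto
    note cov = capacity_le_cover[OF q D(1) \<rho> D(3) refl Sfin]
    have "E \<subseteq> (\<Union>y\<in>D. ball y (7 * \<rho> y))"
    proof
      fix z assume "z \<in> E"
      then obtain y where "y \<in> D" "z \<in> ball y (5 * \<rho> y)" using D(3) by blast
      then show "z \<in> (\<Union>y\<in>D. ball y (7 * \<rho> y))" using \<rho>(1)[of y] by (intro UN_I[of y]) auto
    qed
    moreover have "(\<Union>y\<in>D. ball y (7 * \<rho> y)) \<in> sets M" using D(1) by auto
    moreover have "capacity M q E \<le> 2 * ennreal e" using cov(2) Se by (meson mult_left_mono order_trans zero_le)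
    ultimately show ?thesis using order_trans[OF cov(1) Se] by blast
  qed
  show "AE x in M. x \<notin> E" by (rule AE_not_in_small_covers) (use small in blast)
  have "capacity M q E \<le> 0"
  proof (rule ennreal_le_epsilon)
    fix e :: real assume e: "0 < e"
    have "capacity M q E \<le> 2 * ennreal (e / 2)" using small[of "e / 2"] e by auto
    also have "2 * ennreal (e / 2) = ennreal (2 * (e / 2))" using e by (subst ennreal_mult) auto
    finally show "capacity M q E \<le> 0 + ennreal e" by simp
  qed
  then show "capacity M q E = 0" by simp
qed

section \<open>The Sobolev case\<close>

context poincare_space
begin

text \<open>The hypothesis reaches radius 1 only. Between 1 and \<open>2 * \<sigma> * R0\<close> the
  total \<nu>-mass is finite and balls have at least the measure \<open>m1\<close> of the unit ball.
  The resulting \<open>\<kappa>\<close> depends on the point \<open>x\<close>.\<close>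

lemma density_bound_all_radii:
  assumes \<nu>: "sets \<nu> = sets M" and fin: "emeasure \<nu> UNIV < \<infinity>" and q: "0 < q"
    and good: "\<And>s. 0 < s \<Longrightarrow> s \<le> 1 \<Longrightarrow> ennreal (s powr q) * emeasure \<nu> (ball x s) \<le> ennreal (real n * measure M (ball x s))"
    and R0: "0 < R0"
  obtains \<kappa> where "0 < \<kappa>" "\<And>r. 0 < r \<Longrightarrow> r \<le> R0 \<Longrightarrow>
    emeasure \<nu> (ball x (2 * \<sigma> * r)) \<le> ennreal ((\<kappa> * r powr (- q / p)) powr p * measure M (ball x r))"
proof -
  define N where "N = enn2real (emeasure \<nu> UNIV)"
  have N: "emeasure \<nu> UNIV = ennreal N" "0 \<le> N" using fin by (simp_all add: N_def)
  define R1 where "R1 = 2 * \<sigma> * R0"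
  define m1 where "m1 = measure M (ball x 1)"
  have m1: "0 < m1" unfolding m1_def by (rule measure_ball_pos) simp
  define K where "K = real n + R1 powr q * N / m1"
  have K: "0 \<le> K" "real n \<le> K" "R1 powr q * N / m1 \<le> K" using N m1 by (auto simp: K_def)
  have bound: "emeasure \<nu> (ball x s) \<le> ennreal (K * s powr - q * measure M (ball x s))" if s: "0 < s" "s \<le> R1" for s
  proof (cases "s \<le> 1")
    case True
    have "emeasure \<nu> (ball x s) = ennreal (s powr - q * s powr q) * emeasure \<nu> (ball x s)"
      using s by (simp add: powr_minus)
    also have "\<dots> = ennreal (s powr - q) * (ennreal (s powr q) * emeasure \<nu> (ball x s))"
      by (subst ennreal_mult'') (auto simp: mult.assoc)
    also have "\<dots> \<le> ennreal (s powr - q) * ennreal (real n * measure M (ball x s))"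
      by (intro mult_left_mono good s True) simp
    also have "\<dots> = ennreal (real n * s powr - q * measure M (ball x s))"
      by (subst ennreal_mult''[symmetric]) (auto simp: mult_ac)
    also have "\<dots> \<le> ennreal (K * s powr - q * measure M (ball x s))"
      using K by (intro ennreal_leI mult_right_mono) auto
    finally show ?thesis .
  next
    case False
    have "emeasure \<nu> (ball x s) \<le> ennreal N"
      unfolding N(1)[symmetric] using \<nu> sets.top[of M] by (intro emeasure_mono) auto
    also have "\<dots> \<le> ennreal (K * s powr - q * measure M (ball x s))"
    proof (intro ennreal_leI)
      have "1 \<le> R1 powr q * s powr - q"
      proof -
        have "s powr q * s powr - q \<le> R1 powr q * s powr - q"
          using s q by (intro mult_right_mono powr_mono2) auto
        then show ?thesis using s by (simp add: powr_minus)
      qed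
      then have "N * 1 * 1 \<le> N * (R1 powr q * s powr - q) * (measure M (ball x s) / m1)"
        using False m1 N by (intro mult_mono) (auto simp: m1_def intro!: measure_ball_mono)
      also have "\<dots> = R1 powr q * N / m1 * s powr - q * measure M (ball x s)" by simp
      also have "\<dots> \<le> K * s powr - q * measure M (ball x s)" using K by (intro mult_right_mono) auto
      finally show "N \<le> K * s powr - q * measure M (ball x s)" by simp
    qed
    finally show ?thesis .
  qed
  \<comment> \<open>Doubling passes from radius \<open>2 * \<sigma> * r\<close> back to
    \<open>r\<close>; the added 1 only ensures that \<open>\<kappa>\<close> is positive.\<close>
  define L where "L = K * (2 * \<sigma>) powr - q * growth (2 * \<sigma>) + 1"
  have "0 \<le> K * (2 * \<sigma>) powr - q * growth (2 * \<sigma>)" using K growth_ge_1[of "2 * \<sigma>"] by simp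
  then have L: "0 < L" by (simp add: L_def)
  show ?thesis
  proof (rule that[of "L powr (1 / p)"])
    show "0 < L powr (1 / p)" using L by simp
    fix r assume r: "0 < r" "r \<le> R0"
    have s: "0 < 2 * \<sigma> * r" "2 * \<sigma> * r \<le> R1" using r \<sigma>_ge_1 by (auto simp: R1_def)
    have "emeasure \<nu> (ball x (2 * \<sigma> * r)) \<le> ennreal (K * (2 * \<sigma> * r) powr - q * measure M (ball x (2 * \<sigma> * r)))"
      by (rule bound[OF s])
    also have "\<dots> \<le> ennreal (K * (2 * \<sigma> * r) powr - q * (growth (2 * \<sigma>) * measure M (ball x r)))"
      using K by (intro ennreal_leI mult_left_mono growth_ball r) auto
    also have "\<dots> \<le> ennreal ((L powr (1 / p) * r powr (- q / p)) powr p * measure M (ball x r))"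
    proof (intro ennreal_leI)
      have "(2 * \<sigma> * r) powr - q = (2 * \<sigma>) powr - q * r powr - q" using \<sigma>_ge_1 r by (simp add: powr_mult)
      then have "K * (2 * \<sigma> * r) powr - q * (growth (2 * \<sigma>) * measure M (ball x r)) = (L - 1) * (r powr - q * measure M (ball x r))"
        by (simp add: L_def)
      also have "\<dots> \<le> L * (r powr - q * measure M (ball x r))" by (intro mult_right_mono) auto
      also have "\<dots> = (L powr (1 / p) * r powr (- q / p)) powr p * measure M (ball x r)"
        using L p_gt_1 by (simp add: powr_mult powr_powr)
      finally show "K * (2 * \<sigma> * r) powr - q * (growth (2 * \<sigma>) * measure M (ball x r)) \<le> (L powr (1 / p) * r powr (- q / p)) powr p * measure M (ball x r)" .
    qed
    finally show "emeasure \<nu> (ball x (2 * \<sigma> * r)) \<le> ennreal ((L powr (1 / p) * r powr (- q / p)) powr p * measure M (ball x r))" .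
  qed
qed

lemma level_of_density_bound:
  assumes \<nu>: "sets \<nu> = sets M" and \<kappa>: "0 < \<kappa>" and r: "0 < r"
    and b: "emeasure \<nu> (ball x (2 * \<sigma> * r)) \<le> ennreal ((\<kappa> * r powr (- q / p)) powr p * measure M (ball x r))"
  shows "level \<nu> x r (\<kappa> * r powr (- q / p))"
  using \<kappa> r \<sigma>_ge_1 by (intro levelI_subset[OF _ \<nu> _ ball_sets b]) (auto intro!: subset_ball)

text \<open>Halving the radius multiplies \<open>\<kappa> * r powr (- q / p)\<close> by exactly
  \<open>2 powr (q / p)\<close>, so the telescoping estimate applies with exponent
  \<open>q / p\<close>, which is below 1 because \<open>q < p\<close>.\<close>

lemma average_cauchy_of_density_bound:
  assumes pp: "poincare_pair f \<nu>" and \<kappa>: "0 < \<kappa>" and qp: "q < p"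
    and b: "\<And>r. 0 < r \<Longrightarrow> r \<le> R0 \<Longrightarrow>
    emeasure \<nu> (ball x (2 * \<sigma> * r)) \<le> ennreal ((\<kappa> * r powr (- q / p)) powr p * measure M (ball x r))"
    and r: "0 < r" "r \<le> R0" and s: "0 < s" "s \<le> r"
  shows "\<bar>average M (ball x s) f - average M (ball x r) f\<bar> \<le> telescope (q / p) * (r * (\<kappa> * r powr (- q / p)))"
proof (rule average_telescope[OF pp r(1) _ _ _ s])
  show "0 \<le> \<kappa> * r powr (- q / p)" using \<kappa> by simp
  show "q / p < 1" using qp p_gt_1 by simp
  fix k :: nat
  have \<nu>: "sets \<nu> = sets M" using pp by (simp add: poincare_pair_def)
  have "r / 2 ^ k \<le> r / 1" using r by (intro divide_left_mono) auto
  then have rk: "0 < r / 2 ^ k" "r / 2 ^ k \<le> R0" using r by auto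
  have "(r / 2 ^ k) powr (- q / p) = r powr (- q / p) * 2 powr (q / p * real k)"
    using r by (simp add: powr_divide powr_realpow[symmetric] powr_powr powr_minus_divide mult.commute)
  then show "level \<nu> x (r / 2 ^ k) (\<kappa> * r powr (- q / p) * 2 powr (q / p * real k))"
    using level_of_density_bound[OF \<nu> \<kappa> rk(1) b[OF rk]] by (simp add: mult.assoc)
qed

text \<open>Approximate continuity identifies the limit of the means along the radii
  \<open>1 / 2 ^ k\<close> as \<open>f y\<close>. The telescoping estimate carries this to all small
  radii with error \<open>2 * e k\<close>, so the upper limit is within \<open>2 * e k\<close> of
  \<open>f y\<close> for every \<open>k\<close>.\<close>

lemma limsup_representative_eq_of_density_bound:
  assumes pp: "poincare_pair f \<nu>" and \<kappa>: "0 < \<kappa>" and qp: "0 < q" "q < p"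
    and b: "\<And>r. 0 < r \<Longrightarrow> r \<le> 1 \<Longrightarrow>
    emeasure \<nu> (ball y (2 * \<sigma> * r)) \<le> ennreal ((\<kappa> * r powr (- q / p)) powr p * measure M (ball y r))"
    and ac: "approx_continuous f y"
  shows "limsup_representative M f y = ereal (f y)"
proof -
  have \<nu>: "sets \<nu> = sets M" and fi: "locally_integrable f" using pp by (auto simp: poincare_pair_def)
  define s where "s k = 1 / (2::real) ^ k" for k :: nat
  have s: "0 < s k" "s k \<le> 1" for k by (auto simp: s_def field_simps)
  have "0 < 1 - q / p" using qp p_gt_1 by simp
  define \<theta> :: real where "\<theta> = 2 powr (- (1 - q / p))"
  have \<theta>: "0 < \<theta>" "\<theta> < 1" using \<open>0 < 1 - q / p\<close> powr_less_mono[of "- (1 - q / p)" 0 2] by (auto simp: \<theta>_def)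
  have s\<theta>: "s k * (\<kappa> * s k powr (- q / p)) = \<kappa> * \<theta> ^ k" for k
  proof -
    have "s k * s k powr (- q / p) = s k powr (1 - q / p)" using s(1)[of k] by (simp add: powr_diff powr_minus_divide)
    also have "\<dots> = (2 powr (- real k)) powr (1 - q / p)" by (simp add: s_def powr_minus_divide powr_realpow)
    also have "\<dots> = \<theta> ^ k"
      by (simp add: \<theta>_def powr_realpow[symmetric] powr_powr algebra_simps)
    finally show ?thesis by (simp only: mult.left_commute[of _ \<kappa>])
  qed
  have to0: "(\<lambda>k. B * (\<kappa> * \<theta> ^ k)) \<longlonglongrightarrow> 0" for B
    using tendsto_mult_right_zero[OF LIMSEQ_realpow_zero[of \<theta>], of "B * \<kappa>"] \<theta> by (simp add: mult.assoc)
  have lim: "(\<lambda>k. average M (ball y (s k)) f) \<longlonglongrightarrow> f y"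
  proof (rule tendsto_average_approx_continuous[OF fi ac s(1)])
    show "s \<longlonglongrightarrow> 0" unfolding s_def using LIMSEQ_inverse_realpow_zero[of 2] by (simp add: inverse_eq_divide)
    show "(\<lambda>k. average M (ball y (s k)) (\<lambda>z. \<bar>f z - average M (ball y (s k)) f\<bar>)) \<longlonglongrightarrow> 0"
    proof (rule tendsto_sandwich[OF _ _ tendsto_const to0[of C]])
      show "\<forall>\<^sub>F k in sequentially. 0 \<le> average M (ball y (s k)) (\<lambda>z. \<bar>f z - average M (ball y (s k)) f\<bar>)"
        by (intro always_eventually allI average_nonneg) simp
      have "average M (ball y (s k)) (\<lambda>z. \<bar>f z - average M (ball y (s k)) f\<bar>) \<le> C * s k * (\<kappa> * s k powr (- q / p))" for k
        by (rule poincare_pairD[OF pp s(1) level_of_density_bound[OF \<nu> \<kappa> s(1) b[OF s]]])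
      then show "\<forall>\<^sub>F k in sequentially. average M (ball y (s k)) (\<lambda>z. \<bar>f z - average M (ball y (s k)) f\<bar>) \<le> C * (\<kappa> * \<theta> ^ k)"
        by (intro always_eventually allI) (simp only: mult.assoc s\<theta>)
    qed
  qed
  define e where "e k = telescope (q / p) * (\<kappa> * \<theta> ^ k)" for k
  have tel: "\<bar>average M (ball y t) f - average M (ball y (s k)) f\<bar> \<le> e k" if "0 < t" "t \<le> s k" for t k
    using average_cauchy_of_density_bound[OF pp \<kappa> qp(2) b s that] unfolding s\<theta> e_def .
  have near: "\<bar>average M (ball y t) f - f y\<bar> \<le> 2 * e k" if t: "0 < t" "t \<le> s k" for t k
  proof -
    have "(\<lambda>j. \<bar>average M (ball y (s j)) f - average M (ball y (s k)) f\<bar>) \<longlonglongrightarrow> \<bar>f y - average M (ball y (s k)) f\<bar>"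
      by (intro tendsto_intros lim)
    moreover have "\<forall>\<^sub>F j in sequentially. \<bar>average M (ball y (s j)) f - average M (ball y (s k)) f\<bar> \<le> e k"
      using eventually_ge_at_top[of k]
    proof eventually_elim
      case (elim j)
      then show ?case using s(1) by (intro tel) (auto simp: s_def field_simps)
    qed
    ultimately have "\<bar>f y - average M (ball y (s k)) f\<bar> \<le> e k" by (rule tendsto_upperbound) simp
    with tel[OF t] show ?thesis by linarith
  qed
  have rep: "\<exists>a. limsup_representative M f y = ereal a \<and> \<bar>a - f y\<bar> \<le> 2 * e k" for k
    using limsup_representative_near[OF s(1) near, of k] by metis
  then obtain a where a: "limsup_representative M f y = ereal a" by blast
  then have ae: "\<bar>a - f y\<bar> \<le> 2 * e k" for k using rep[of k] by simp
  have "(\<lambda>k. 2 * e k) \<longlonglongrightarrow> 2 * 0"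
    unfolding e_def by (intro tendsto_mult tendsto_const to0)
  then have "\<bar>a - f y\<bar> \<le> 2 * 0" by (rule LIMSEQ_le_const) (use ae in blast)
  with a show ?thesis by simp
qed

end

text \<open>After division by \<open>t\<close>, adding 1 makes the base at least 1, so the exponent
  \<open>h\<close> may be raised to \<open>P\<close>. This treats all \<open>h\<close> up to
  \<open>P\<close> at once, including \<open>h < 1\<close>, and leaves a constant plus a multiple of
  \<open>w powr P\<close>.\<close>

lemma powr_split_le:
  fixes w \<tau> t h P :: real
  assumes h: "0 < h" "h \<le> P" and w: "0 \<le> w" and \<tau>: "0 \<le> \<tau>" and t: "0 < t"
  shows "(w + \<tau> * t) powr h \<le> t powr h * 2 powr P * (1 + \<tau>) powr P + t powr h * 2 powr P * t powr - P * w powr P"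
proof -
  define s where "s = w / t"
  have s: "0 \<le> s" "w = t * s" using w t by (auto simp: s_def)
  have "(s + \<tau>) powr h \<le> (1 + s + \<tau>) powr h" using s \<tau> h by (intro powr_mono2) auto
  also have "\<dots> \<le> (1 + s + \<tau>) powr P" using s \<tau> h by (intro powr_mono) auto
  also have "\<dots> \<le> (2 * max s (1 + \<tau>)) powr P"
  proof (intro powr_mono2)
    show "1 + s + \<tau> \<le> 2 * max s (1 + \<tau>)"
      by (cases "s \<le> 1 + \<tau>") (auto simp: max_def)
  qed (use s \<tau> h in auto)
  also have "\<dots> = 2 powr P * (max s (1 + \<tau>)) powr P" using s by (simp add: powr_mult)
  also have "(max s (1 + \<tau>)) powr P \<le> (1 + \<tau>) powr P + s powr P" by (simp add: max_def)
  finally have "(s + \<tau>) powr h \<le> 2 powr P * ((1 + \<tau>) powr P + s powr P)" by simp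
  then have "t powr h * (s + \<tau>) powr h \<le> t powr h * (2 powr P * ((1 + \<tau>) powr P + s powr P))"
    by (intro mult_left_mono) auto
  moreover have "(w + \<tau> * t) powr h = t powr h * (s + \<tau>) powr h"
    using s \<tau> t by (simp add: powr_mult[symmetric] algebra_simps)
  moreover have "s powr P = t powr - P * w powr P" using w t by (simp add: s_def powr_divide powr_minus_divide)
  ultimately show ?thesis by (simp add: algebra_simps)
qed

context sobolev_space
begin

text \<open>At a point off the exceptional set, \<open>t r\<close> is a multiple of
  \<open>r powr (1 - q / p)\<close>. It controls both the distance from \<open>u x\<close> to the
  mean and, by the Sobolev-Poincare inequality, the mean of order \<open>P\<close> of the deviation
  of \<open>f\<close>. The integrand is then bounded by a positive power of \<open>t\<close>, which
  sums geometrically.\<close>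

lemma oscillation_integral_sobolev:
  assumes tr: "truncatable f \<nu>" and fin: "emeasure \<nu> UNIV < \<infinity>" and q: "1 < q" "q < p"
    and h: "0 < h" "h \<le> P" and \<delta>: "0 < \<delta>" and u: "\<And>x. u x = limsup_representative M f x"
  shows "quasievery M q (\<lambda>x. oscillation_integral M p h \<delta> u x < \<infinity>)"
proof -
  have pp: "poincare_pair f \<nu>" using tr by (simp add: truncatable_def)
  have \<nu>: "sets \<nu> = sets M" and fi: "locally_integrable f" using pp by (auto simp: poincare_pair_def)
  have fm[measurable]: "f \<in> borel_measurable M" using fi by (simp add: locally_integrable_def)
  have q0: "0 < q" using q by simp
  \<comment> \<open>The quantifier over \<open>n\<close> stands inside: outside \<open>E\<close> a
    single \<open>n\<close> bounds the density at all radii up to 1.\<close>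
  define E where "E = {x. \<forall>n::nat. \<exists>r. 0 < r \<and> r \<le> 1 \<and> ennreal (real n * measure M (ball x r)) \<le> ennreal (r powr q) * emeasure \<nu> (ball x r)}"
  have Enull: "capacity M q E = 0" "AE x in M. x \<notin> E"
    using high_density_null[OF \<nu> fin q(1), of E] unfolding E_def by auto
  have good: "\<exists>\<kappa>>0. \<forall>r. 0 < r \<and> r \<le> R0 \<longrightarrow>
    emeasure \<nu> (ball x (2 * \<sigma> * r)) \<le> ennreal ((\<kappa> * r powr (- q / p)) powr p * measure M (ball x r))"
    if x: "x \<notin> E" and R0: "0 < R0" for x R0
  proof -
    obtain n :: nat where n: "\<forall>r. \<not> (0 < r \<and> r \<le> 1 \<and> ennreal (real n * measure M (ball x r)) \<le> ennreal (r powr q) * emeasure \<nu> (ball x r))"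
      using x unfolding E_def by blast
    have "ennreal (s powr q) * emeasure \<nu> (ball x s) \<le> ennreal (real n * measure M (ball x s))" if "0 < s" "s \<le> 1" for s
      using n that by (meson linear)
    from density_bound_all_radii[OF \<nu> fin q0 this R0] show ?thesis by metis
  qed
  \<comment> \<open>Inside the integral over a ball, \<open>u y\<close> may now be replaced by
    \<open>f y\<close>, for which the Sobolev-Poincare inequality is available. The value
    \<open>u x\<close> at the centre is kept and treated by the limit of means.\<close>
  have AEu: "AE y in M. u y = ereal (f y)"
    using Enull(2) AE_approx_continuous[OF fm]
  proof eventually_elim
    case (elim y)
    obtain \<kappa> where \<kappa>: "0 < \<kappa>" "\<forall>r. 0 < r \<and> r \<le> 1 \<longrightarrow>
      emeasure \<nu> (ball y (2 * \<sigma> * r)) \<le> ennreal ((\<kappa> * r powr (- q / p)) powr p * measure M (ball y r))"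
      using good[OF elim(1), of 1] by auto
    show ?case unfolding u
      by (rule limsup_representative_eq_of_density_bound[OF pp \<kappa>(1) q0 q(2) _ elim(2)]) (use \<kappa>(2) in auto)
  qed
  obtain K where K: "0 < K" "\<And>f \<nu> x r T. \<lbrakk>truncatable f \<nu>; 0 < r; 0 < T;
    emeasure \<nu> (ball x (2 * \<sigma> * r)) \<le> ennreal (T powr p * measure M (ball x r))\<rbrakk>
    \<Longrightarrow> (\<integral>\<^sup>+y\<in>ball x r. ennreal (\<bar>f y - average M (ball x r) f\<bar> powr P) \<partial>M)
       \<le> ennreal (K * (r * T) powr P * measure M (ball x r))"
    using sobolev_poincare by blast
  define \<tau> where "\<tau> = telescope (q / p)"
  have \<tau>: "0 \<le> \<tau>" using q p_gt_1 unfolding \<tau>_def by (intro telescope_nonneg) simp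
  \<comment> \<open>Its two summands are the two terms of the splitting
    \<open>powr_split_le\<close>, the second after insertion of the Sobolev-Poincare bound.\<close>
  define A where "A = 2 powr P * (1 + \<tau>) powr P + 2 powr P * K"
  have A: "0 < A" using K(1) by (simp add: A_def add_nonneg_pos)
  have main: "oscillation_integral M p h \<delta> u x < \<infinity>" if x: "x \<notin> E" for x
  proof -
    obtain \<kappa> where \<kappa>: "0 < \<kappa>" and b: "\<And>r. 0 < r \<Longrightarrow> r \<le> \<delta> \<Longrightarrow>
      emeasure \<nu> (ball x (2 * \<sigma> * r)) \<le> ennreal ((\<kappa> * r powr (- q / p)) powr p * measure M (ball x r))"
      using good[OF x \<delta>] by auto
    define t where "t r = r * (\<kappa> * r powr (- q / p))" for r
    have qp: "0 < 1 - q / p" using q p_gt_1 by simp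
    have t_eq: "t r = \<kappa> * r powr (1 - q / p)" if "0 < r" for r
      using that by (simp add: t_def powr_diff powr_minus_divide)
    define p' where "p' = p / (p - 1)"
    have p': "0 < p'" using p_gt_1 by (simp add: p'_def)
    define B where "B = A powr (p / (h * (p - 1)))"
    have osc: "oscillation_integral M p h \<delta> u x \<le> (\<Sum>k. ennreal (B * t (\<delta> / 2 ^ k) powr p'))"
      unfolding oscillation_integral_def
    proof (rule nn_integral_dyadic_le[OF \<delta>])
      fix k r assume rk: "\<delta> / 2 ^ Suc k \<le> r" "r < \<delta> / 2 ^ k"
      have r: "0 < r" using rk(1) \<delta> by (meson divide_pos_pos less_le_trans zero_less_numeral zero_less_power)
      have "\<delta> / 2 ^ k \<le> \<delta> / 1" using \<delta> by (intro divide_left_mono) auto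
      then have r\<delta>: "r \<le> \<delta>" using rk by simp
      define m where "m = average M (ball x r) f"
      have tpos: "0 < t r" using r \<kappa> by (simp add: t_def)
      obtain a where a: "u x = ereal a" "\<bar>a - m\<bar> \<le> \<tau> * t r"
      proof (rule limsup_representative_near[OF r])
        fix s assume s: "0 < s" "s \<le> r"
        show "\<bar>average M (ball x s) f - m\<bar> \<le> \<tau> * t r"
          unfolding m_def \<tau>_def t_def by (rule average_cauchy_of_density_bound[OF pp \<kappa> q(2) b r r\<delta> s])
      qed (use u in auto)
      have "(\<integral>\<^sup>+y\<in>ball x r. e2ennreal \<bar>u y - u x\<bar> epowr h \<partial>M)
        \<le> (\<integral>\<^sup>+y. ennreal (t r powr h * 2 powr P * (1 + \<tau>) powr P) * indicator (ball x r) y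
             + ennreal (t r powr h * 2 powr P * t r powr - P) * (ennreal (\<bar>f y - m\<bar> powr P) * indicator (ball x r) y) \<partial>M)"
      proof (rule nn_integral_mono_AE)
        show "AE y in M. e2ennreal \<bar>u y - u x\<bar> epowr h * indicator (ball x r) y
          \<le> ennreal (t r powr h * 2 powr P * (1 + \<tau>) powr P) * indicator (ball x r) y
             + ennreal (t r powr h * 2 powr P * t r powr - P) * (ennreal (\<bar>f y - m\<bar> powr P) * indicator (ball x r) y)"
          using AEu
        proof eventually_elim
          case (elim y)
          have "e2ennreal \<bar>u y - u x\<bar> epowr h \<le> ennreal ((\<bar>f y - m\<bar> + \<tau> * t r) powr h)"
            unfolding elim a(1) using a(2) h by (intro e2ennreal_epowr_le) auto
          also have "\<dots> \<le> ennreal (t r powr h * 2 powr P * (1 + \<tau>) powr P + t r powr h * 2 powr P * t r powr - P * \<bar>f y - m\<bar> powr P)"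
            using h \<tau> tpos by (intro ennreal_leI powr_split_le) auto
          also have "\<dots> = ennreal (t r powr h * 2 powr P * (1 + \<tau>) powr P) + ennreal (t r powr h * 2 powr P * t r powr - P) * ennreal (\<bar>f y - m\<bar> powr P)"
            by (subst ennreal_plus) (auto simp: ennreal_mult'')
          finally show ?case by (auto split: split_indicator)
        qed
      qed
      also have "\<dots> = ennreal (t r powr h * 2 powr P * (1 + \<tau>) powr P) * emeasure M (ball x r)
        + ennreal (t r powr h * 2 powr P * t r powr - P) * (\<integral>\<^sup>+y\<in>ball x r. ennreal (\<bar>f y - m\<bar> powr P) \<partial>M)"
        by (subst nn_integral_add) (auto simp: nn_integral_cmult nn_integral_cmult_indicator)
      also have "\<dots> \<le> ennreal (t r powr h * 2 powr P * (1 + \<tau>) powr P) * emeasure M (ball x r)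
        + ennreal (t r powr h * 2 powr P * t r powr - P) * ennreal (K * t r powr P * measure M (ball x r))"
        unfolding m_def t_def using \<kappa> r by (intro add_left_mono mult_left_mono K(2)[OF tr r] b r\<delta>) auto
      also have "\<dots> = ennreal (t r powr h * A * measure M (ball x r))"
      proof -
        have "t r powr h * 2 powr P * t r powr - P * (K * t r powr P * measure M (ball x r))
          = t r powr h * 2 powr P * K * measure M (ball x r) * (t r powr - P * t r powr P)"
          by (simp only: mult_ac)
        also have "t r powr - P * t r powr P = 1" using tpos by (simp add: powr_minus)
        finally have eq: "t r powr h * 2 powr P * t r powr - P * (K * t r powr P * measure M (ball x r)) = t r powr h * 2 powr P * K * measure M (ball x r)"
          by (simp only: mult_1_right)
        define \<mu> where "\<mu> = measure M (ball x r)"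
        define X Y Z where "X = t r powr h * 2 powr P * (1 + \<tau>) powr P" and "Y = t r powr h * 2 powr P * t r powr - P"
          and "Z = K * t r powr P * \<mu>"
        have nonneg: "0 \<le> X * \<mu>" "0 \<le> Y * Z" "0 \<le> \<mu>" "0 \<le> Z" using K(1) by (auto simp: X_def Y_def Z_def \<mu>_def)
        have "ennreal X * ennreal \<mu> + ennreal Y * ennreal Z = ennreal (X * \<mu> + Y * Z)"
          unfolding ennreal_mult''[OF nonneg(3), symmetric] ennreal_mult''[OF nonneg(4), symmetric]
          by (rule ennreal_plus[OF nonneg(1,2), symmetric])
        also have "Y * Z = t r powr h * 2 powr P * K * \<mu>" unfolding Y_def Z_def \<mu>_def by (rule eq)
        also have "X * \<mu> + t r powr h * 2 powr P * K * \<mu> = t r powr h * A * \<mu>"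
          by (simp add: X_def A_def algebra_simps)
        finally show ?thesis by (simp only: X_def Y_def Z_def \<mu>_def emeasure_ball)
      qed
      finally have "nn_average M (ball x r) (\<lambda>y. e2ennreal \<bar>u y - u x\<bar> epowr h) epowr (p / (h * (p - 1)))
        \<le> ennreal (A powr (p / (h * (p - 1))) * t r powr (p / (p - 1)))"
        using tpos A h p_gt_1 by (intro nn_average_epowr_le[OF r]) auto
      also have "\<dots> \<le> ennreal (B * t (\<delta> / 2 ^ k) powr p')"
      proof -
        have "t r \<le> t (\<delta> / 2 ^ k)"
          using r rk \<delta> \<kappa> qp by (simp add: t_eq) (intro powr_mono2, auto)
        then show ?thesis using tpos p' unfolding B_def p'_def[symmetric]
          by (intro ennreal_leI mult_left_mono powr_mono2) auto
      qed
      finally show "nn_average M (ball x r) (\<lambda>y. e2ennreal \<bar>u y - u x\<bar> epowr h) epowr (p / (h * (p - 1))) \<le> ennreal (B * t (\<delta> / 2 ^ k) powr p')" .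
    qed
    define \<theta> :: real where "\<theta> = 2 powr (- ((1 - q / p) * p'))"
    have \<theta>: "0 < \<theta>" "\<theta> < 1" using qp p' powr_less_mono[of "- ((1 - q / p) * p')" 0 2] by (auto simp: \<theta>_def)
    have geom: "B * t (\<delta> / 2 ^ k) powr p' = B * (\<kappa> * \<delta> powr (1 - q / p)) powr p' * \<theta> ^ k" for k
    proof -
      have pw: "(\<delta> / 2 ^ k) powr \<gamma> = \<delta> powr \<gamma> * 2 powr (- \<gamma> * real k)" for \<gamma>
        using \<delta> by (simp add: powr_divide powr_realpow[symmetric] powr_powr powr_minus_divide mult.commute)
      have "t (\<delta> / 2 ^ k) = \<kappa> * \<delta> powr (1 - q / p) * 2 powr (- (1 - q / p) * real k)"
        unfolding t_eq[OF divide_pos_pos[OF \<delta> zero_less_power[OF zero_less_numeral]]] pw by simp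
      then have "t (\<delta> / 2 ^ k) powr p' = (\<kappa> * \<delta> powr (1 - q / p)) powr p' * (2 powr (- (1 - q / p) * real k)) powr p'"
        using \<kappa> by (simp add: powr_mult)
      also have "(2 powr (- (1 - q / p) * real k)) powr p' = \<theta> ^ k"
        by (simp add: \<theta>_def powr_realpow[symmetric] powr_powr algebra_simps)
      finally show ?thesis by (simp add: mult.assoc)
    qed
    have "(\<Sum>k. ennreal (B * t (\<delta> / 2 ^ k) powr p')) < \<infinity>"
      unfolding geom using \<theta> by (intro suminf_geometric_finite) (auto simp: B_def)
    with osc show ?thesis by (rule le_less_trans)
  qed
  show ?thesis unfolding quasievery_def using Enull(1) main by blast
qed

end

section \<open>Assembly of the two cases from the hypotheses on the space\<close>

theorem theorem4p1:
  fixes M :: "'a::complete_space measure"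
    and p q Q \<delta> :: real
    and f :: "'a \<Rightarrow> real" and u :: "'a \<Rightarrow> ereal"
  assumes "metric_measure_space M"
    and "doubling M"
    and "1 < p"
    and "supports_poincare M p"
    and "0 < Q"
    and "relative_lower_volume_decay M Q"
    and "0 < \<delta>"
    and "1 < q" and "q < p"
    and "f \<in> newton_space M p"
    and "\<And>x. u x = limsup_representative M f x"
  shows "(\<forall>h::real. (p < Q \<and> 0 < h \<and> h \<le> Q * p / (Q - p)) \<or> (p = Q \<and> 0 < h) \<longrightarrow>
            quasievery M q (\<lambda>x. oscillation_integral M p h \<delta> u x < \<infinity>))
       \<and> (\<forall>h::real. p > Q \<and> 0 < h \<longrightarrow>
            (\<integral>\<^sup>+x. oscillation_integral M p h \<delta> u x epowr (p - 1) \<partial>M) < \<infinity>)"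
proof -
  interpret metric_measure_space M by fact
  obtain C1 where C1: "0 < C1" "\<And>x r. 0 < r \<Longrightarrow> measure M (ball x (2 * r)) \<le> C1 * measure M (ball x r)"
    using assms(2) unfolding doubling_def by blast
  define Cd where "Cd = max 1 C1"
  interpret doubling_space M Cd
  proof
    fix x :: 'a and r :: real assume "0 < r"
    from C1(2)[OF this] show "measure M (ball x (2 * r)) \<le> Cd * measure M (ball x r)"
      by (rule order_trans) (auto simp: Cd_def intro!: mult_right_mono)
  qed (simp add: Cd_def)
  obtain C0 \<sigma> where C0: "0 < C0" and \<sigma>: "1 \<le> \<sigma>" and poin: "\<And>x r u g. 0 < r \<Longrightarrow> integrable M u \<Longrightarrow> weak_upper_gradient M p u g \<Longrightarrow>
     ennreal (average M (ball x r) (\<lambda>y. \<bar>u y - average M (ball x r) u\<bar>))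
       \<le> ennreal (C0 * diameter (ball x r)) * (nn_average M (ball x (\<sigma> * r)) (\<lambda>y. g y epowr p)) epowr (1 / p)"
    using assms(4) unfolding supports_poincare_def by blast
  obtain c where c: "0 < c" and decay: "\<And>x R y r. y \<in> ball x R \<Longrightarrow> 0 < r \<Longrightarrow> r \<le> R \<Longrightarrow>
     measure M (ball y r) / measure M (ball x R) \<ge> c * (r / R) powr Q"
    using assms(6) unfolding relative_lower_volume_decay_def by blast
  \<comment> \<open>The order of volume decay may be raised, because \<open>r / R \<le> 1\<close>.
    The case \<open>p = Q\<close> relies on this to enter the Sobolev range.\<close>
  have decay': "c * (r / R) powr Q' * measure M (ball x R) \<le> measure M (ball y r)"
    if "y \<in> ball x R" "0 < r" "r \<le> R" "Q \<le> Q'" for x y r R Q'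
  proof -
    have "0 < measure M (ball x R)" using that by (intro measure_ball_pos) auto
    then have "c * (r / R) powr Q * measure M (ball x R) \<le> measure M (ball y r)"
      using decay[OF that(1-3)] by (simp add: field_simps)
    moreover have "(r / R) powr Q' \<le> (r / R) powr Q" using that by (intro powr_mono') auto
    then have "c * (r / R) powr Q' * measure M (ball x R) \<le> c * (r / R) powr Q * measure M (ball x R)"
      using c by (intro mult_right_mono mult_left_mono) auto
    ultimately show ?thesis by simp
  qed
  interpret poincare_space M Cd p "1 + 2 * C0" \<sigma>
    using assms(3) C0 \<sigma> by unfold_locales auto
  have fm: "f \<in> borel_measurable M" and fp: "(\<integral>\<^sup>+x. ennreal (\<bar>f x\<bar> powr p) \<partial>M) < \<infinity>"
    using assms(10) by (auto simp: newton_space_def)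
  obtain g where g: "upper_gradient f g" "(\<integral>\<^sup>+x. g x epowr p \<partial>M) < \<infinity>"
    using assms(10) by (auto simp: newton_space_def)
  have gm[measurable]: "g \<in> borel_measurable M" using g(1) by (intro borel_funD) (simp add: upper_gradient_def)
  define G where "G y = g y epowr p" for y
  have Gm: "G \<in> borel_measurable M" unfolding G_def by measurable
  have fin: "emeasure (density M G) UNIV < \<infinity>"
    using g(2) Gm sets.top[of M] by (simp add: emeasure_density G_def)
  have fi: "locally_integrable f" using assms(3) by (intro locally_integrable_powr[OF fm _ fp]) simp
  have pair: "poincare_pair f (density M G)"
    unfolding G_def by (rule poincare_pair_weak_upper_gradient[OF assms(3) C0 \<sigma> poin fi weak_upper_gradient_upper_gradient[OF g]])
  have sobolev: "quasievery M q (\<lambda>x. oscillation_integral M p h \<delta> u x < \<infinity>)"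
    if Q': "Q \<le> Q'" "p < Q'" and h: "0 < h" "h \<le> Q' * p / (Q' - p)" for Q' h
  proof -
    interpret S: sobolev_space M Cd p "1 + 2 * C0" \<sigma> c Q'
      using c Q' assms(5) decay' by unfold_locales auto
    have "S.truncatable f (density M G)"
      unfolding S.truncatable_def
    proof (intro conjI allI impI pair)
      fix m a b :: real assume "0 < a \<and> a < b"
      then have ab: "a < b" by simp
      show "poincare_pair (\<lambda>y. max a (min b \<bar>f y - m\<bar>))
        (density (density M G) (indicator {y. a < \<bar>f y - m\<bar> \<and> \<bar>f y - m\<bar> < b}))"
        unfolding G_def by (rule poincare_pair_truncation[OF assms(3) C0 \<sigma> poin fm g ab])
    qed
    then show ?thesis
      using h by (intro S.oscillation_integral_sobolev[OF _ fin assms(8,9) h(1) _ assms(7) assms(11)]) (simp_all add: S.P_def)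
  qed
  show ?thesis
  proof (intro conjI allI impI)
    fix h :: real assume *: "(p < Q \<and> 0 < h \<and> h \<le> Q * p / (Q - p)) \<or> (p = Q \<and> 0 < h)"
    show "quasievery M q (\<lambda>x. oscillation_integral M p h \<delta> u x < \<infinity>)"
    proof (cases "p < Q")
      case True
      with * show ?thesis by (intro sobolev[of Q]) auto
    next
      case False
      with * have pQ: "p = Q" and h: "0 < h" by auto
      have p0: "0 < p" using assms(3) by simp
      \<comment> \<open>Chosen so that \<open>Q' > p\<close> and the critical exponent for
        \<open>Q'\<close> equals \<open>h + p\<close>, hence exceeds the given
        \<open>h\<close>.\<close>
      define Q' where "Q' = p + p * p / h"
      have "Q' * p / (Q' - p) = h + p" using p0 h by (simp add: Q'_def field_simps)
      then show ?thesis using p0 h pQ by (intro sobolev[of Q']) (auto simp: Q'_def)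
    qed
  next
    fix h :: real assume *: "p > Q \<and> 0 < h"
    interpret D: poincare_decay_space M Cd p "1 + 2 * C0" \<sigma> c Q
      using c assms(5) decay'[where Q'=Q] by unfold_locales auto
    show "(\<integral>\<^sup>+x. oscillation_integral M p h \<delta> u x epowr (p - 1) \<partial>M) < \<infinity>"
      using * by (intro D.oscillation_integral_morrey[OF Gm fin pair _ _ assms(7,11)]) auto
  qed
qed

end
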